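(* Let $(\mathcal X,d,\mu)$ be a separable, upper doubling, geometrically doubling metric measure space with $\mu(\{x\})=0$ for all $x\in\mathcal X$, and let $T$ be a Calderón–Zygmund operator whose kernel is a standard kernel. Then the following statements are equivalent: (i) $T$ is bounded on $L^2(\mu)$; namely, there exists a positive constant $C$ such that $\|Tf\|_{L^2(\mu)}\le C\|f\|_{L^2(\mu)}$ for all $f\in L^2(\mu)$. (ii) $T$ is bounded on $L^p(\mu)$ for some $p\in(1,\infty)$; namely, there exist $p\in(1,\infty)$ and a positive constant $C(p)$, depending on $p$, such that $\|Tf\|_{L^p(\mu)}\le C(p)\|f\|_{L^p(\mu)}$ for all $f\in L^p(\mu)$. (iii) $T$ is bounded from $L^1(\mu)$ to $L^{1,\infty}(\mu)$; namely, there exists a positive constant $\widetilde C$ such that $\|Tf\|_{L^{1,\infty}(\mu)}\le\widetilde C\|f\|_{L^1(\mu)}$ for all $f\in L^1(\mu)$.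
   Context: Setting. $(\mathcal X,d)$ is a separable metric space, $B(x,r)=\{y\in\mathcal X: d(x,y)<r\}$, and $\mu$ is a nonnegative Borel measure on $\mathcal X$ such that: - (upper doubling) there are a dominating function $\lambda:\mathcal X\times(0,\infty)\to(0,\infty)$ and a constant $C_\lambda>0$ such that for each $x$ the map $r\mapsto\lambda(x,r)$ is non-decreasing, and $\mu(B(x,r))\le\lambda(x,r)\le C_\lambda\lambda(x,r/2)$ for all $x\in\mathcal X$, $r\in(0,\infty)$; moreover $\lambda$ is always assumed to satisfy, for some constant $\widetilde C_\lambda>0$, $\lambda(x,r)\le\widetilde C_\lambda\lambda(y,r)$ whenever $d(x,y)\le r$; - (geometrically doubling) there is $N_0\in\{1,2,\dots\}$ such that every ball $B(x,r)$ can be covered by at most $N_0$ balls of radius $r/2$; - (non-atomic condition) $\mu(\{x\})=0$ for all $x\in\mathcal X$. Standard kernel: a map $K:(\mathcal X\times\mathcal X)\setminus\{(x,x):x\in\mathcal X\}\to\mathbb C$ for which there are constants $\tau\in(0,1]$ and $C>0$ with $|K(x,y)|\le C/\lambda(x,d(x,y))$ for all $x\ne y$, and $|K(x,y)-K(\tilde x,y)|+|K(y,x)-K(y,\tilde x)|\le C\,\dfrac{d(x,\tilde x)^\tau}{d(x,y)^\tau\lambda(x,d(x,y))}$ for all $x,\tilde x,y$ with $x\neq y$ and $d(x,y)\ge2d(x,\tilde x)$. Calderón–Zygmund operator with kernel $K$: a linear operator $T$ such that for all $f\in L^\infty_b(\mu)$ (bounded functions with bounded support) and all $x\notin\operatorname{supp}f$,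 $Tf(x)=\int_{\mathcal X}K(x,y)f(y)\,d\mu(y)$. Here $\operatorname{supp}f$ is the smallest closed set $F$ such that $f$ vanishes $\mu$-a.e. on $\mathcal X\setminus F$. Convention: $T$ is defined initially on $L^\infty_b(\mu)$ with values in (classes of) $\mu$-measurable functions, and whenever it is bounded in some $L^p$ or weak-type sense, $T$ also denotes its unique continuous extension to the corresponding $L^p(\mu)$. $\|g\|_{L^{p,\infty}(\mu)}=\sup_{t>0}t\,\mu(\{x:|g(x)|>t\})^{1/p}$. *)

theory Defs
  imports "HOL-Analysis.Analysis"
begin

text \<open>
  A separable metric space is a type of sort \<open>{metric_space, second_countable_topology}\<close>;
  for metric spaces the class assumption is separability:
\<close>

lemma second_countable_iff_separable:
  "(\<exists>B :: 'a::metric_space set set. countable B \<and> open = generate_topology B)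
    \<longleftrightarrow> (\<exists>D :: 'a set. countable D \<and> closure D = UNIV)"
proof
  assume "\<exists>B :: 'a set set. countable B \<and> open = generate_topology B"
  then interpret second_countable_topology "open :: 'a set \<Rightarrow> bool"
    by unfold_locales
  obtain D :: "'a set" where D: "countable D" "\<And>X. open X \<Longrightarrow> X \<noteq> {} \<Longrightarrow> \<exists>d\<in>D. d \<in> X"
    using countable_dense_exists by auto
  have "closure D = UNIV"
    using D(2)[of "- closure D"] closure_subset[of D] by blast
  with D(1) show "\<exists>D :: 'a set. countable D \<and> closure D = UNIV" by blast
next
  assume "\<exists>D :: 'a set. countable D \<and> closure D = UNIV"
  then obtain D :: "'a set" where D: "countable D" "closure D = UNIV" by blast
  define B where "B = (\<lambda>(d, q). ball d q) ` (D \<times> (\<rat> :: real set))"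
  have cB: "countable B" unfolding B_def using D(1) countable_rat by auto
  have "topological_basis B"
  proof (rule topological_basisI)
    show "open U" if "U \<in> B" for U using that by (auto simp: B_def)
  next
    fix U :: "'a set" and x assume "open U" "x \<in> U"
    then obtain e where e: "e > 0" "ball x e \<subseteq> U" by (meson openE)
    obtain q where q: "q \<in> \<rat>" "e / 4 < q" "q < e / 2"
      using Rats_dense_in_real[of "e/4" "e/2"] e(1) by auto
    have "x \<in> closure D" using D(2) by simp
    then obtain d where d: "d \<in> D" "dist d x < e / 4"
      using closure_approachable[of x D] e(1) by (meson divide_pos_pos zero_less_numeral)
    have "ball d q \<subseteq> ball x e"
    proof
      fix y assume "y \<in> ball d q"
      then show "y \<in> ball x e"
        using dist_triangle[of x y d] d(2) q(3) e(1) by (simp add: dist_commute)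
    qed
    moreover have "x \<in> ball d q" using d(2) q(2) by simp
    moreover have "ball d q \<in> B" unfolding B_def using d(1) q(1) by auto
    ultimately show "\<exists>B'\<in>B. x \<in> B' \<and> B' \<subseteq> U" using e(2) by blast
  qed
  then have "open = generate_topology B" by (rule topological_basis_imp_subbasis)
  with cB show "\<exists>B :: 'a set set. countable B \<and> open = generate_topology B" by blast
qed

text \<open>
  The dominating function is written \<open>\<Lambda>\<close>, since \<open>\<lambda>\<close> is reserved for
  abstraction.  Only its values at positive radii are constrained or used.
\<close>

definition upper_doubling :: "'a::metric_space measure \<Rightarrow> ('a \<Rightarrow> real \<Rightarrow> real) \<Rightarrow> bool" where
  "upper_doubling \<mu> \<Lambda> \<longleftrightarrow>
     (\<forall>x. \<forall>r>0. \<Lambda> x r > 0) \<and>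
     (\<forall>x. mono_on {0<..} (\<Lambda> x)) \<and>
     (\<forall>x. \<forall>r>0. emeasure \<mu> (ball x r) \<le> ennreal (\<Lambda> x r)) \<and>
     (\<exists>C>0. \<forall>x. \<forall>r>0. \<Lambda> x r \<le> C * \<Lambda> x (r / 2)) \<and>
     (\<exists>C>0. \<forall>x y. \<forall>r>0. dist x y \<le> r \<longrightarrow> \<Lambda> x r \<le> C * \<Lambda> y r)"

definition geometrically_doubling :: "'a::metric_space itself \<Rightarrow> bool" where
  "geometrically_doubling (_ :: 'a itself) \<longleftrightarrow>
     (\<exists>N\<ge>1. \<forall>x::'a. \<forall>r>0. \<exists>Y. finite Y \<and> card Y \<le> N \<and> ball x r \<subseteq> (\<Union>y\<in>Y. ball y (r / 2)))"

text \<open>The value of a kernel on the diagonal is irrelevant everywhere below.\<close>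

definition standard_kernel ::
    "('a::metric_space \<Rightarrow> real \<Rightarrow> real) \<Rightarrow> ('a \<Rightarrow> 'a \<Rightarrow> complex) \<Rightarrow> bool" where
  "standard_kernel \<Lambda> K \<longleftrightarrow>
     (\<exists>\<tau> C. 0 < \<tau> \<and> \<tau> \<le> 1 \<and> C > 0 \<and>
        (\<forall>x y. x \<noteq> y \<longrightarrow> norm (K x y) \<le> C / \<Lambda> x (dist x y)) \<and>
        (\<forall>x x' y. x \<noteq> y \<and> dist x y \<ge> 2 * dist x x' \<longrightarrow>
           norm (K x y - K x' y) + norm (K y x - K y x')
             \<le> C * (dist x x' powr \<tau> / (dist x y powr \<tau> * \<Lambda> x (dist x y)))))"

definition supp :: "'a::metric_space measure \<Rightarrow> ('a \<Rightarrow> complex) \<Rightarrow> 'a set" where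
  "supp \<mu> f = \<Inter>{F. closed F \<and> (AE x in \<mu>. x \<notin> F \<longrightarrow> f x = 0)}"

text \<open>By separability the intersection belongs to the family, so it is its least element.\<close>

lemma supp_least:
  fixes f :: "'a::{metric_space, second_countable_topology} \<Rightarrow> complex"
  shows "closed (supp \<mu> f)"
    and "AE x in \<mu>. x \<notin> supp \<mu> f \<longrightarrow> f x = 0"
    and "\<And>F. closed F \<Longrightarrow> AE x in \<mu>. x \<notin> F \<longrightarrow> f x = 0 \<Longrightarrow> supp \<mu> f \<subseteq> F"
proof -
  let ?\<F> = "{F. closed F \<and> (AE x in \<mu>. x \<notin> F \<longrightarrow> f x = 0)}"
  show "closed (supp \<mu> f)" unfolding supp_def by (intro closed_Inter) auto
  show "\<And>F. closed F \<Longrightarrow> AE x in \<mu>. x \<notin> F \<longrightarrow> f x = 0 \<Longrightarrow> supp \<mu> f \<subseteq> F"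
    unfolding supp_def by auto
  obtain \<G> where \<G>: "\<G> \<subseteq> uminus ` ?\<F>" "countable \<G>" "\<Union>\<G> = \<Union>(uminus ` ?\<F>)"
    using Lindelof[of "uminus ` ?\<F>"] by (auto simp: open_Compl)
  have "AE x in \<mu>. \<forall>G\<in>\<G>. x \<in> G \<longrightarrow> f x = 0"
  proof (subst AE_ball_countable[OF \<G>(2)], intro ballI)
    fix G assume "G \<in> \<G>"
    then obtain F where "F \<in> ?\<F>" "G = - F" using \<G>(1) by blast
    then show "AE x in \<mu>. x \<in> G \<longrightarrow> f x = 0" by auto
  qed
  moreover have "- supp \<mu> f = \<Union>\<G>" unfolding supp_def \<G>(3) by auto
  ultimately show "AE x in \<mu>. x \<notin> supp \<mu> f \<longrightarrow> f x = 0"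
    by (elim AE_mp, intro AE_I2) blast
qed

definition Linf_b :: "'a::metric_space measure \<Rightarrow> ('a \<Rightarrow> complex) set" where
  "Linf_b \<mu> = {f \<in> borel_measurable \<mu>. (\<exists>B. AE x in \<mu>. norm (f x) \<le> B) \<and> bounded (supp \<mu> f)}"

text \<open>
  Norms are \<open>ennreal\<close>-valued, so that \<open>\<infinity>\<close> records the failure of integrability
  and a norm inequality with finite right-hand side includes membership of the left-hand
  side in the corresponding space.
\<close>

definition enn_powr :: "ennreal \<Rightarrow> real \<Rightarrow> ennreal" where
  "enn_powr a r = (if a = \<infinity> then \<infinity> else ennreal (enn2real a powr r))"

definition Lp_norm :: "'a measure \<Rightarrow> real \<Rightarrow> ('a \<Rightarrow> complex) \<Rightarrow> ennreal" where
  "Lp_norm \<mu> p f = enn_powr (\<integral>\<^sup>+x. ennreal (norm (f x) powr p) \<partial>\<mu>) (1 / p)"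

definition Lp_space :: "'a measure \<Rightarrow> real \<Rightarrow> ('a \<Rightarrow> complex) set" where
  "Lp_space \<mu> p = {f \<in> borel_measurable \<mu>. Lp_norm \<mu> p f < \<infinity>}"

definition weak_Lp_norm :: "'a measure \<Rightarrow> real \<Rightarrow> ('a \<Rightarrow> complex) \<Rightarrow> ennreal" where
  "weak_Lp_norm \<mu> p f =
     (SUP t\<in>{0<..}. ennreal t * enn_powr (emeasure \<mu> {x \<in> space \<mu>. norm (f x) > t}) (1 / p))"

text \<open>
  Operators act on representatives; the second clause makes them well defined on
  \<open>\<mu>\<close>-a.e. classes.
\<close>

definition linear_operator_on ::
    "'a measure \<Rightarrow> ('a \<Rightarrow> complex) set \<Rightarrow> (('a \<Rightarrow> complex) \<Rightarrow> 'a \<Rightarrow> complex) \<Rightarrow> bool" where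
  "linear_operator_on \<mu> V T \<longleftrightarrow>
     (\<forall>f\<in>V. T f \<in> borel_measurable \<mu>) \<and>
     (\<forall>f\<in>V. \<forall>g\<in>V. (AE x in \<mu>. f x = g x) \<longrightarrow> (AE x in \<mu>. T f x = T g x)) \<and>
     (\<forall>f\<in>V. \<forall>g\<in>V. \<forall>a b.
        AE x in \<mu>. T (\<lambda>y. a * f y + b * g y) x = a * T f x + b * T g x)"

definition CZ_operator ::
    "'a::metric_space measure \<Rightarrow> ('a \<Rightarrow> 'a \<Rightarrow> complex) \<Rightarrow>
     (('a \<Rightarrow> complex) \<Rightarrow> 'a \<Rightarrow> complex) \<Rightarrow> bool" where
  "CZ_operator \<mu> K T \<longleftrightarrow>
     linear_operator_on \<mu> (Linf_b \<mu>) T \<and>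
     (\<forall>f\<in>Linf_b \<mu>. AE x in \<mu>. x \<notin> supp \<mu> f \<longrightarrow> T f x = (\<integral>y. K x y * f y \<partial>\<mu>))"

text \<open>
  \<open>S\<close> is an extension of \<open>T\<close> from \<open>Linf_b \<mu>\<close> to \<open>V\<close>.  When \<open>V\<close> is an
  \<open>L\<^sup>p\<close> space and \<open>S\<close> satisfies a strong or weak type norm inequality on \<open>V\<close>, linearity
  makes \<open>S\<close> continuous, and since \<open>Linf_b \<mu>\<close> is dense in \<open>V\<close> it is then the unique
  continuous extension of \<open>T\<close>.
\<close>

definition linear_extension ::
    "'a::metric_space measure \<Rightarrow> (('a \<Rightarrow> complex) \<Rightarrow> 'a \<Rightarrow> complex) \<Rightarrow>
     ('a \<Rightarrow> complex) set \<Rightarrow> (('a \<Rightarrow> complex) \<Rightarrow> 'a \<Rightarrow> complex) \<Rightarrow> bool" where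
  "linear_extension \<mu> T V S \<longleftrightarrow>
     linear_operator_on \<mu> V S \<and> (\<forall>f\<in>Linf_b \<mu>. AE x in \<mu>. S f x = T f x)"

definition bounded_on_Lp ::
    "'a::metric_space measure \<Rightarrow> real \<Rightarrow> (('a \<Rightarrow> complex) \<Rightarrow> 'a \<Rightarrow> complex) \<Rightarrow> bool" where
  "bounded_on_Lp \<mu> p T \<longleftrightarrow>
     (\<exists>S C. linear_extension \<mu> T (Lp_space \<mu> p) S \<and> C > 0 \<and>
        (\<forall>f\<in>Lp_space \<mu> p. Lp_norm \<mu> p (S f) \<le> ennreal C * Lp_norm \<mu> p f))"

definition bounded_L1_weak_L1 ::
    "'a::metric_space measure \<Rightarrow> (('a \<Rightarrow> complex) \<Rightarrow> 'a \<Rightarrow> complex) \<Rightarrow> bool" where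
  "bounded_L1_weak_L1 \<mu> T \<longleftrightarrow>
     (\<exists>S C. linear_extension \<mu> T (Lp_space \<mu> 1) S \<and> C > 0 \<and>
        (\<forall>f\<in>Lp_space \<mu> 1. weak_Lp_norm \<mu> 1 (S f) \<le> ennreal C * Lp_norm \<mu> 1 f))"

end

theory Submission
  imports Defs
begin

text \<open>
  Fix the ladder of balls \<open>B(x, 32\<^sup>j r)\<close>.  Almost every point has arbitrarily small doubling
  balls, and above any ball there is a next doubling ball \<open>R\<close> such that
  \<open>\<Sum> \<mu>(B(x, 32\<^sup>j r)) / \<Lambda> x (32\<^sup>j r)\<close>, summed over the scales up to \<open>R\<close>, is bounded by an
  absolute constant; so the part of a singular integral living between a ball and its next
  doubling ball is harmless.

  \<open>L\<^sup>p\<close> implies weak type (1,1) by Tolsa's nonhomogeneous Calderon--Zygmund decomposition: the bad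
  part \<open>b\<close> on a stopping ball is balanced by a multiple \<open>\<phi>\<close> of an indicator function that lives on
  the next doubling ball, where the \<open>L\<^sup>p\<close> bound controls \<open>T \<phi>\<close>.  Besicovitch's covering theorem is not
  available; Vitali coverings and an exceptional set made of dilated stopping balls replace it.
  The stopping condition uses the weight \<open>1\<^sub>G |f| / t + 1\<^sub>U\<close>, \<open>G = {|f| > t}\<close>, with an open \<open>U \<supseteq> G\<close> of comparable
  measure, which makes a differentiation theorem unnecessary.

  Weak type (1,1) implies \<open>L\<^sup>2\<close> by a good lambda inequality between \<open>|T f|\<close> and a maximal function of
  \<open>f\<close>: \<open>T f\<close> on a stopping ball is compared with its value at a point of the next doubling ball
  where \<open>|T f|\<close> is small.  No truncated singular integrals are needed.

  The extensions to \<open>L\<^sup>p\<close> are limits in measure along approximations by bounded functions.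
\<close>

subsection \<open>Coverings and outer regularity\<close>

text \<open>The obstacle is that \<open>\<mu>\<close> need not be doubling: dilating a ball, as a
  Vitali covering does, may increase its measure without control. The loss is repaid only at a ball
  \<open>B(x, R)\<close> with \<open>m x (1024 * R) \<le> \<beta> * m x R\<close>. Two steps of
  ratio 32 are needed there, because the stopping inequality on \<open>B(x, 32 R)\<close> already
  has \<open>m x (1024 * R)\<close> on its right-hand side. The ratio 32 leaves room for the dilates
  in use: 3 from the covering, 8 to separate a point from the support of a piece, and 4 in the
  denominator of the maximal function, with \<open>4 * 8 = 32\<close>. The threshold
  \<open>1 / (4 * \<beta>)\<close> becomes density at most 1/4 on the doubling ball, so half of it
  survives even if another quarter has to be discarded. Choosing the largest admissible stopping
  radius requires that some ball have large measure. If none has, the measure of the whole space is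
  comparable to the quantity to be estimated and the claim follows directly; both directions split
  into these two cases. All estimates are made for \<open>T\<close> on bounded functions with
  bounded support.\<close>

text \<open>A greedy choice: a ball of maximal radius is kept, and every ball meeting it lies in its
  threefold dilate, so those are discarded before the induction continues. In a finite family the
  maximum is attained, which is why the factor is exactly 3.\<close>

lemma finite_Vitali:
  fixes x :: "'i \<Rightarrow> 'a::metric_space" and r :: "'i \<Rightarrow> real"
  assumes "finite I"
  obtains J where "J \<subseteq> I" "disjoint_family_on (\<lambda>i. ball (x i) (r i)) J"
    "(\<Union>i\<in>I. ball (x i) (r i)) \<subseteq> (\<Union>j\<in>J. ball (x j) (3 * r j))"
proof -
  have "\<exists>J\<subseteq>I. disjoint_family_on (\<lambda>i. ball (x i) (r i)) J \<and>
    (\<Union>i\<in>I. ball (x i) (r i)) \<subseteq> (\<Union>j\<in>J. ball (x j) (3 * r j))"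
    using assms
  proof (induction I rule: finite_psubset_induct)
    case (psubset I)
    show ?case
    proof (cases "I = {}")
      case False
      then obtain k where k: "k \<in> I" "\<And>i. i \<in> I \<Longrightarrow> r i \<le> r k"
        using psubset.hyps obtains_MAX[of I r] by (metis Max_ge finite_imageI imageI)
      define I' where "I' = {i \<in> I - {k}. ball (x i) (r i) \<inter> ball (x k) (r k) = {}}"
      have "I' \<subset> I" using k(1) by (auto simp: I'_def)
      from psubset.IH[OF this] obtain J where J: "J \<subseteq> I'"
        "disjoint_family_on (\<lambda>i. ball (x i) (r i)) J"
        "(\<Union>i\<in>I'. ball (x i) (r i)) \<subseteq> (\<Union>j\<in>J. ball (x j) (3 * r j))" by blast
      have "disjoint_family_on (\<lambda>i. ball (x i) (r i)) (insert k J)"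
        using J(1,2) unfolding disjoint_family_on_def I'_def by blast
      moreover have "ball (x i) (r i) \<subseteq> (\<Union>j\<in>insert k J. ball (x j) (3 * r j))" if i: "i \<in> I" for i
      proof (cases "i \<in> I'")
        case True
        then show ?thesis using J(3) by auto
      next
        case False
        have "ball (x i) (r i) \<subseteq> ball (x k) (3 * r k)"
        proof (cases "i = k")
          case True
          \<comment> \<open>Radii may be negative; then \<open>3 * r k\<close> is smaller than
            \<open>r k\<close>, but the ball is empty.\<close>
          show ?thesis
          proof (cases "r k \<ge> 0")
            case True
            then show ?thesis using \<open>i = k\<close> by (auto intro!: subset_ball)
          next
            case False
            then show ?thesis using \<open>i = k\<close> by (simp add: ball_empty)
          qed
        next
          case ne: False
          then obtain z where z: "z \<in> ball (x i) (r i)" "z \<in> ball (x k) (r k)"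
            using i False unfolding I'_def by auto
          show ?thesis
          proof
            fix y assume y: "y \<in> ball (x i) (r i)"
            have "dist (x k) y \<le> dist (x k) z + (dist z (x i) + dist (x i) y)"
              by (smt (verit) dist_triangle)
            also have "\<dots> < r k + (r i + r i)"
              using y z by (simp add: dist_commute)
            also have "\<dots> \<le> 3 * r k" using k(2)[OF i] by simp
            finally show "y \<in> ball (x k) (3 * r k)" by simp
          qed
        qed
        then show ?thesis by blast
      qed
      ultimately show ?thesis using k(1) J(1) unfolding I'_def
        by (intro exI[of _ "insert k J"]) blast
    qed (auto simp: disjoint_family_on_def)
  qed
  then show thesis using that by blast
qed

text \<open>Asking for a closed set inside and an open set outside at once makes the condition
  symmetric under complements, so the sets satisfying it form a \<sigma>-algebra. It contains the
  closed sets, since in a metric space these are the intersections of their neighbourhoods of radius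
  \<open>1 / Suc n\<close>.\<close>

lemma finite_measure_regular:
  fixes M :: "'a::metric_space measure"
  assumes "finite_measure M" and sets_M: "sets M = sets borel" and A: "A \<in> sets borel" and "e > 0"
  shows "\<exists>F U. closed F \<and> open U \<and> F \<subseteq> A \<and> A \<subseteq> U \<and> measure M (U - F) < e"
proof -
  interpret finite_measure M by fact
  have [measurable]: "F \<in> sets M" "U \<in> sets M" if "closed F" "open U" for F U
    using that sets_M by auto
  have "\<forall>e>0. \<exists>F U. closed F \<and> open U \<and> F \<subseteq> A \<and> A \<subseteq> U \<and> measure M (U - F) < e"
    if "A \<in> sigma_sets UNIV (Collect closed)" for A
    using that
  proof (induction rule: sigma_sets.induct)
    case (Basic A)
    then have A: "closed A" by simp
    show ?case
    \<comment> \<open>\<open>infdist x {}\<close> is 0, so the neighbourhoods \<open>U n\<close> of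
      the empty set would be the whole space.\<close>
    proof (cases "A = {}")
      case True
      then show ?thesis by (intro allI impI exI[of _ "{}"]) auto
    next
      case False
      define U where "U n = {x. infdist x A < 1 / Suc n}" for n
      have oU: "open (U n)" for n unfolding U_def
        by (intro open_Collect_less continuous_intros)
      have dec: "decseq (\<lambda>n. U n - A)"
      proof (rule decseq_SucI)
        fix n :: nat
        have "1 / real (Suc (Suc n)) \<le> 1 / real (Suc n)" by (simp add: field_simps)
        then show "U (Suc n) - A \<subseteq> U n - A" unfolding U_def by fastforce
      qed
      have inter: "(\<Inter>n. U n - A) = {}"
      proof -
        { fix x assume x: "x \<notin> A" "\<And>n. infdist x A < 1 / Suc n"
          then have "infdist x A > 0" using infdist_pos_not_in_closed[OF A False] by blast
          then obtain n where "1 / Suc n < infdist x A"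
            by (meson nat_approx_posE)
          with x(2)[of n] have False by simp }
        then show ?thesis unfolding U_def by blast
      qed
      have "range (\<lambda>n. U n - A) \<subseteq> sets M" using A oU by (auto simp: sets_M)
      from finite_Lim_measure_decseq[OF this dec] have lim: "(\<lambda>n. measure M (U n - A)) \<longlonglongrightarrow> 0"
        unfolding inter measure_empty .
      show ?thesis
      proof (intro allI impI)
        fix e :: real assume "e > 0"
        then have "\<forall>\<^sub>F n in sequentially. measure M (U n - A) < e"
          using order_tendstoD(2)[OF lim] by simp
        then obtain n where "measure M (U n - A) < e"
          using eventually_happens'[OF sequentially_bot] by blast
        moreover have "A \<subseteq> U n" unfolding U_def by auto
        ultimately show "\<exists>F U. closed F \<and> open U \<and> F \<subseteq> A \<and> A \<subseteq> U \<and> measure M (U - F) < e"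
          using A oU by blast
      qed
    qed
  next
    case Empty
    then show ?case by (intro allI impI exI[of _ "{}"]) auto
  next
    case (Compl A)
    show ?case
    proof (intro allI impI)
      fix e :: real assume "e > 0"
      obtain F U where "closed F" "open U" "F \<subseteq> A" "A \<subseteq> U" "measure M (U - F) < e"
        using Compl.IH[rule_format, OF \<open>e > 0\<close>] by (elim exE conjE)
      moreover have "(- F) - (- U) = U - F" by auto
      ultimately show "\<exists>F U. closed F \<and> open U \<and> F \<subseteq> UNIV - A \<and> UNIV - A \<subseteq> U \<and> measure M (U - F) < e"
        by (intro exI[of _ "- U"] exI[of _ "- F"]) (simp add: Compl_eq_Diff_UNIV[symmetric] open_Compl closed_Compl)
    qed
  next
    case (Union A)
    show ?case
    proof (intro allI impI)
      fix e :: real assume e: "e > 0"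
      have "\<forall>n. \<exists>F U. closed F \<and> open U \<and> F \<subseteq> A n \<and> A n \<subseteq> U \<and> measure M (U - F) < e / 2 * (1/2) ^ Suc n"
      proof
        fix n
        have "e / 2 * (1/2) ^ Suc n > 0" using e by simp
        from Union.IH[rule_format, OF this] show "\<exists>F U. closed F \<and> open U \<and> F \<subseteq> A n \<and> A n \<subseteq> U
          \<and> measure M (U - F) < e / 2 * (1/2) ^ Suc n" .
      qed
      then obtain F U where FU: "\<And>n. closed (F n)" "\<And>n. open (U n)" "\<And>n. F n \<subseteq> A n" "\<And>n. A n \<subseteq> U n"
        "\<And>n. measure M (U n - F n) < e / 2 * (1/2) ^ Suc n" by metis
      have [measurable]: "F n \<in> sets M" "U n \<in> sets M" for n using FU(1,2) sets_M by auto
      have summ: "summable (\<lambda>n. e / 2 * (1/2) ^ Suc n :: real)"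
        by (intro summable_mult) (simp add: summable_geometric)
      have summ2: "summable (\<lambda>n. measure M (U n - F n))"
        by (rule summable_comparison_test'[OF summ, of 0]) (use FU(5) in \<open>auto intro: less_imp_le\<close>)
      have "measure M (\<Union>n. U n - F n) \<le> (\<Sum>n. measure M (U n - F n))"
        by (rule finite_measure_subadditive_countably) (use summ2 in auto)
      also have "\<dots> \<le> (\<Sum>n. e / 2 * (1/2) ^ Suc n)"
        by (intro suminf_le summ summ2) (use FU(5) in \<open>auto intro: less_imp_le\<close>)
      also have "\<dots> = e / 2"
        using sums_unique[OF sums_mult[OF power_half_series, of "e/2"]] by simp
      finally have 1: "measure M (\<Union>n. U n - F n) \<le> e / 2" .
      define V where "V = (\<Union>n. U n)"
      \<comment> \<open>An infinite union of closed sets need not be closed, so only finitely many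
        \<open>F n\<close> are kept; continuity from above brings the loss below
        \<open>e\<close>.\<close>
      define G where "G k = (\<Union>n<k. F n)" for k :: nat
      have mV: "V \<in> sets M" and mG: "\<And>k. G k \<in> sets M" unfolding V_def G_def by auto
      have dec: "decseq (\<lambda>k. V - G k)"
        unfolding decseq_def G_def by (fastforce intro: less_le_trans)
      have "(\<Inter>k. V - G k) \<subseteq> (\<Union>n. U n - F n)"
        unfolding V_def G_def by blast
      then have "measure M (\<Inter>k. V - G k) \<le> e / 2"
        using 1 finite_measure_mono[of "\<Inter>k. V - G k" "\<Union>n. U n - F n"] by fastforce
      moreover have "(\<lambda>k. measure M (V - G k)) \<longlonglongrightarrow> measure M (\<Inter>k. V - G k)"
        by (rule finite_Lim_measure_decseq[OF _ dec]) (use mV mG in auto)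
      ultimately have "\<forall>\<^sub>F k in sequentially. measure M (V - G k) < e"
        using order_tendstoD(2)[of _ "measure M (\<Inter>k. V - G k)" sequentially e] e by auto
      then obtain k where "measure M (V - G k) < e"
        using eventually_happens'[OF sequentially_bot] by blast
      moreover have "open V" "closed (G k)" unfolding V_def G_def using FU by auto
      moreover have "G k \<subseteq> \<Union> (range A)" "\<Union> (range A) \<subseteq> V" unfolding V_def G_def using FU(3,4) by blast+
      ultimately show "\<exists>F U. closed F \<and> open U \<and> F \<subseteq> \<Union> (range A) \<and> \<Union> (range A) \<subseteq> U \<and> measure M (U - F) < e"
        by blast
    qed
  qed
  moreover have "A \<in> sigma_sets UNIV (Collect closed)"
    using A unfolding borel_eq_closed by (simp add: sets_measure_of)
  ultimately show ?thesis using \<open>e > 0\<close> by blast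
qed

text \<open>Regularity of finite measures is applied to the restriction of \<open>M\<close> to
  \<open>B n\<close>, with errors summable in \<open>n\<close>. Cutting each open set back to
  \<open>B n\<close> confines its excess to the region where it is controlled.\<close>

lemma locally_finite_outer_regular:
  fixes M :: "'a::metric_space measure"
  assumes sets_M: "sets M = sets borel" and fin: "\<And>x r. emeasure M (ball x r) < \<infinity>"
    and A: "A \<in> sets M" and "e > 0"
  obtains U where "open U" "A \<subseteq> U" "emeasure M (U - A) \<le> ennreal e"
proof -
  fix x0 :: 'a
  define B where "B n = ball x0 (real n)" for n :: nat
  have [measurable]: "B n \<in> sets M" for n using sets_M by (simp add: B_def)
  note A[measurable]
  have [measurable]: "U \<in> sets M" if "open U" for U using that sets_M by auto
  have sp: "space M = UNIV" using sets_eq_imp_space_eq[OF sets_M] by simp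
  have "\<exists>U. open U \<and> A \<subseteq> U \<and> emeasure M ((U - A) \<inter> B n) \<le> ennreal (e * (1/2) ^ Suc n)" for n
  proof -
    let ?N = "density M (indicator (B n))"
    have em: "emeasure ?N C = emeasure M (C \<inter> B n)" if "C \<in> sets M" for C
      using that by (simp add: emeasure_density mult.commute flip: indicator_inter_arith)
    interpret finite_measure ?N
      by (rule finite_measureI) (use em[of "space M"] fin[of x0 "real n"] sp in \<open>auto simp: B_def\<close>)
    obtain F U where FU: "closed F" "open U" "F \<subseteq> A" "A \<subseteq> U" "measure ?N (U - F) < e * (1/2) ^ Suc n"
      using finite_measure_regular[OF finite_measure_axioms, of A "e * (1/2) ^ Suc n"] \<open>e > 0\<close> sets_M A
      by auto
    have [measurable]: "F \<in> sets M" "U \<in> sets M" using FU sets_M by auto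
    have "emeasure M ((U - A) \<inter> B n) = emeasure ?N (U - A)" by (subst em) auto
    also have "\<dots> \<le> emeasure ?N (U - F)" using FU by (intro emeasure_mono) auto
    also have "\<dots> \<le> ennreal (e * (1/2) ^ Suc n)"
      using FU(5) by (simp add: emeasure_eq_measure ennreal_leI less_imp_le)
    finally show ?thesis using FU by blast
  qed
  then obtain U where U: "\<And>n. open (U n)" "\<And>n. A \<subseteq> U n"
    "\<And>n. emeasure M ((U n - A) \<inter> B n) \<le> ennreal (e * (1/2) ^ Suc n)" by metis
  define V where "V = (\<Union>n. U n \<inter> B n)"
  have "open V" unfolding V_def B_def using U(1) by auto
  moreover have "A \<subseteq> V"
  proof
    fix y assume "y \<in> A"
    obtain n :: nat where "dist x0 y < n" using reals_Archimedean2 by blast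
    then show "y \<in> V" unfolding V_def B_def using U(2) \<open>y \<in> A\<close> by auto
  qed
  moreover have "emeasure M (V - A) \<le> ennreal e"
  proof -
    have "V - A = (\<Union>n. (U n - A) \<inter> B n)" unfolding V_def by auto
    also have "emeasure M \<dots> \<le> (\<Sum>n. emeasure M ((U n - A) \<inter> B n))"
      by (rule emeasure_subadditive_countably) (use U(1) in auto)
    also have "\<dots> \<le> (\<Sum>n. ennreal (e * (1/2) ^ Suc n))"
      by (intro suminf_le U(3)) auto
    also have "\<dots> = ennreal e"
      using sums_mult[OF power_half_series, of e] \<open>e > 0\<close>
      by (intro suminf_ennreal_eq) auto
    finally show ?thesis .
  qed
  ultimately show thesis using that by blast
qed

subsection \<open>Upper doubling spaces\<close>

text \<open>Used with \<open>q = 2\<close> to pass from geometric doubling to coverings by balls of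
  radius \<open>r / 1024\<close>, and with \<open>q = 1024\<close> to count the balls at scale
  \<open>k\<close> when points without small doubling balls are shown to be negligible.\<close>

lemma iterated_ball_cover:
  fixes x :: "'a::metric_space"
  assumes cov: "\<And>(x::'a) r. 0 < r \<Longrightarrow> \<exists>Y. finite Y \<and> card Y \<le> N \<and> ball x r \<subseteq> (\<Union>y\<in>Y. ball y (r / q))"
    and "0 < q" "0 < r"
  shows "\<exists>Y. finite Y \<and> card Y \<le> N ^ k \<and> ball x r \<subseteq> (\<Union>y\<in>Y. ball y (r / q ^ k))"
proof (induction k)
  case 0
  show ?case by (intro exI[of _ "{x}"]) auto
next
  case (Suc k)
  then obtain Y where Y: "finite Y" "card Y \<le> N ^ k" "ball x r \<subseteq> (\<Union>y\<in>Y. ball y (r / q ^ k))" by blast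
  have "\<forall>y::'a. \<exists>Z. finite Z \<and> card Z \<le> N \<and> ball y (r / q ^ k) \<subseteq> (\<Union>z\<in>Z. ball z (r / q ^ k / q))"
    by (intro allI cov) (use assms in simp)
  from choice[OF this] obtain Z :: "'a \<Rightarrow> 'a set" where Z': "\<forall>y. finite (Z y) \<and> card (Z y) \<le> N \<and>
    ball y (r / q ^ k) \<subseteq> (\<Union>z\<in>Z y. ball z (r / q ^ k / q))" ..
  then have Z: "\<And>y. finite (Z y)" "\<And>y. card (Z y) \<le> N"
    "\<And>y. ball y (r / q ^ k) \<subseteq> (\<Union>z\<in>Z y. ball z (r / q ^ k / q))" by auto
  have "card (\<Union>y\<in>Y. Z y) \<le> (\<Sum>y\<in>Y. card (Z y))" by (rule card_UN_le) fact
  also have "\<dots> \<le> (\<Sum>y\<in>Y. N)" by (intro sum_mono Z)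
  also have "\<dots> \<le> N ^ Suc k" using Y(2) by simp
  finally have "card (\<Union>y\<in>Y. Z y) \<le> N ^ Suc k" .
  moreover have "ball x r \<subseteq> (\<Union>z\<in>(\<Union>y\<in>Y. Z y). ball z (r / q ^ Suc k))"
  proof
    fix p assume "p \<in> ball x r"
    then obtain y where y: "y \<in> Y" "p \<in> ball y (r / q ^ k)" using Y(3) by blast
    then obtain z where "z \<in> Z y" "p \<in> ball z (r / q ^ k / q)" using Z(3) by blast
    then show "p \<in> (\<Union>z\<in>(\<Union>y\<in>Y. Z y). ball z (r / q ^ Suc k))" using y(1)
      by (auto simp: field_simps)
  qed
  ultimately show ?case using Y(1) Z(1) by blast
qed

text \<open>One constant \<open>L\<close> serves for the growth of \<open>\<Lambda>\<close> over a
  factor 32 and for its change of centre. The lower bounds on \<open>\<beta>\<close> have separate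
  uses: \<open>2 * real N \<le> \<beta>\<close> beats the number of covering balls, so that small
  doubling balls exist almost everywhere, and \<open>2 * L\<^sup>2 \<le> \<beta>\<close> beats the
  growth of \<open>\<Lambda>\<close> over two scales, so that large doubling balls exist.\<close>

locale doubling_space =
  fixes \<mu> :: "'a::{metric_space, second_countable_topology} measure"
    and \<Lambda> :: "'a \<Rightarrow> real \<Rightarrow> real" and L \<beta> :: real and N :: nat
  assumes sets_mu: "sets \<mu> = sets borel"
    and Lam_pos: "0 < r \<Longrightarrow> 0 < \<Lambda> x r"
    and Lam_mono: "0 < r \<Longrightarrow> r \<le> s \<Longrightarrow> \<Lambda> x r \<le> \<Lambda> x s"
    and ball_le_Lam: "0 < r \<Longrightarrow> emeasure \<mu> (ball x r) \<le> ennreal (\<Lambda> x r)"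
    and L_ge1: "1 \<le> L"
    and Lam_32: "0 < r \<Longrightarrow> \<Lambda> x (32 * r) \<le> L * \<Lambda> x r"
    and Lam_swap: "0 < r \<Longrightarrow> dist x y \<le> r \<Longrightarrow> \<Lambda> x r \<le> L * \<Lambda> y r"
    and ball_cover: "0 < r \<Longrightarrow> \<exists>Y. finite Y \<and> card Y \<le> N \<and> ball x r \<subseteq> (\<Union>y\<in>Y. ball y (r / 1024))"
    and beta_N: "2 * real N \<le> \<beta>" and beta_L: "2 * L\<^sup>2 \<le> \<beta>"
begin

abbreviation m :: "'a \<Rightarrow> real \<Rightarrow> real" where "m x r \<equiv> measure \<mu> (ball x r)"

lemma space_mu [simp]: "space \<mu> = UNIV"
  using sets_eq_imp_space_eq[OF sets_mu] by simp

lemma open_in_sets [measurable (raw), intro]: "open U \<Longrightarrow> U \<in> sets \<mu>"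
  by (simp add: sets_mu)

lemma closed_in_sets [measurable (raw), intro]: "closed U \<Longrightarrow> U \<in> sets \<mu>"
  by (simp add: sets_mu)

lemma ball_in_sets [measurable, simp]: "ball x r \<in> sets \<mu>"
  by (simp add: sets_mu)

lemma emeasure_ball_finite: "emeasure \<mu> (ball x r) < \<infinity>"
proof (cases "r > 0")
  case True
  from ball_le_Lam[OF this, of x] show ?thesis unfolding infinity_ennreal_def by (rule le_less_trans[OF _ ennreal_less_top])
next
  case False
  then show ?thesis by (simp add: ball_empty)
qed

lemma emeasure_ball: "emeasure \<mu> (ball x r) = ennreal (m x r)"
  using emeasure_ball_finite[of x r] by (intro emeasure_eq_ennreal_measure) (auto simp: less_top)

lemma ball_fmeasurable [simp]: "ball x r \<in> fmeasurable \<mu>"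
  using emeasure_ball_finite by (simp add: fmeasurable_def)

lemma m_le_Lam: "0 < r \<Longrightarrow> m x r \<le> \<Lambda> x r"
  using ball_le_Lam[of r x] Lam_pos[of r x] by (simp add: emeasure_ball ennreal_le_iff)

lemma m_mono_sub: "ball x r \<subseteq> ball y s \<Longrightarrow> m x r \<le> m y s"
  by (rule measure_mono_fmeasurable) auto

lemma m_mono: "r \<le> s \<Longrightarrow> m x r \<le> m x s"
  by (rule m_mono_sub) auto

lemma ball_subset_shift: "dist y x + r \<le> s \<Longrightarrow> ball x r \<subseteq> ball y s" for x y :: 'a
proof
  fix z assume "dist y x + r \<le> s" "z \<in> ball x r"
  then show "z \<in> ball y s" using dist_triangle[of y z x] by simp
qed

lemma beta_pos: "\<beta> > 0"
proof -
  have "L\<^sup>2 \<ge> 1" using L_ge1 by (simp add: one_le_power)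
  then show ?thesis using beta_L by linarith
qed

lemma sigma_finite_mu: "sigma_finite_measure \<mu>"
proof
  fix x0 :: 'a
  show "\<exists>A. countable A \<and> A \<subseteq> sets \<mu> \<and> \<Union> A = space \<mu> \<and> (\<forall>a\<in>A. emeasure \<mu> a \<noteq> \<infinity>)"
  proof (intro exI[of _ "range (\<lambda>n::nat. ball x0 (real n))"] conjI)
    show "(\<Union>n::nat. ball x0 (real n)) = space \<mu>"
      using reals_Archimedean2 by auto
    show "\<forall>a\<in>range (\<lambda>n::nat. ball x0 (real n)). emeasure \<mu> a \<noteq> \<infinity>"
      by (auto simp: emeasure_ball)
  qed auto
qed

sublocale sigma_finite_measure \<mu> by (rule sigma_finite_mu)

lemma Lam_32_pow: "0 < r \<Longrightarrow> \<Lambda> x (32 * (32 * r)) \<le> L\<^sup>2 * \<Lambda> x r"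
proof -
  assume r: "0 < r"
  have "\<Lambda> x (32 * (32 * r)) \<le> L * \<Lambda> x (32 * r)" using r by (intro Lam_32) simp
  also have "\<dots> \<le> L * (L * \<Lambda> x r)" using Lam_32[OF r] L_ge1 by (intro mult_left_mono) auto
  finally show ?thesis by (simp add: power2_eq_square mult.assoc)
qed

section \<open>Small and large doubling balls\<close>

text \<open>The centres at which a stopping argument can start: small doubling balls supply the
  first radius, and positive measure is needed to climb to the next doubling ball.\<close>

definition tame :: "'a \<Rightarrow> bool" where
  "tame x \<longleftrightarrow> (\<forall>r>0. m x r > 0) \<and> (\<forall>e>0. \<exists>s>0. s < e \<and> m x (1024 * s) \<le> \<beta> * m x s)"

text \<open>By Lindelof, the union of all balls of measure zero is the union of countably many of
  them.\<close>

lemma AE_ball_pos: "AE x in \<mu>. \<forall>r>0. m x r > 0"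
proof -
  let ?\<F> = "{ball x r | x r. m x r = 0}"
  obtain \<G> where \<G>: "\<G> \<subseteq> ?\<F>" "countable \<G>" "\<Union>\<G> = \<Union>?\<F>"
    using Lindelof[of ?\<F>] by auto
  have "\<Union>\<G> \<in> null_sets \<mu>"
  proof (rule null_sets_UN'[of \<G> id, simplified])
    show "countable \<G>" by fact
    fix A assume "A \<in> \<G>"
    then obtain x r where "A = ball x r" "m x r = 0" using \<G>(1) by blast
    then show "A \<in> null_sets \<mu>" by (auto simp: null_sets_def emeasure_ball)
  qed
  then show ?thesis
  proof (rule AE_I')
    show "{x \<in> space \<mu>. \<not> (\<forall>r>0. 0 < m x r)} \<subseteq> \<Union>\<G>"
    proof
      fix x assume "x \<in> {x \<in> space \<mu>. \<not> (\<forall>r>0. 0 < m x r)}"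
      then obtain r where "r > 0" "m x r = 0" using measure_nonneg[of \<mu>] by (auto simp: not_less order_antisym)
      then have "x \<in> ball x r" "ball x r \<in> ?\<F>" by auto
      then show "x \<in> \<Union>\<G>" unfolding \<G>(3) by blast
    qed
  qed
qed

text \<open>At a point with no doubling ball below radius \<open>e\<close>, each division of the
  radius by 1024 divides the measure by more than \<open>\<beta>\<close>, while the number of
  covering balls grows only by the factor \<open>N\<close>. As \<open>N / \<beta> \<le> 1/2\<close>,
  the exceptional set lies in sets whose measures decrease like \<open>(1/2) ^ i\<close>.\<close>

lemma AE_small_doubling_aux:
  fixes x0 :: 'a
  assumes e: "e > 0" and n: "(n::real) > 0"
  shows "AE x in \<mu>. x \<in> ball x0 n \<longrightarrow> (\<exists>s>0. s < e \<and> m x (1024 * s) \<le> \<beta> * m x s)"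
proof -
  define Bad where "Bad = {x \<in> ball x0 n. \<forall>s>0. s < e \<longrightarrow> \<beta> * m x s < m x (1024 * s)}"
  \<comment> \<open>Twice the radius of the covering balls: a covering ball that contains a bad
    point then lies in the ball of radius \<open>\<rho> j\<close> about that point.\<close>
  define \<rho> where "\<rho> j = 2 * n / 1024 ^ j" for j :: nat
  have rho_pos: "\<rho> j > 0" for j using n by (simp add: \<rho>_def)
  have "(\<lambda>j. 2 * n * (1/1024) ^ j) \<longlonglongrightarrow> 0"
    by (intro tendsto_mult_right_zero LIMSEQ_power_zero) auto
  then have "\<rho> \<longlonglongrightarrow> 0" unfolding \<rho>_def by (simp only: power_one_over times_divide_eq_right mult_1_right)
  then have "\<forall>\<^sub>F j in sequentially. \<rho> j < e" using order_tendstoD(2) e by blast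
  then obtain j0 where j0: "\<And>j. j \<ge> j0 \<Longrightarrow> \<rho> j < e" unfolding eventually_sequentially by blast
  define V where "V = m x0 (n + \<rho> j0)"
  have decay: "m x (\<rho> (j0 + i)) \<le> V * (1 / \<beta>) ^ i" if x: "x \<in> Bad" for x i
  proof (induction i)
    case 0
    have "ball x (\<rho> j0) \<subseteq> ball x0 (n + \<rho> j0)" using x unfolding Bad_def
      by (intro ball_subset_shift) auto
    then show ?case unfolding V_def using m_mono_sub by simp
  next
    case (Suc i)
    have "\<beta> * m x (\<rho> (j0 + Suc i)) < m x (1024 * \<rho> (j0 + Suc i))"
      using x rho_pos j0[of "j0 + Suc i"] unfolding Bad_def by auto
    also have "1024 * \<rho> (j0 + Suc i) = \<rho> (j0 + i)" by (simp add: \<rho>_def)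
    finally have "m x (\<rho> (j0 + Suc i)) \<le> (1 / \<beta>) * m x (\<rho> (j0 + i))"
      using beta_pos by (simp add: field_simps)
    also have "\<dots> \<le> (1 / \<beta>) * (V * (1 / \<beta>) ^ i)"
      using Suc beta_pos by (intro mult_left_mono) auto
    finally show ?case by simp
  qed
  have V0: "V \<ge> 0" by (simp add: V_def)
  \<comment> \<open>Measurable supersets are produced because \<open>Bad\<close> itself is not known
    to be measurable.\<close>
  have "\<exists>A\<in>sets \<mu>. Bad \<subseteq> A \<and> emeasure \<mu> A \<le> ennreal (V * N ^ j0 * (1/2) ^ i)" for i
  proof -
    have "\<exists>Y. finite Y \<and> card Y \<le> N ^ (j0 + i) \<and> ball x0 n \<subseteq> (\<Union>y\<in>Y. ball y (n / 1024 ^ (j0 + i)))"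
      by (rule iterated_ball_cover[OF ball_cover _ n]) simp_all
    then obtain Y where Y: "finite Y" "card Y \<le> N ^ (j0 + i)" "ball x0 n \<subseteq> (\<Union>y\<in>Y. ball y (n / 1024 ^ (j0 + i)))"
      by (elim exE conjE)
    \<comment> \<open>The decay is known only around bad points, so covering balls that miss
      \<open>Bad\<close> are dropped.\<close>
    define Z where "Z = {y \<in> Y. ball y (n / 1024 ^ (j0 + i)) \<inter> Bad \<noteq> {}}"
    define A where "A = (\<Union>y\<in>Z. ball y (n / 1024 ^ (j0 + i)))"
    have fZ: "finite Z" using Y(1) by (simp add: Z_def)
    have sm: "emeasure \<mu> (ball y (n / 1024 ^ (j0 + i))) \<le> ennreal (V * (1 / \<beta>) ^ i)" if "y \<in> Z" for y
    proof -
      obtain x where x: "x \<in> Bad" "x \<in> ball y (n / 1024 ^ (j0 + i))" using \<open>y \<in> Z\<close> unfolding Z_def by blast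
      have "ball y (n / 1024 ^ (j0 + i)) \<subseteq> ball x (\<rho> (j0 + i))"
        using x(2) unfolding \<rho>_def by (intro ball_subset_shift) (auto simp: dist_commute)
      then have "m y (n / 1024 ^ (j0 + i)) \<le> V * (1 / \<beta>) ^ i"
        using order_trans[OF m_mono_sub decay[OF x(1), of i]] by blast
      then show ?thesis by (simp add: emeasure_ball ennreal_leI)
    qed
    have "emeasure \<mu> A \<le> (\<Sum>y\<in>Z. emeasure \<mu> (ball y (n / 1024 ^ (j0 + i))))"
      unfolding A_def by (rule emeasure_subadditive_finite) (use fZ in auto)
    also have "\<dots> \<le> (\<Sum>y\<in>Z. ennreal (V * (1 / \<beta>) ^ i))" by (intro sum_mono sm)
    also have "\<dots> = ennreal (card Z * (V * (1 / \<beta>) ^ i))"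
      using V0 beta_pos by (simp add: ennreal_mult ennreal_of_nat_eq_real_of_nat)
    also have "\<dots> \<le> ennreal (V * N ^ j0 * (1/2) ^ i)"
    proof (rule ennreal_leI)
      have "card Z \<le> N ^ (j0 + i)" using card_mono[OF Y(1), of Z] Y(2) by (simp add: Z_def)
      then have "real (card Z) \<le> real N ^ (j0 + i)" by (metis of_nat_le_iff of_nat_power)
      then have "card Z * (V * (1 / \<beta>) ^ i) \<le> real N ^ (j0 + i) * (V * (1 / \<beta>) ^ i)"
        using V0 beta_pos by (intro mult_right_mono) auto
      also have "\<dots> = V * N ^ j0 * (N / \<beta>) ^ i" by (simp add: power_add power_divide field_simps)
      also have "\<dots> \<le> V * N ^ j0 * (1/2) ^ i"
        using V0 beta_pos beta_N by (intro mult_left_mono power_mono) (auto simp: field_simps)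
      finally show "card Z * (V * (1 / \<beta>) ^ i) \<le> V * N ^ j0 * (1/2) ^ i" .
    qed
    finally have "emeasure \<mu> A \<le> ennreal (V * N ^ j0 * (1/2) ^ i)" .
    moreover have "Bad \<subseteq> A"
    proof
      fix x assume "x \<in> Bad"
      then obtain y where "y \<in> Y" "x \<in> ball y (n / 1024 ^ (j0 + i))" using Y(3) unfolding Bad_def by blast
      then show "x \<in> A" using \<open>x \<in> Bad\<close> unfolding A_def Z_def by blast
    qed
    moreover have "A \<in> sets \<mu>" unfolding A_def by auto
    ultimately show ?thesis by blast
  qed
  then obtain A where A: "\<And>i. A i \<in> sets \<mu>" "\<And>i. Bad \<subseteq> A i"
    "\<And>i. emeasure \<mu> (A i) \<le> ennreal (V * N ^ j0 * (1/2) ^ i)" by metis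
  have "(\<lambda>i. ennreal (V * N ^ j0 * (1/2) ^ i)) \<longlonglongrightarrow> ennreal 0"
    by (intro tendsto_ennrealI tendsto_mult_right_zero LIMSEQ_power_zero) auto
  moreover have "emeasure \<mu> (\<Inter>i. A i) \<le> ennreal (V * N ^ j0 * (1/2) ^ i)" for i
    using emeasure_mono[of "\<Inter>i. A i" "A i" \<mu>] A by (meson INF_lower UNIV_I order_trans)
  ultimately have "emeasure \<mu> (\<Inter>i. A i) \<le> ennreal 0"
    by (intro LIMSEQ_le_const) auto
  then have "(\<Inter>i. A i) \<in> null_sets \<mu>" using A(1) by (auto simp: null_sets_def)
  then show ?thesis
    by (rule AE_I') (use A(2) in \<open>force simp: Bad_def not_le\<close>)
qed

lemma AE_tame: "AE x in \<mu>. tame x"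
proof -
  fix x0 :: 'a
  have "AE x in \<mu>. \<forall>i::nat. \<forall>k::nat. x \<in> ball x0 (real (Suc k)) \<longrightarrow>
    (\<exists>s>0. s < 1 / Suc i \<and> m x (1024 * s) \<le> \<beta> * m x s)"
    unfolding AE_all_countable by (intro allI AE_small_doubling_aux) auto
  with AE_ball_pos show ?thesis
  proof eventually_elim
    case (elim x)
    have "\<exists>s>0. s < e \<and> m x (1024 * s) \<le> \<beta> * m x s" if "e > 0" for e
    proof -
      obtain i where i: "1 / Suc i < e" using \<open>e > 0\<close> by (meson nat_approx_posE)
      obtain k :: nat where "dist x0 x < k" using reals_Archimedean2 by blast
      then have "x \<in> ball x0 (real (Suc k))" by simp
      with elim(2) obtain s where "s>0" "s < 1 / Suc i" "m x (1024 * s) \<le> \<beta> * m x s" by blast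
      with i show ?thesis by (meson less_trans)
    qed
    with elim(1) show ?case unfolding tame_def by blast
  qed
qed

text \<open>
  Below the next doubling ball the ratio of \<open>\<mu>\<close> to \<open>\<Lambda>\<close> at least doubles with every second scale,
  because \<open>\<beta> \<ge> 2 L\<^sup>2\<close>, and it never exceeds 1; so the sum is dominated by its last terms.
\<close>

lemma next_doubling:
  assumes r: "r > 0" and pos: "m x r > 0"
  obtains n where "n \<ge> 1" "m x (32 ^ (n + 2) * r) \<le> \<beta> * m x (32 ^ n * r)"
    "(\<Sum>j\<le>n. m x (32 ^ (j + 2) * r) / \<Lambda> x (32 ^ j * r)) \<le> 5 * L\<^sup>2"
proof -
  define \<rho> where "\<rho> j = 32 ^ j * r" for j :: nat
  have rp: "\<rho> j > 0" for j using r by (simp add: \<rho>_def)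
  have rS: "32 * (32 * \<rho> j) = \<rho> (j + 2)" for j by (simp add: \<rho>_def)
  define a where "a j = m x (\<rho> j) / \<Lambda> x (\<rho> j)" for j
  have a0: "0 \<le> a j" for j using Lam_pos[OF rp, of x j] by (simp add: a_def)
  have a1: "a j \<le> 1" for j using Lam_pos[OF rp, of x j] m_le_Lam[OF rp, of x j] by (simp add: a_def)
  have Lam2: "\<Lambda> x (\<rho> (j + 2)) \<le> L\<^sup>2 * \<Lambda> x (\<rho> j)" for j
    using Lam_32_pow[OF rp, of x j] unfolding rS .
  have grow: "2 * a j \<le> a (j + 2)" if "\<beta> * m x (\<rho> j) < m x (\<rho> (j + 2))" for j
  proof -
    have l: "\<Lambda> x (\<rho> j) > 0" "\<Lambda> x (\<rho> (j+2)) > 0" using Lam_pos rp by auto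
    have "2 * m x (\<rho> j) * \<Lambda> x (\<rho> (j+2)) \<le> 2 * m x (\<rho> j) * (L\<^sup>2 * \<Lambda> x (\<rho> j))"
      using Lam2 by (intro mult_left_mono) auto
    also have "\<dots> = (2 * L\<^sup>2) * m x (\<rho> j) * \<Lambda> x (\<rho> j)" by simp
    also have "\<dots> \<le> \<beta> * m x (\<rho> j) * \<Lambda> x (\<rho> j)"
      using beta_L l by (intro mult_right_mono) auto
    also have "\<dots> \<le> m x (\<rho> (j + 2)) * \<Lambda> x (\<rho> j)" using that l by (intro mult_right_mono) auto
    finally show ?thesis unfolding a_def using l by (simp add: field_simps)
  qed
  have "\<exists>n\<ge>1. m x (\<rho> (n + 2)) \<le> \<beta> * m x (\<rho> n)"
  proof (rule ccontr)
    assume "\<not> ?thesis"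
    then have g: "2 * a j \<le> a (j + 2)" if "j \<ge> 1" for j using grow that by (meson not_le)
    have "2 ^ k * a 1 \<le> a (1 + 2 * k)" for k
    proof (induction k)
      case (Suc k)
      have "2 ^ Suc k * a 1 \<le> 2 * a (1 + 2 * k)" using Suc by simp
      also have "\<dots> \<le> a (1 + 2 * Suc k)" using g[of "1 + 2 * k"] by simp
      finally show ?case .
    qed simp
    then have b: "2 ^ k * a 1 \<le> 1" for k using a1 order_trans by blast
    have "m x (\<rho> 1) > 0" using pos m_mono[of r "\<rho> 1" x] r by (simp add: \<rho>_def)
    then have "a 1 > 0" using Lam_pos[OF rp, of x 1] by (simp add: a_def)
    obtain k where "1 / a 1 < 2 ^ k" using real_arch_pow[of 2 "1 / a 1"] by auto
    with b[of k] \<open>a 1 > 0\<close> show False by (simp add: field_simps)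
  qed
  then obtain n0 where n0: "n0 \<ge> 1 \<and> m x (\<rho> (n0 + 2)) \<le> \<beta> * m x (\<rho> n0)" by blast
  \<comment> \<open>The scale 0 is excluded because the stopping inequalities hold only from
    \<open>32 * r\<close> on; the doubling ball has to be strictly larger than the stopping
    ball.\<close>
  define n where "n = (LEAST n. n \<ge> 1 \<and> m x (\<rho> (n + 2)) \<le> \<beta> * m x (\<rho> n))"
  have n: "n \<ge> 1 \<and> m x (\<rho> (n + 2)) \<le> \<beta> * m x (\<rho> n)" unfolding n_def by (rule LeastI, rule n0)
  have g: "2 * a j \<le> a (j + 2)" if "1 \<le> j" "j < n" for j
    using grow[of j] not_less_Least[of j "\<lambda>n. n \<ge> 1 \<and> m x (\<rho> (n + 2)) \<le> \<beta> * m x (\<rho> n)"] that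
    unfolding n_def[symmetric] by (meson not_le)
  \<comment> \<open>With two terms on the right, the two-step growth
    \<open>2 * a k \<le> a (k + 2)\<close> closes the induction without separating even and odd
    scales.\<close>
  have "(\<Sum>i=1..<k. a i) \<le> a k + a (Suc k)" if "1 \<le> k" "k \<le> n" for k
    using that
  proof (induction k rule: dec_induct)
    case base
    show ?case using a0 by simp
  next
    case (step k)
    have "(\<Sum>i=1..<Suc k. a i) = (\<Sum>i=1..<k. a i) + a k" using step by simp
    also have "\<dots> \<le> 2 * a k + a (Suc k)" using step by simp
    also have "\<dots> \<le> a (Suc k) + a (Suc (Suc k))" using g[of k] step by simp
    finally show ?case .
  qed
  then have S: "(\<Sum>i=1..<n. a i) \<le> 2" using n a1[of n] a1[of "Suc n"] by fastforce
  have "(\<Sum>j\<le>n. a (j + 2)) = (\<Sum>i=2..n+2. a i)"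
    by (rule sum.reindex_bij_witness[of _ "\<lambda>i. i - 2" "\<lambda>j. j + 2"]) auto
  also have "\<dots> \<le> (\<Sum>i=1..<n+3. a i)" by (rule sum_mono2) (use a0 in auto)
  also have "\<dots> = (\<Sum>i=1..<n. a i) + a n + a (n+1) + a (n+2)"
    using n by (simp add: eval_nat_numeral)
  \<comment> \<open>At most 2 from the terms below \<open>n\<close> and at most 1 from each of the
    last three.\<close>
  also have "\<dots> \<le> 5" using S a1[of n] a1[of "n+1"] a1[of "n+2"] by linarith
  finally have s5: "(\<Sum>j\<le>n. a (j + 2)) \<le> 5" .
  \<comment> \<open>Annuli require a numerator two scales above the denominator: the kernel is
    bounded at the inner radius, while a maximal function bound involves a dilate of the outer ball.
    The mismatch costs \<open>L\<^sup>2\<close>.\<close>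
  have "(\<Sum>j\<le>n. m x (\<rho> (j + 2)) / \<Lambda> x (\<rho> j)) \<le> (\<Sum>j\<le>n. L\<^sup>2 * a (j + 2))"
  proof (rule sum_mono)
    fix j
    have l: "\<Lambda> x (\<rho> j) > 0" "\<Lambda> x (\<rho> (j+2)) > 0" using Lam_pos rp by auto
    have "m x (\<rho> (j+2)) * \<Lambda> x (\<rho> (j+2)) \<le> m x (\<rho> (j+2)) * (L\<^sup>2 * \<Lambda> x (\<rho> j))"
      using Lam2 by (intro mult_left_mono) auto
    then show "m x (\<rho> (j + 2)) / \<Lambda> x (\<rho> j) \<le> L\<^sup>2 * a (j + 2)"
      unfolding a_def using l by (simp add: field_simps)
  qed
  also have "\<dots> = L\<^sup>2 * (\<Sum>j\<le>n. a (j + 2))" by (simp add: sum_distrib_left)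
  also have "\<dots> \<le> L\<^sup>2 * 5" using s5 by (intro mult_left_mono) auto
  finally have "(\<Sum>j\<le>n. m x (\<rho> (j + 2)) / \<Lambda> x (\<rho> j)) \<le> 5 * L\<^sup>2" by (simp add: mult.commute)
  with that n show thesis unfolding \<rho>_def by blast
qed

end

subsection \<open>Stopping balls and maximal sets\<close>

context doubling_space
begin

text \<open>Lindelof and continuity from above reduce to finitely many balls at the cost of a set of
  measure below \<open>\<delta>\<close>; the finite covering lemma then applies whatever the radii
  are.\<close>

lemma Vitali_almost_cover:
  fixes x :: "'i \<Rightarrow> 'a" and r :: "'i \<Rightarrow> real"
  assumes G: "G \<in> sets \<mu>" "emeasure \<mu> G < \<infinity>"
    and cov: "AE y in \<mu>. y \<in> G \<longrightarrow> y \<in> (\<Union>i\<in>S. ball (x i) (r i))" and \<delta>: "\<delta> > 0"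
  obtains I where "finite I" "I \<subseteq> S" "disjoint_family_on (\<lambda>i. ball (x i) (r i)) I"
    "emeasure \<mu> (G - (\<Union>i\<in>I. ball (x i) (3 * r i))) < ennreal \<delta>"
proof -
  let ?B = "\<lambda>i. ball (x i) (r i)"
  note G(1)[measurable]
  obtain \<G> where \<G>: "\<G> \<subseteq> ?B ` S" "countable \<G>" "\<Union>\<G> = \<Union>(?B ` S)"
    using Lindelof[of "?B ` S"] by auto
  have "countable \<G> \<and> \<G> \<subseteq> ?B ` S" using \<G>(1,2) by simp
  then have "\<exists>T. countable T \<and> T \<subseteq> S \<and> \<G> = ?B ` T" by (simp only: countable_subset_image)
  then obtain T where T: "countable T" "T \<subseteq> S" "\<G> = ?B ` T" by (elim exE conjE)
  have UT: "(\<Union>i\<in>T. ?B i) = (\<Union>i\<in>S. ?B i)" using \<G>(3) T(3) by simp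
  have null: "emeasure \<mu> (G - (\<Union>i\<in>T. ?B i)) = 0"
  proof (rule AE_iff_measurable[THEN iffD1, rotated 2])
    show "G - (\<Union>i\<in>T. ?B i) \<in> sets \<mu>" by (intro sets.Diff G(1) open_in_sets open_UN) auto
    show "{y \<in> space \<mu>. \<not> (y \<in> G \<longrightarrow> y \<in> (\<Union>i\<in>S. ?B i))} = G - (\<Union>i\<in>T. ?B i)" using UT by auto
  qed (use cov in simp)
  have "\<exists>F. finite F \<and> F \<subseteq> T \<and> emeasure \<mu> (G - (\<Union>i\<in>F. ?B i)) < ennreal \<delta>"
  proof (cases "T = {}")
    case True
    then show ?thesis using null \<delta> by (intro exI[of _ "{}"]) auto
  next
    case False
    define D where "D n = G - (\<Union>k<n. ?B (from_nat_into T k))" for n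
    have "decseq D" unfolding decseq_def D_def by (fastforce intro: less_le_trans)
    moreover have Dm: "D n \<in> sets \<mu>" for n unfolding D_def by auto
    moreover have "emeasure \<mu> (D n) \<noteq> \<infinity>" for n
      using emeasure_mono[of "D n" G \<mu>] G unfolding D_def by (auto simp: top_unique)
    ultimately have "(\<lambda>n. emeasure \<mu> (D n)) \<longlonglongrightarrow> emeasure \<mu> (\<Inter>n. D n)"
      by (intro Lim_emeasure_decseq) auto
    moreover have "(\<Inter>n. D n) = G - (\<Union>i\<in>T. ?B i)"
    proof -
      have *: "(\<Union>i\<in>T. ?B i) = (\<Union>k. ?B (from_nat_into T k))"
        by (subst range_from_nat_into[OF False T(1), symmetric]) (simp only: image_image)
      show ?thesis unfolding * D_def by blast
    qed
    ultimately have "(\<lambda>n. emeasure \<mu> (D n)) \<longlonglongrightarrow> 0" using null by simp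
    then have "\<forall>\<^sub>F n in sequentially. emeasure \<mu> (D n) < ennreal \<delta>"
      using \<delta> by (intro order_tendstoD(2)) auto
    then obtain n where "emeasure \<mu> (D n) < ennreal \<delta>"
      using eventually_happens'[OF sequentially_bot] by blast
    moreover have "D n = G - (\<Union>i\<in>from_nat_into T ` {..<n}. ?B i)" unfolding D_def by auto
    ultimately show ?thesis using from_nat_into[OF False]
      by (intro exI[of _ "from_nat_into T ` {..<n}"]) auto
  qed
  then obtain F where F: "finite F" "F \<subseteq> T" "emeasure \<mu> (G - (\<Union>i\<in>F. ?B i)) < ennreal \<delta>" by blast
  obtain J where J: "J \<subseteq> F" "disjoint_family_on ?B J" "(\<Union>i\<in>F. ?B i) \<subseteq> (\<Union>j\<in>J. ball (x j) (3 * r j))"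
    using finite_Vitali[OF F(1), of x r] by blast
  have "emeasure \<mu> (G - (\<Union>j\<in>J. ball (x j) (3 * r j))) \<le> emeasure \<mu> (G - (\<Union>i\<in>F. ?B i))"
    using J(3) by (intro emeasure_mono sets.Diff G(1) open_in_sets open_UN) auto
  also note F(3)
  finally show thesis using that[of J] J F T finite_subset by blast
qed

section \<open>Stopping radii for an integrable weight\<close>

definition iw :: "('a \<Rightarrow> real) \<Rightarrow> 'a set \<Rightarrow> real" where
  "iw w A = (LINT z|\<mu>. w z * indicator A z)"

lemma iw_le_total:
  assumes "integrable \<mu> w" "\<And>z. w z \<ge> 0" "A \<in> sets \<mu>"
  shows "iw w A \<le> (LINT z|\<mu>. w z)"
  unfolding iw_def using assms
  by (intro integral_mono integrable_real_mult_indicator) (auto simp: indicator_def)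

lemma sum_iw_disjoint:
  assumes "integrable \<mu> w" "\<And>z. w z \<ge> 0" "finite I" "\<And>i. i \<in> I \<Longrightarrow> A i \<in> sets \<mu>" "disjoint_family_on A I"
  shows "(\<Sum>i\<in>I. iw w (A i)) = iw w (\<Union>i\<in>I. A i)"
proof -
  have "(\<Sum>i\<in>I. iw w (A i)) = (LINT z|\<mu>. (\<Sum>i\<in>I. w z * indicator (A i) z))"
    unfolding iw_def using assms by (intro Bochner_Integration.integral_sum[symmetric] integrable_real_mult_indicator) auto
  also have "\<dots> = iw w (\<Union>i\<in>I. A i)" unfolding iw_def
    using assms by (intro Bochner_Integration.integral_cong refl)
      (simp add: indicator_UN_disjoint[OF assms(3,5)] sum_distrib_left)
  finally show ?thesis .
qed

lemma m_eq_integral: "m x r = (LINT z|\<mu>. indicator (ball x r) z)"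
  by simp

lemma m_le_iw:
  assumes "integrable \<mu> w" "\<And>z. w z \<ge> 0" "\<And>z. z \<in> ball x r \<Longrightarrow> w z \<ge> 1"
  shows "m x r \<le> iw w (ball x r)"
  unfolding iw_def m_eq_integral using assms
  by (intro integral_mono integrable_real_mult_indicator integrable_real_indicator)
    (auto simp: indicator_def emeasure_ball)

text \<open>In a small doubling ball inside \<open>U\<close> the bound \<open>w \<ge> 1\<close>
  makes the density of \<open>w\<close> exceed the threshold. By \<open>big\<close> the density is
  below it at all large scales of the ladder above this ball, so there is a last scale at which it
  is exceeded.\<close>

lemma stopping_radius:
  assumes w: "integrable \<mu> w" "\<And>z. w z \<ge> 0" "\<And>z. z \<in> U \<Longrightarrow> w z \<ge> 1"
    and U: "open U" "x \<in> U" and x: "tame x"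
    and big: "(LINT z|\<mu>. w z) < m y R / (4 * \<beta>)"
  obtains r where "r > 0" "m x (32 * r) / (4 * \<beta>) < iw w (ball x r)"
    "\<And>i. i \<ge> 1 \<Longrightarrow> iw w (ball x (32 ^ i * r)) \<le> m x (32 ^ (i + 1) * r) / (4 * \<beta>)"
proof -
  obtain e where e: "e > 0" "ball x e \<subseteq> U" using U openE by blast
  obtain s where s: "s > 0" "s < e" "m x (1024 * s) \<le> \<beta> * m x s" using x e(1) unfolding tame_def by blast
  define P where "P i \<longleftrightarrow> m x (32 ^ (i + 1) * s) / (4 * \<beta>) < iw w (ball x (32 ^ i * s))" for i :: nat
  have ms: "m x s > 0" using x s unfolding tame_def by blast
  have "m x (32 * s) \<le> m x (1024 * s)" using s by (intro m_mono) auto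
  also have "\<dots> \<le> \<beta> * m x s" by fact
  also have "\<dots> < 4 * \<beta> * m x s" using ms beta_pos by simp
  also have "\<dots> \<le> 4 * \<beta> * iw w (ball x s)"
  proof (intro mult_left_mono m_le_iw w)
    fix z assume "z \<in> ball x s"
    then show "z \<in> U" using e s by auto
  qed (use beta_pos in auto)
  finally have "P 0" unfolding P_def using beta_pos by (simp add: field_simps)
  have "32 > (1::real)" by simp
  from real_arch_pow[OF this, of "(dist x y + R) / s"] obtain n where "(dist x y + R) / s < 32 ^ n" by blast
  then have n: "dist x y + R \<le> 32 ^ n * s" using s by (simp add: field_simps)
  have bd: "i \<le> n" if "P i" for i
  proof (rule ccontr)
    assume "\<not> i \<le> n"
    then have "(32::real) ^ n \<le> 32 ^ (i + 1)" by (intro power_increasing) auto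
    then have "dist x y + R \<le> 32 ^ (i + 1) * s" using n s by (meson mult_right_mono less_imp_le order_trans)
    then have "m y R \<le> m x (32 ^ (i + 1) * s)" by (intro m_mono_sub ball_subset_shift)
    then have "m y R / (4 * \<beta>) \<le> m x (32 ^ (i + 1) * s) / (4 * \<beta>)" using beta_pos by (intro divide_right_mono) auto
    also have "\<dots> < iw w (ball x (32 ^ i * s))" using that unfolding P_def .
    also have "\<dots> \<le> (LINT z|\<mu>. w z)" using w by (intro iw_le_total) auto
    finally show False using big by simp
  qed
  then have fin: "finite {i. P i}" by (meson finite_nat_set_iff_bounded_le mem_Collect_eq)
  \<comment> \<open>The last success rather than the first failure: the reverse inequality is then
    available at every larger scale, in particular at the next doubling ball and one scale above
    it.\<close>
  define k where "k = Max {i. P i}"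
  have Pk: "P k" unfolding k_def using Max_in[OF fin] \<open>P 0\<close> by blast
  have nP: "\<not> P i" if "i > k" for i using Max_ge[OF fin, of i] that unfolding k_def by auto
  show thesis
  proof (rule that[of "32 ^ k * s"])
    show "32 ^ k * s > 0" using s by simp
    show "m x (32 * (32 ^ k * s)) / (4 * \<beta>) < iw w (ball x (32 ^ k * s))"
      using Pk unfolding P_def by (simp add: mult.assoc)
    fix i :: nat assume "i \<ge> 1"
    then have "\<not> P (i + k)" using nP by simp
    then show "iw w (ball x (32 ^ i * (32 ^ k * s))) \<le> m x (32 ^ (i + 1) * (32 ^ k * s)) / (4 * \<beta>)"
      unfolding P_def by (simp add: power_add mult_ac)
  qed
qed

text \<open>In a doubling space the measure of a dilate is bounded by that of the ball. Here the
  stopping condition bounds \<open>m x (32 * r x)\<close> by the mass of \<open>w\<close> in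
  \<open>ball x (r x)\<close> instead, and these masses add up because the undilated balls are
  disjoint.\<close>

lemma stopping_balls:
  assumes w: "integrable \<mu> w" "\<And>z. w z \<ge> 0" "\<And>z. z \<in> U \<Longrightarrow> w z \<ge> 1"
    and U: "open U" and G: "G \<in> sets \<mu>" "G \<subseteq> U" "emeasure \<mu> G < \<infinity>" and \<delta>: "\<delta> > 0"
    and big: "(LINT z|\<mu>. w z) < m y R / (4 * \<beta>)"
  obtains I r where "finite I" "\<And>x. x \<in> I \<Longrightarrow> tame x" "\<And>x. x \<in> I \<Longrightarrow> r x > 0"
    "disjoint_family_on (\<lambda>x. ball x (r x)) I"
    "emeasure \<mu> (G - (\<Union>x\<in>I. ball x (3 * r x))) < ennreal \<delta>"
    "(\<Sum>x\<in>I. m x (32 * r x)) \<le> 4 * \<beta> * (LINT z|\<mu>. w z)"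
    "\<And>x i. x \<in> I \<Longrightarrow> i \<ge> 1 \<Longrightarrow> iw w (ball x (32 ^ i * r x)) \<le> m x (32 ^ (i + 1) * r x) / (4 * \<beta>)"
proof -
  have "\<exists>r>0. m x (32 * r) / (4 * \<beta>) < iw w (ball x r) \<and>
    (\<forall>i\<ge>1. iw w (ball x (32 ^ i * r)) \<le> m x (32 ^ (i + 1) * r) / (4 * \<beta>))"
    if "tame x" "x \<in> U" for x
  proof -
    from stopping_radius[OF w U that(2,1) big] obtain r where "r > 0" "m x (32 * r) / (4 * \<beta>) < iw w (ball x r)"
      "\<And>i. i \<ge> 1 \<Longrightarrow> iw w (ball x (32 ^ i * r)) \<le> m x (32 ^ (i + 1) * r) / (4 * \<beta>)" by metis
    then show ?thesis by (intro exI[of _ r] conjI allI impI)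
  qed
  then obtain r where r: "\<And>x. tame x \<Longrightarrow> x \<in> U \<Longrightarrow> r x > 0"
    "\<And>x. tame x \<Longrightarrow> x \<in> U \<Longrightarrow> m x (32 * r x) / (4 * \<beta>) < iw w (ball x (r x))"
    "\<And>x i. tame x \<Longrightarrow> x \<in> U \<Longrightarrow> i \<ge> 1 \<Longrightarrow> iw w (ball x (32 ^ i * r x)) \<le> m x (32 ^ (i + 1) * r x) / (4 * \<beta>)"
    by metis
  define S where "S = {x \<in> U. tame x}"
  have "AE y in \<mu>. y \<in> G \<longrightarrow> y \<in> (\<Union>x\<in>S. ball x (r x))"
    using AE_tame
  proof eventually_elim
    case (elim y)
    then show ?case using G(2) r(1)[of y] unfolding S_def by (intro impI UN_I[of y]) auto
  qed
  from Vitali_almost_cover[OF G(1,3) this \<delta>] obtain I where I: "finite I" "I \<subseteq> S"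
    "disjoint_family_on (\<lambda>x. ball x (r x)) I"
    "emeasure \<mu> (G - (\<Union>x\<in>I. ball x (3 * r x))) < ennreal \<delta>" .
  have "(\<Sum>x\<in>I. m x (32 * r x)) \<le> (\<Sum>x\<in>I. 4 * \<beta> * iw w (ball x (r x)))"
  proof (rule sum_mono)
    fix x assume "x \<in> I"
    then have "m x (32 * r x) / (4 * \<beta>) < iw w (ball x (r x))" using r(2) I(2) unfolding S_def by auto
    then show "m x (32 * r x) \<le> 4 * \<beta> * iw w (ball x (r x))" using beta_pos by (simp add: field_simps)
  qed
  also have "\<dots> = 4 * \<beta> * iw w (\<Union>x\<in>I. ball x (r x))"
    unfolding sum_distrib_left[symmetric] using sum_iw_disjoint[OF w(1,2) I(1) _ I(3)] by simp
  also have "\<dots> \<le> 4 * \<beta> * (LINT z|\<mu>. w z)"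
    using beta_pos I(1) w by (intro mult_left_mono iw_le_total) auto
  finally have "(\<Sum>x\<in>I. m x (32 * r x)) \<le> 4 * \<beta> * (LINT z|\<mu>. w z)" .
  moreover have "tame x" "x \<in> U" if "x \<in> I" for x using I(2) that unfolding S_def by auto
  ultimately show thesis using that[of I r] I r by blast
qed

text \<open>
  The set where an uncentred maximal function of \<open>w\<close>, with dilated balls in the denominator,
  exceeds \<open>t\<close>.
\<close>

definition max_set :: "('a \<Rightarrow> real) \<Rightarrow> real \<Rightarrow> 'a set" where
  "max_set w t = \<Union>{ball x r | x r. iw w (ball x r) > t * m x (4 * r)}"

lemma open_max_set: "open (max_set w t)"
  unfolding max_set_def by auto

lemma notin_max_setD: "z \<notin> max_set w t \<Longrightarrow> z \<in> ball x r \<Longrightarrow> iw w (ball x r) \<le> t * m x (4 * r)"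
  unfolding max_set_def by (rule ccontr) (auto simp: not_le simp del: mem_ball)

text \<open>The selected balls are disjoint and their threefold dilates almost cover. As the
  denominator of the maximal function contains an even larger dilate, the weak type bound holds with
  constant 1 and without any doubling of \<open>\<mu>\<close>.\<close>

lemma emeasure_max_set_le:
  assumes w: "integrable \<mu> w" "\<And>z. w z \<ge> 0" and t: "t > 0"
  shows "emeasure \<mu> (max_set w t) \<le> ennreal ((LINT z|\<mu>. w z) / t)"
proof -
  fix x0 :: 'a
  define S where "S = {(x, r). iw w (ball x r) > t * m x (4 * r)}"
  \<comment> \<open>The covering lemma needs a set of finite measure; the bound is uniform in
    \<open>n\<close>.\<close>
  define G where "G n = max_set w t \<inter> ball x0 (real n)" for n :: nat
  have OS: "max_set w t = (\<Union>p\<in>S. ball (fst p) (snd p))" unfolding max_set_def S_def by force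
  have Gm: "G n \<in> sets \<mu>" for n unfolding G_def using open_max_set by auto
  have Gf: "emeasure \<mu> (G n) < \<infinity>" for n
  proof -
    have "emeasure \<mu> (G n) \<le> emeasure \<mu> (ball x0 (real n))" unfolding G_def by (intro emeasure_mono) auto
    then show ?thesis using emeasure_ball_finite le_less_trans by blast
  qed
  have "emeasure \<mu> (G n) \<le> ennreal ((LINT z|\<mu>. w z) / t)" for n
  proof (rule ennreal_le_epsilon)
    fix \<delta> :: real assume \<delta>: "\<delta> > 0"
    have "AE y in \<mu>. y \<in> G n \<longrightarrow> y \<in> (\<Union>p\<in>S. ball (fst p) (snd p))" unfolding G_def OS by auto
    from Vitali_almost_cover[OF Gm Gf this \<delta>] obtain I where I: "finite I" "I \<subseteq> S"
      "disjoint_family_on (\<lambda>p. ball (fst p) (snd p)) I"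
      "emeasure \<mu> (G n - (\<Union>p\<in>I. ball (fst p) (3 * snd p))) < ennreal \<delta>" .
    let ?B = "\<lambda>p. ball (fst p) (3 * snd p)"
    have "emeasure \<mu> (\<Union>p\<in>I. ?B p) \<le> (\<Sum>p\<in>I. emeasure \<mu> (?B p))"
      by (rule emeasure_subadditive_finite) (use I in auto)
    also have "\<dots> = ennreal (\<Sum>p\<in>I. m (fst p) (3 * snd p))" by (simp add: emeasure_ball sum_ennreal)
    also have "\<dots> \<le> ennreal ((LINT z|\<mu>. w z) / t)"
    proof (rule ennreal_leI)
      have "(\<Sum>p\<in>I. m (fst p) (3 * snd p)) \<le> (\<Sum>p\<in>I. iw w (ball (fst p) (snd p)) / t)"
      proof (rule sum_mono)
        fix p assume "p \<in> I"
        then have p: "iw w (ball (fst p) (snd p)) > t * m (fst p) (4 * snd p)" using I(2) unfolding S_def by auto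
        have "m (fst p) (3 * snd p) \<le> m (fst p) (4 * snd p)"
        proof (cases "snd p > 0")
          case True then show ?thesis by (intro m_mono) auto
        next
          case False
          then show ?thesis by (simp add: ball_empty)
        qed
        then have "t * m (fst p) (3 * snd p) \<le> t * m (fst p) (4 * snd p)" using t by simp
        with p have "t * m (fst p) (3 * snd p) \<le> iw w (ball (fst p) (snd p))" by linarith
        then show "m (fst p) (3 * snd p) \<le> iw w (ball (fst p) (snd p)) / t"
          using t by (simp only: pos_le_divide_eq mult.commute)
      qed
      also have "\<dots> = iw w (\<Union>p\<in>I. ball (fst p) (snd p)) / t"
        using sum_iw_disjoint[OF w I(1) _ I(3)] by (simp flip: sum_divide_distrib)
      also have "\<dots> \<le> (LINT z|\<mu>. w z) / t"
        using t I(1) w by (intro divide_right_mono iw_le_total) auto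
      finally show "(\<Sum>p\<in>I. m (fst p) (3 * snd p)) \<le> (LINT z|\<mu>. w z) / t" .
    qed
    finally have 1: "emeasure \<mu> (\<Union>p\<in>I. ?B p) \<le> ennreal ((LINT z|\<mu>. w z) / t)" .
    have "emeasure \<mu> (G n) \<le> emeasure \<mu> ((\<Union>p\<in>I. ?B p) \<union> (G n - (\<Union>p\<in>I. ?B p)))"
      using I(1) Gm by (intro emeasure_mono) auto
    also have "\<dots> \<le> emeasure \<mu> (\<Union>p\<in>I. ?B p) + emeasure \<mu> (G n - (\<Union>p\<in>I. ?B p))"
      using I(1) Gm by (intro emeasure_subadditive) auto
    also have "\<dots> \<le> ennreal ((LINT z|\<mu>. w z) / t) + ennreal \<delta>"
      using 1 I(4) by (intro add_mono) auto
    finally show "emeasure \<mu> (G n) \<le> ennreal ((LINT z|\<mu>. w z) / t) + ennreal \<delta>" .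
  qed
  moreover have "incseq G" unfolding incseq_def G_def by fastforce
  then have "(\<lambda>n. emeasure \<mu> (G n)) \<longlonglongrightarrow> emeasure \<mu> (\<Union>n. G n)"
    using Gm by (intro Lim_emeasure_incseq) auto
  moreover have "(\<Union>n. G n) = max_set w t"
    unfolding G_def using reals_Archimedean2 by auto
  ultimately show ?thesis by (metis LIMSEQ_le_const2)
qed

text \<open>Values of \<open>w\<close> up to \<open>s / 2\<close> contribute at most half of the
  required average, so only the part above \<open>s / 2\<close> matters. This truncation is what
  produces a square integral once the estimate is integrated over the levels.\<close>

lemma emeasure_max_set_le_truncated:
  assumes w: "integrable \<mu> w" "\<And>z. w z \<ge> 0" and s: "s > 0"
  shows "emeasure \<mu> (max_set w s) \<le> ennreal (2 / s) * (\<integral>\<^sup>+z. ennreal (w z) * indicator {z. w z > s / 2} z \<partial>\<mu>)"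
proof -
  have [measurable]: "w \<in> borel_measurable \<mu>" using w by auto
  have "{z \<in> space \<mu>. w z > s / 2} \<in> sets \<mu>" by measurable
  then have lev: "{z. w z > s / 2} \<in> sets \<mu>" by simp
  define v where "v z = w z * indicator {z. w z > s / 2} z" for z
  have v: "integrable \<mu> v" unfolding v_def
    by (intro integrable_real_mult_indicator w lev)
  have v0: "v z \<ge> 0" for z using w(2) by (simp add: v_def)
  have "max_set w s \<subseteq> max_set v (s / 2)"
  proof
    fix z assume "z \<in> max_set w s"
    then obtain x r where xr: "z \<in> ball x r" "iw w (ball x r) > s * m x (4 * r)" unfolding max_set_def by blast
    have r: "r > 0" using xr(1) by (simp add: dist_commute) (metis dist_not_less_zero le_less_trans not_le zero_le_dist)
    have i1: "integrable \<mu> (\<lambda>z. w z * indicator (ball x r) z)" "integrable \<mu> (\<lambda>z. v z * indicator (ball x r) z)"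
      using w(1) v by (auto intro!: integrable_real_mult_indicator)
    have i2: "integrable \<mu> (\<lambda>z. s / 2 * indicator (ball x r) z)"
      by (intro integrable_mult_right integrable_real_indicator) (auto simp: emeasure_ball)
    have "iw w (ball x r) \<le> (LINT z|\<mu>. v z * indicator (ball x r) z + s / 2 * indicator (ball x r) z)"
      unfolding iw_def
    proof (intro integral_mono Bochner_Integration.integrable_add i1 i2)
      fix z
      have "w z \<le> v z + s / 2" using s by (simp add: v_def indicator_def)
      then show "w z * indicator (ball x r) z \<le> v z * indicator (ball x r) z + s / 2 * indicator (ball x r) z"
        by (simp add: indicator_def)
    qed
    also have "\<dots> = iw v (ball x r) + s / 2 * m x r" unfolding iw_def
      using i1(2) i2 by (subst Bochner_Integration.integral_add) auto
    also have "s / 2 * m x r \<le> s / 2 * m x (4 * r)" using s r by (intro mult_left_mono m_mono) auto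
    finally have "s / 2 * m x (4 * r) < iw v (ball x r)" using xr(2) by simp
    then show "z \<in> max_set v (s / 2)" using xr(1) unfolding max_set_def by blast
  qed
  then have "emeasure \<mu> (max_set w s) \<le> emeasure \<mu> (max_set v (s / 2))"
    using open_max_set by (intro emeasure_mono) auto
  also have "\<dots> \<le> ennreal ((LINT z|\<mu>. v z) / (s / 2))"
    using v v0 s by (intro emeasure_max_set_le) auto
  also have "\<dots> = ennreal (2 / s) * ennreal (LINT z|\<mu>. v z)"
    using s v0 by (subst ennreal_mult[symmetric]) (auto simp: field_simps intro!: Bochner_Integration.integral_nonneg)
  also have "ennreal (LINT z|\<mu>. v z) = (\<integral>\<^sup>+z. ennreal (v z) \<partial>\<mu>)"
    using v v0 by (intro nn_integral_eq_integral[symmetric]) auto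
  also have "(\<integral>\<^sup>+z. ennreal (v z) \<partial>\<mu>) = (\<integral>\<^sup>+z. ennreal (w z) * indicator {z. w z > s / 2} z \<partial>\<mu>)"
    by (intro nn_integral_cong) (auto simp: v_def indicator_def)
  finally show ?thesis .
qed

end

subsection \<open>Distribution functions and good lambda inequalities\<close>

lemma nn_integral_indicator_Ioo: 
  fixes a :: real assumes "a \<ge> 0"
  shows "(\<integral>\<^sup>+t. indicator {0<..<a} t \<partial>lborel) = ennreal a"
  using assms by (simp add: emeasure_lborel_Ioo)

lemma nn_integral_2t_Ioo:
  fixes a :: real assumes "a \<ge> 0"
  shows "(\<integral>\<^sup>+t. ennreal (2 * t) * indicator {0<..<a} t \<partial>lborel) = ennreal (a\<^sup>2)"
proof -
  have "(\<integral>\<^sup>+t. ennreal (2 * t) * indicator {0<..<a} t \<partial>lborel) = (\<integral>\<^sup>+t. ennreal (2 * t) * indicator {0..a} t \<partial>lborel)"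
  proof (rule nn_integral_cong_AE)
    show "AE t in lborel. ennreal (2 * t) * indicator {0<..<a} t = ennreal (2 * t) * indicator {0..a} t"
      using AE_lborel_singleton[of 0] AE_lborel_singleton[of a]
      by eventually_elim (auto simp: indicator_def)
  qed
  also have "\<dots> = ennreal (a\<^sup>2 - 0\<^sup>2)"
    using assms by (intro nn_integral_FTC_Icc) (auto intro!: derivative_eq_intros simp: power2_eq_square)
  finally show ?thesis by simp
qed

context sigma_finite_measure
begin

text \<open>Fubini for the function \<open>2 * t\<close> on the region
  \<open>0 < t < h x\<close>.\<close>

lemma layer_cake_square:
  assumes [measurable]: "h \<in> borel_measurable M" and h: "\<And>x. h x \<ge> (0::real)"
  shows "(\<integral>\<^sup>+x. ennreal ((h x)\<^sup>2) \<partial>M) =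
    (\<integral>\<^sup>+t. ennreal (2 * t) * emeasure M {x \<in> space M. h x > t} * indicator {0<..} t \<partial>lborel)"
proof -
  interpret P: pair_sigma_finite lborel M by standard
  have "(\<integral>\<^sup>+x. ennreal ((h x)\<^sup>2) \<partial>M) = (\<integral>\<^sup>+x. (\<integral>\<^sup>+t. ennreal (2 * t) * indicator {0<..<h x} t \<partial>lborel) \<partial>M)"
    using h by (simp add: nn_integral_2t_Ioo)
  also have "\<dots> = (\<integral>\<^sup>+t. (\<integral>\<^sup>+x. ennreal (2 * t) * indicator {0<..<h x} t \<partial>M) \<partial>lborel)"
    by (rule P.Fubini') (simp add: indicator_def)
  also have "\<dots> = (\<integral>\<^sup>+t. ennreal (2 * t) * emeasure M {x \<in> space M. h x > t} * indicator {0<..} t \<partial>lborel)"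
  proof (rule nn_integral_cong)
    fix t :: real
    have "(\<integral>\<^sup>+x. ennreal (2 * t) * indicator {0<..<h x} t \<partial>M) =
       (\<integral>\<^sup>+x. (ennreal (2 * t) * indicator {0<..} t) * indicator {x \<in> space M. h x > t} x \<partial>M)"
      by (intro nn_integral_cong) (auto simp: indicator_def)
    also have "\<dots> = (ennreal (2 * t) * indicator {0<..} t) * emeasure M {x \<in> space M. h x > t}"
      by (rule nn_integral_cmult_indicator) measurable
    finally show "(\<integral>\<^sup>+x. ennreal (2 * t) * indicator {0<..<h x} t \<partial>M) =
      ennreal (2 * t) * emeasure M {x \<in> space M. h x > t} * indicator {0<..} t" by (simp add: mult_ac)
  qed
  finally show ?thesis .
qed

lemma measurable_distribution_function:
  assumes [measurable]: "h \<in> borel_measurable M"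
  shows "(\<lambda>t::real. emeasure M {x \<in> space M. h x > t}) \<in> borel_measurable borel"
proof -
  have "(\<lambda>t::real. \<integral>\<^sup>+x. indicator {x \<in> space M. h x > t} x \<partial>M) \<in> borel_measurable borel"
    by (rule borel_measurable_nn_integral) (simp add: indicator_def)
  then show ?thesis by simp
qed

text \<open>Substituting \<open>t = 2 * s\<close> in the layer cake integral costs a factor 4, so
  the factor 1/8 leaves one half of the original integral, which is absorbed on the left. Absorption
  is legitimate only for finite quantities: \<open>weak\<close> supplies finiteness, and its
  constant \<open>A\<close> does not enter the result.\<close>

lemma good_lambda_integrated:
  assumes F[measurable]: "F \<in> borel_measurable M" and F0: "\<And>x. F x \<ge> (0::real)"
    and H[measurable]: "H \<in> borel_measurable borel"
    and good: "\<And>t. t > 0 \<Longrightarrow> emeasure M {x \<in> space M. F x > 2 * t} \<le>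
       ennreal (1/8) * emeasure M {x \<in> space M. F x > t} + H t"
    and weak: "\<And>t. t > 0 \<Longrightarrow> emeasure M {x \<in> space M. F x > t} \<le> ennreal (A / t)"
  shows "(\<integral>\<^sup>+x. ennreal ((F x)\<^sup>2) \<partial>M) \<le> 16 * (\<integral>\<^sup>+t. ennreal t * H t * indicator {0<..} t \<partial>lborel)"
proof -
  define e where "e t = emeasure M {x \<in> space M. F x > t}" for t
  have e[measurable]: "e \<in> borel_measurable borel" unfolding e_def by (rule measurable_distribution_function) fact
  define X where "X = (\<integral>\<^sup>+t. ennreal t * H t * indicator {0<..} t \<partial>lborel)"
  \<comment> \<open>Cutting the levels at \<open>n\<close> makes the integral finite, since
    \<open>2 * t * e t\<close> stays bounded by \<open>weak\<close>.\<close>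
  define I where "I n = (\<integral>\<^sup>+t. ennreal (2 * t) * e t * indicator {0<..<real n} t \<partial>lborel)" for n :: nat
  have Ifin: "I n < \<infinity>" for n
  proof -
    have "I n \<le> (\<integral>\<^sup>+t. ennreal (2 * \<bar>A\<bar>) * indicator {0<..<real n} t \<partial>lborel)"
      unfolding I_def
    proof (rule nn_integral_mono)
      fix t :: real
      show "ennreal (2 * t) * e t * indicator {0<..<real n} t \<le> ennreal (2 * \<bar>A\<bar>) * indicator {0<..<real n} t"
      proof (cases "0 < t \<and> t < real n")
        case True
        then have "ennreal (2 * t) * e t \<le> ennreal (2 * t) * ennreal (\<bar>A\<bar> / t)"
          using weak[of t] unfolding e_def
          by (intro mult_left_mono order_trans[OF weak] ennreal_leI divide_right_mono) auto
        also have "\<dots> = ennreal (2 * \<bar>A\<bar>)" using True by (subst ennreal_mult[symmetric]) auto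
        finally show ?thesis by (intro mult_right_mono) auto
      qed (auto simp: indicator_def)
    qed
    also have "\<dots> = ennreal (2 * \<bar>A\<bar>) * ennreal (real n)"
      by (subst nn_integral_cmult) (auto simp: nn_integral_indicator_Ioo)
    also have "\<dots> < \<infinity>" by (simp add: ennreal_mult_less_top)
    finally show ?thesis .
  qed
  have "I n \<le> 16 * X" for n
  proof -
    have "I n = ennreal 2 * (\<integral>\<^sup>+s. ennreal (2 * (2 * s)) * e (2 * s) * indicator {0<..<real n} (2 * s) \<partial>lborel)"
      unfolding I_def by (subst nn_integral_real_affine[of _ 2 0]) auto
    also have "\<dots> = (\<integral>\<^sup>+s. ennreal 2 * (ennreal (2 * (2 * s)) * e (2 * s) * indicator {0<..<real n} (2 * s)) \<partial>lborel)"
      by (subst nn_integral_cmult) auto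
    also have "\<dots> \<le> (\<integral>\<^sup>+s. ennreal (1/2) * (ennreal (2 * s) * e s * indicator {0<..<real n} s) +
        8 * (ennreal s * H s * indicator {0<..} s) \<partial>lborel)"
    proof (rule nn_integral_mono)
      fix s :: real
      show "ennreal 2 * (ennreal (2 * (2 * s)) * e (2 * s) * indicator {0<..<real n} (2 * s)) \<le>
        ennreal (1/2) * (ennreal (2 * s) * e s * indicator {0<..<real n} s) + 8 * (ennreal s * H s * indicator {0<..} s)"
      proof (cases "0 < s \<and> 2 * s < real n")
        case True
        have "ennreal 2 * (ennreal (2 * (2 * s)) * e (2 * s)) = ennreal (8 * s) * e (2 * s)"
          unfolding mult.assoc[symmetric] using True by (subst ennreal_mult[symmetric]) auto
        also have "\<dots> \<le> ennreal (8 * s) * (ennreal (1/8) * e s + H s)"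
          using good[of s] True unfolding e_def by (intro mult_left_mono) auto
        also have "\<dots> = ennreal (8 * s) * ennreal (1/8) * e s + ennreal (8 * s) * H s"
          by (simp add: distrib_left mult.assoc)
        also have "ennreal (8 * s) * ennreal (1/8) = ennreal (1/2) * ennreal (2 * s)"
        proof -
          have "ennreal (8 * s) * ennreal (1/8) = ennreal s" using True by (subst ennreal_mult[symmetric]) auto
          moreover have "ennreal (1/2) * ennreal (2 * s) = ennreal s" using True by (subst ennreal_mult[symmetric]) auto
          ultimately show ?thesis by (simp only:)
        qed
        also have "ennreal (8 * s) = 8 * ennreal s"
          using True by (simp add: ennreal_mult)
        finally show ?thesis using True by (simp add: mult.assoc)
      qed (auto simp: indicator_def)
    qed
    also have "\<dots> = ennreal (1/2) * I n + 8 * X"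
      unfolding I_def X_def by (subst nn_integral_add) (auto simp: nn_integral_cmult)
    finally have *: "I n \<le> ennreal (1/2) * I n + 8 * X" .
    show ?thesis
    proof (cases "X = \<infinity>")
      case True
      then show ?thesis by (simp add: ennreal_mult_top)
    next
      case False
      obtain i where i: "I n = ennreal i" "i \<ge> 0" using Ifin[of n] by (cases "I n") auto
      obtain x where x: "X = ennreal x" "x \<ge> 0" using False by (cases X) auto
      have "ennreal i \<le> ennreal (1/2) * ennreal i + ennreal 8 * ennreal x"
        using * unfolding i x by simp
      also have "\<dots> = ennreal (1/2 * i + 8 * x)"
        using i x by (subst (1 2) ennreal_mult[symmetric]) (auto simp: ennreal_plus)
      finally have "ennreal i \<le> ennreal (1/2 * i + 8 * x)" .
      then have "i \<le> 1/2 * i + 8 * x" using i x by (subst (asm) ennreal_le_iff) auto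
      then have "i \<le> 16 * x" by simp
      then have "ennreal i \<le> ennreal (16 * x)" by (rule ennreal_leI)
      then show ?thesis using i x by (simp add: ennreal_mult)
    qed
  qed
  moreover have "(\<integral>\<^sup>+x. ennreal ((F x)\<^sup>2) \<partial>M) = (SUP n. I n)"
  proof -
    have "(\<integral>\<^sup>+x. ennreal ((F x)\<^sup>2) \<partial>M) = (\<integral>\<^sup>+t. (SUP n::nat. ennreal (2 * t) * e t * indicator {0<..<real n} t) \<partial>lborel)"
      unfolding layer_cake_square[OF F F0] e_def[symmetric]
    proof (rule nn_integral_cong)
      fix t :: real
      obtain n0 :: nat where n0: "t < n0" using reals_Archimedean2 by blast
      show "ennreal (2 * t) * e t * indicator {0<..} t = (SUP n::nat. ennreal (2 * t) * e t * indicator {0<..<real n} t)"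
      proof (rule antisym)
        have "ennreal (2 * t) * e t * indicator {0<..} t = ennreal (2 * t) * e t * indicator {0<..<real n0} t"
          using n0 by (auto simp: indicator_def)
        also have "\<dots> \<le> (SUP n::nat. ennreal (2 * t) * e t * indicator {0<..<real n} t)" by (rule SUP_upper) auto
        finally show "ennreal (2 * t) * e t * indicator {0<..} t \<le> (SUP n::nat. ennreal (2 * t) * e t * indicator {0<..<real n} t)" .
        show "(SUP n::nat. ennreal (2 * t) * e t * indicator {0<..<real n} t) \<le> ennreal (2 * t) * e t * indicator {0<..} t"
          by (rule SUP_least) (auto simp: indicator_def)
      qed
    qed
    also have "\<dots> = (SUP n. I n)" unfolding I_def
      by (rule nn_integral_monotone_convergence_SUP) (auto simp: incseq_def le_fun_def indicator_def)
    finally show ?thesis .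
  qed
  ultimately show ?thesis unfolding X_def by (simp add: SUP_least)
qed

end

context doubling_space
begin

text \<open>After the truncated maximal estimate is inserted and the integrals are exchanged, the
  level integral of \<open>w z\<close> runs over \<open>0 < t < 2 * w z / \<gamma>\<close> and
  yields the square. The constant 64 is 16 from absorption, times 2 from the maximal estimate, times
  2 from the truncation level.\<close>

lemma good_lambda_L2:
  assumes w: "integrable \<mu> w" "\<And>z. w z \<ge> 0" and F[measurable]: "F \<in> borel_measurable \<mu>" and F0: "\<And>x. F x \<ge> (0::real)"
    and \<gamma>: "\<gamma> > 0"
    and good: "\<And>t. t > 0 \<Longrightarrow> emeasure \<mu> {x. F x > 2 * t} \<le>
       ennreal (1/8) * emeasure \<mu> {x. F x > t} + emeasure \<mu> (max_set w (\<gamma> * t))"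
    and weak: "\<And>t. t > 0 \<Longrightarrow> emeasure \<mu> {x. F x > t} \<le> ennreal (A / t)"
  shows "(\<integral>\<^sup>+x. ennreal ((F x)\<^sup>2) \<partial>\<mu>) \<le> ennreal (64 / \<gamma>\<^sup>2) * (\<integral>\<^sup>+x. ennreal ((w x)\<^sup>2) \<partial>\<mu>)"
proof -
  have [measurable]: "w \<in> borel_measurable \<mu>" using w by auto
  define H where "H t = ennreal (2 / (\<gamma> * t)) * (\<integral>\<^sup>+z. ennreal (w z) * indicator {z. w z > \<gamma> * t / 2} z \<partial>\<mu>)" for t
  have "(\<lambda>t. \<integral>\<^sup>+z. ennreal (w z) * indicator {z. w z > \<gamma> * t / 2} z \<partial>\<mu>) \<in> borel_measurable borel"
    by (rule borel_measurable_nn_integral) (simp add: indicator_def)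
  then have Hm[measurable]: "H \<in> borel_measurable borel" unfolding H_def by measurable
  interpret P: pair_sigma_finite lborel \<mu> by standard
  have "(\<integral>\<^sup>+x. ennreal ((F x)\<^sup>2) \<partial>\<mu>) \<le> 16 * (\<integral>\<^sup>+t. ennreal t * H t * indicator {0<..} t \<partial>lborel)"
  proof (rule good_lambda_integrated[OF F F0 Hm])
    fix t :: real assume t: "t > 0"
    have "emeasure \<mu> (max_set w (\<gamma> * t)) \<le> H t" unfolding H_def
      using w \<gamma> t by (intro emeasure_max_set_le_truncated) auto
    then show "emeasure \<mu> {x \<in> space \<mu>. F x > 2 * t} \<le> ennreal (1/8) * emeasure \<mu> {x \<in> space \<mu>. F x > t} + H t"
      using good[OF t] by (simp add: order_trans[OF _ add_left_mono])
  qed (use weak in auto)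
  also have "(\<integral>\<^sup>+t. ennreal t * H t * indicator {0<..} t \<partial>lborel) =
    (\<integral>\<^sup>+t. (\<integral>\<^sup>+z. ennreal (2 / \<gamma>) * (ennreal (w z) * indicator {0<..<2 * w z / \<gamma>} t) \<partial>\<mu>) \<partial>lborel)"
  proof (rule nn_integral_cong)
    fix t :: real
    show "ennreal t * H t * indicator {0<..} t =
      (\<integral>\<^sup>+z. ennreal (2 / \<gamma>) * (ennreal (w z) * indicator {0<..<2 * w z / \<gamma>} t) \<partial>\<mu>)"
    proof (cases "t > 0")
      case True
      have "ennreal t * H t = ennreal (2 / \<gamma>) * (\<integral>\<^sup>+z. ennreal (w z) * indicator {z. w z > \<gamma> * t / 2} z \<partial>\<mu>)"
        unfolding H_def mult.assoc[symmetric] using True \<gamma> by (subst ennreal_mult[symmetric]) auto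
      also have "\<dots> = (\<integral>\<^sup>+z. ennreal (2 / \<gamma>) * (ennreal (w z) * indicator {z. w z > \<gamma> * t / 2} z) \<partial>\<mu>)"
        by (subst nn_integral_cmult) (auto simp: indicator_def)
      also have "\<dots> = (\<integral>\<^sup>+z. ennreal (2 / \<gamma>) * (ennreal (w z) * indicator {0<..<2 * w z / \<gamma>} t) \<partial>\<mu>)"
        using True \<gamma> by (intro nn_integral_cong) (auto simp: indicator_def field_simps)
      finally show ?thesis using True by simp
    qed auto
  qed
  also have "\<dots> = (\<integral>\<^sup>+z. (\<integral>\<^sup>+t. ennreal (2 / \<gamma>) * (ennreal (w z) * indicator {0<..<2 * w z / \<gamma>} t) \<partial>lborel) \<partial>\<mu>)"
    by (rule P.Fubini'[symmetric]) (simp add: indicator_def)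
  also have "\<dots> = (\<integral>\<^sup>+z. ennreal (4 / \<gamma>\<^sup>2) * ennreal ((w z)\<^sup>2) \<partial>\<mu>)"
  proof (rule nn_integral_cong)
    fix z
    have "(\<integral>\<^sup>+t. ennreal (2 / \<gamma>) * (ennreal (w z) * indicator {0<..<2 * w z / \<gamma>} t) \<partial>lborel) =
      ennreal (2 / \<gamma>) * (ennreal (w z) * ennreal (2 * w z / \<gamma>))"
      using w(2)[of z] \<gamma> by (simp add: nn_integral_cmult emeasure_lborel_Ioo)
    also have "\<dots> = ennreal (4 / \<gamma>\<^sup>2 * (w z)\<^sup>2)"
      using w(2)[of z] \<gamma> by (simp add: ennreal_mult[symmetric] power2_eq_square)
    finally show "(\<integral>\<^sup>+t. ennreal (2 / \<gamma>) * (ennreal (w z) * indicator {0<..<2 * w z / \<gamma>} t) \<partial>lborel) =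
      ennreal (4 / \<gamma>\<^sup>2) * ennreal ((w z)\<^sup>2)" by (simp add: ennreal_mult[symmetric])
  qed
  also have "\<dots> = ennreal (4 / \<gamma>\<^sup>2) * (\<integral>\<^sup>+z. ennreal ((w z)\<^sup>2) \<partial>\<mu>)" by (rule nn_integral_cmult) measurable
  also have "16 * (ennreal (4 / \<gamma>\<^sup>2) * (\<integral>\<^sup>+z. ennreal ((w z)\<^sup>2) \<partial>\<mu>)) = ennreal (64 / \<gamma>\<^sup>2) * (\<integral>\<^sup>+z. ennreal ((w z)\<^sup>2) \<partial>\<mu>)"
  proof -
    have "16 * ennreal (4 / \<gamma>\<^sup>2) = ennreal 16 * ennreal (4 / \<gamma>\<^sup>2)" by simp
    also have "\<dots> = ennreal (64 / \<gamma>\<^sup>2)" by (subst ennreal_mult[symmetric]) auto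
    finally show ?thesis by (simp add: mult.assoc[symmetric])
  qed
  finally show ?thesis .
qed

end

subsection \<open>Bounded functions with bounded support, and annuli\<close>

text \<open>For a non-integrable function the Bochner integral is 0 by convention and the bound is
  trivial.\<close>

lemma ennreal_norm_integral_le:
  fixes f :: "'a \<Rightarrow> complex"
  shows "ennreal (norm (LINT x|M. f x)) \<le> (\<integral>\<^sup>+x. ennreal (norm (f x)) \<partial>M)"
proof (cases "integrable M f")
  case True
  then show ?thesis by (rule integral_norm_bound_ennreal)
next
  case False
  then show ?thesis by (simp add: not_integrable_integral_eq)
qed

lemma ex_scale:
  fixes R d :: real
  assumes "R > 0" "d \<ge> R"
  obtains j :: nat where "32 ^ j * R \<le> d" "d < 32 ^ (j + 1) * R"
proof -
  have "32 > (1::real)" by simp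
  from real_arch_pow[OF this, of "d / R"] obtain n where "d / R < 32 ^ n" by blast
  then have n: "d < 32 ^ n * R" using assms by (simp add: field_simps)
  define k where "k = (LEAST n. d < 32 ^ n * R)"
  have k: "d < 32 ^ k * R" unfolding k_def by (rule LeastI, rule n)
  have "k \<noteq> 0" using k assms by (cases k) auto
  then obtain j where j: "k = Suc j" by (cases k) auto
  have "\<not> d < 32 ^ j * R" using not_less_Least[of j "\<lambda>n. d < 32 ^ n * R"] j unfolding k_def by simp
  then show thesis using k j by (intro that[of j]) auto
qed

context doubling_space
begin

lemma Linf_bI:
  assumes "g \<in> borel_measurable \<mu>" "AE x in \<mu>. norm (g x) \<le> B" "AE x in \<mu>. x \<notin> ball x0 R \<longrightarrow> g x = 0"
  shows "g \<in> Linf_b \<mu>"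
proof -
  have "AE x in \<mu>. x \<notin> cball x0 R \<longrightarrow> g x = 0" using assms(3) by eventually_elim auto
  then have "supp \<mu> g \<subseteq> cball x0 R" by (intro supp_least(3)) auto
  then have "bounded (supp \<mu> g)" using bounded_cball bounded_subset by blast
  then show ?thesis using assms unfolding Linf_b_def by blast
qed

lemma Linf_bE:
  assumes "f \<in> Linf_b \<mu>"
  obtains B R where "B > 0" "R > 0" "AE x in \<mu>. norm (f x) \<le> B" "AE x in \<mu>. x \<notin> ball x0 R \<longrightarrow> f x = 0"
proof -
  from assms obtain B where B: "AE x in \<mu>. norm (f x) \<le> B" and b: "bounded (supp \<mu> f)"
    unfolding Linf_b_def by blast
  obtain e where e: "\<And>y. y \<in> supp \<mu> f \<Longrightarrow> dist x0 y \<le> e" using bounded_any_center[of _ x0] b by metis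
  show thesis
  proof (rule that[of "max B 1" "max e 0 + 1"])
    show "AE x in \<mu>. norm (f x) \<le> max B 1" using B by eventually_elim auto
    show "AE x in \<mu>. x \<notin> ball x0 (max e 0 + 1) \<longrightarrow> f x = 0"
      using supp_least(2)[of \<mu> f]
    proof eventually_elim
      case (elim x)
      show ?case
      proof
        assume "x \<notin> ball x0 (max e 0 + 1)"
        then have "x \<notin> supp \<mu> f" using e[of x] by auto
        then show "f x = 0" using elim by blast
      qed
    qed
  qed auto
qed

lemma Linf_b_measurable: "f \<in> Linf_b \<mu> \<Longrightarrow> f \<in> borel_measurable \<mu>"
  unfolding Linf_b_def by blast

lemma Linf_b_dominated:
  assumes f: "f \<in> Linf_b \<mu>" and g: "g \<in> borel_measurable \<mu>" and le: "AE x in \<mu>. norm (g x) \<le> c * norm (f x)"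
  shows "g \<in> Linf_b \<mu>"
proof -
  fix x0 :: 'a
  obtain B R where "B > 0" "R > 0" and BR: "AE x in \<mu>. norm (f x) \<le> B" "AE x in \<mu>. x \<notin> ball x0 R \<longrightarrow> f x = 0"
    using Linf_bE[OF f] .
  show ?thesis
  proof (rule Linf_bI[OF g])
    show "AE x in \<mu>. norm (g x) \<le> \<bar>c\<bar> * B"
      using le BR(1)
    proof eventually_elim
      case (elim x)
      have "c * norm (f x) \<le> \<bar>c\<bar> * B" using elim(2) by (intro mult_mono) auto
      with elim show ?case by linarith
    qed
    show "AE x in \<mu>. x \<notin> ball x0 R \<longrightarrow> g x = 0"
      using le BR(2) by eventually_elim auto
  qed
qed

lemma Linf_b_add:
  assumes f: "f \<in> Linf_b \<mu>" and g: "g \<in> Linf_b \<mu>"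
  shows "(\<lambda>x. f x + g x) \<in> Linf_b \<mu>"
proof -
  fix x0 :: 'a
  obtain B R where "B > 0" "R > 0" and 1: "AE x in \<mu>. norm (f x) \<le> B" "AE x in \<mu>. x \<notin> ball x0 R \<longrightarrow> f x = 0"
    using Linf_bE[OF f] .
  obtain B' R' where "B' > 0" "R' > 0" and 2: "AE x in \<mu>. norm (g x) \<le> B'" "AE x in \<mu>. x \<notin> ball x0 R' \<longrightarrow> g x = 0"
    using Linf_bE[OF g] .
  show ?thesis
  proof (rule Linf_bI)
    show "(\<lambda>x. f x + g x) \<in> borel_measurable \<mu>" using f g Linf_b_measurable by auto
    show "AE x in \<mu>. norm (f x + g x) \<le> B + B'"
      using 1(1) 2(1) by eventually_elim (rule order_trans[OF norm_triangle_ineq add_mono])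
    show "AE x in \<mu>. x \<notin> ball x0 (max R R') \<longrightarrow> f x + g x = 0"
      using 1(2) 2(2) by eventually_elim auto
  qed
qed

lemma Linf_b_cmult: "f \<in> Linf_b \<mu> \<Longrightarrow> (\<lambda>x. c * f x) \<in> Linf_b \<mu>"
  by (rule Linf_b_dominated[of f _ "norm c"]) (simp_all add: norm_mult borel_measurable_times Linf_b_measurable)

lemma Linf_b_lincomb: "f \<in> Linf_b \<mu> \<Longrightarrow> g \<in> Linf_b \<mu> \<Longrightarrow> (\<lambda>x. a * f x + b * g x) \<in> Linf_b \<mu>"
  by (intro Linf_b_add Linf_b_cmult)

lemma Linf_b_diff: "f \<in> Linf_b \<mu> \<Longrightarrow> g \<in> Linf_b \<mu> \<Longrightarrow> (\<lambda>x. f x - g x) \<in> Linf_b \<mu>"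
  using Linf_b_lincomb[of f g 1 "-1"] by simp

lemma Linf_b_zero: "(\<lambda>x. 0) \<in> Linf_b \<mu>"
  by (rule Linf_bI[of _ 0 undefined 0]) auto

lemma Linf_b_sum: "finite I \<Longrightarrow> (\<And>i. i \<in> I \<Longrightarrow> f i \<in> Linf_b \<mu>) \<Longrightarrow> (\<lambda>x. \<Sum>i\<in>I. f i x) \<in> Linf_b \<mu>"
  by (induction I rule: finite_induct) (auto intro: Linf_b_zero Linf_b_add)

lemma Linf_b_restrict: "f \<in> Linf_b \<mu> \<Longrightarrow> A \<in> sets \<mu> \<Longrightarrow> (\<lambda>x. f x * indicator A x) \<in> Linf_b \<mu>"
  by (rule Linf_b_dominated[of f _ 1])
    (simp_all add: norm_mult borel_measurable_times Linf_b_measurable indicator_def)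

lemma Linf_b_indicator: "A \<in> sets \<mu> \<Longrightarrow> A \<subseteq> ball x0 R \<Longrightarrow> (\<lambda>x. c * indicator A x) \<in> Linf_b \<mu>"
  by (rule Linf_bI[of _ "norm c" x0 R]) (auto intro!: AE_I2 simp: indicator_def)

lemma Linf_b_powr_integrable:
  assumes f: "f \<in> Linf_b \<mu>" and p: "p > 0"
  shows "integrable \<mu> (\<lambda>x. norm (f x) powr p)"
proof -
  fix x0 :: 'a
  obtain B R where BR: "B > 0" "R > 0" "AE x in \<mu>. norm (f x) \<le> B" "AE x in \<mu>. x \<notin> ball x0 R \<longrightarrow> f x = 0"
    using Linf_bE[OF f] .
  note [measurable] = Linf_b_measurable[OF f]
  show ?thesis
  proof (rule Bochner_Integration.integrable_bound)
    show "integrable \<mu> (\<lambda>x. B powr p * indicator (ball x0 R) x)"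
      by (intro integrable_mult_right integrable_real_indicator) (auto simp: emeasure_ball)
    show "AE x in \<mu>. norm (norm (f x) powr p) \<le> norm (B powr p * indicator (ball x0 R) x)"
      using BR(3,4)
    proof eventually_elim
      case (elim x)
      then show ?case using p BR(1) by (cases "x \<in> ball x0 R") (auto intro!: powr_mono2)
    qed
  qed measurable
qed

lemma Linf_b_integrable: "f \<in> Linf_b \<mu> \<Longrightarrow> integrable \<mu> f"
  using Linf_b_powr_integrable[of f 1] by (intro integrable_norm_cancel[OF _ Linf_b_measurable]) auto

lemma Linf_b_integrable_norm: "f \<in> Linf_b \<mu> \<Longrightarrow> integrable \<mu> (\<lambda>x. norm (f x))"
  using Linf_b_integrable by auto

lemma nn_integral_norm_Linf_b: "f \<in> Linf_b \<mu> \<Longrightarrow> (\<integral>\<^sup>+x. ennreal (norm (f x)) \<partial>\<mu>) = ennreal (LINT x|\<mu>. norm (f x))"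
  by (intro nn_integral_eq_integral Linf_b_integrable_norm) auto

lemma nn_integral_ball_eq_iw:
  assumes "integrable \<mu> w" "\<And>z. w z \<ge> 0"
  shows "(\<integral>\<^sup>+z. ennreal (w z) * indicator (ball x r) z \<partial>\<mu>) = ennreal (iw w (ball x r))"
proof -
  have "(\<integral>\<^sup>+z. ennreal (w z) * indicator (ball x r) z \<partial>\<mu>) = (\<integral>\<^sup>+z. ennreal (w z * indicator (ball x r) z) \<partial>\<mu>)"
    by (intro nn_integral_cong) (auto simp: indicator_def)
  also have "\<dots> = ennreal (iw w (ball x r))" unfolding iw_def using assms
    by (intro nn_integral_eq_integral integrable_real_mult_indicator) auto
  finally show ?thesis .
qed

section \<open>Integrals of radial kernels over annuli\<close>

lemma dist_measurable [measurable]: "(\<lambda>z. dist x z) \<in> borel_measurable \<mu>"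
  using borel_measurable_continuous_onI[of "\<lambda>z. dist x z"]
  by (simp add: continuous_on_dist continuous_on_const continuous_on_id measurable_cong_sets[OF sets_mu refl])

text \<open>Monotonicity is known on positive radii only, so \<open>\<Lambda> x\<close> is extended
  by 0 to a monotone, hence Borel, function; its value at distance 0 is put back separately.\<close>

lemma Lam_dist_measurable [measurable]: "(\<lambda>z. \<Lambda> x (dist x z)) \<in> borel_measurable \<mu>"
proof -
  define g where "g s = (if s > 0 then \<Lambda> x s else 0)" for s
  have "mono g" unfolding g_def mono_def using Lam_pos[of _ x] Lam_mono[of _ _ x] by (auto intro: less_imp_le)
  then have [measurable]: "g \<in> borel_measurable borel" by (rule borel_measurable_mono)
  have "(\<lambda>z. if dist x z > 0 then g (dist x z) else \<Lambda> x 0) \<in> borel_measurable \<mu>" by measurable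
  also have "(\<lambda>z. if dist x z > 0 then g (dist x z) else \<Lambda> x 0) = (\<lambda>z. \<Lambda> x (dist x z))"
    by (auto simp: g_def fun_eq_iff)
  finally show ?thesis .
qed

text \<open>Between \<open>32 ^ j * r\<close> and \<open>32 ^ (j + 1) * r\<close> the kernel is at
  most its value at the inner radius, which cancels the \<open>\<Lambda>\<close> in the bound on the
  mass. It is applied to \<open>norm (f z)\<close> in the good lambda argument and to the constant 1
  for the bad parts.\<close>

lemma nn_integral_annuli:
  fixes w :: "'a \<Rightarrow> real"
  assumes r: "r > 0" and [measurable]: "w \<in> borel_measurable \<mu>"
    and b: "\<And>j. j \<le> n \<Longrightarrow> (\<integral>\<^sup>+z. ennreal (w z) * indicator (ball x (32 ^ (j + 1) * r)) z \<partial>\<mu>) \<le> ennreal (b j * \<Lambda> x (32 ^ j * r))"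
    and b0: "\<And>j. b j \<ge> 0"
  shows "(\<integral>\<^sup>+z. ennreal (w z) * ennreal (1 / \<Lambda> x (dist x z)) * indicator (ball x (32 ^ (n + 1) * r) - ball x r) z \<partial>\<mu>)
    \<le> ennreal (\<Sum>j\<le>n. b j)"
proof -
  define l where "l j = \<Lambda> x (32 ^ j * r)" for j :: nat
  have l: "l j > 0" for j unfolding l_def using r by (intro Lam_pos) simp
  have "(\<integral>\<^sup>+z. ennreal (w z) * ennreal (1 / \<Lambda> x (dist x z)) * indicator (ball x (32 ^ (n + 1) * r) - ball x r) z \<partial>\<mu>)
    \<le> (\<integral>\<^sup>+z. (\<Sum>j\<le>n. ennreal (1 / l j) * (ennreal (w z) * indicator (ball x (32 ^ (j + 1) * r)) z)) \<partial>\<mu>)"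
  proof (rule nn_integral_mono)
    fix z
    show "ennreal (w z) * ennreal (1 / \<Lambda> x (dist x z)) * indicator (ball x (32 ^ (n + 1) * r) - ball x r) z
      \<le> (\<Sum>j\<le>n. ennreal (1 / l j) * (ennreal (w z) * indicator (ball x (32 ^ (j + 1) * r)) z))" (is "_ \<le> sum ?f _")
    proof (cases "z \<in> ball x (32 ^ (n + 1) * r) - ball x r")
      case True
      then have d: "dist x z \<ge> r" "dist x z < 32 ^ (n + 1) * r" by auto
      obtain j where j: "32 ^ j * r \<le> dist x z" "dist x z < 32 ^ (j + 1) * r" using ex_scale[OF r d(1)] .
      have "32 ^ j * r < 32 ^ (n + 1) * r" using j(1) d(2) by linarith
      then have "(32::real) ^ j < 32 ^ (n + 1)" using r by simp
      then have jn: "j \<le> n" by (simp add: power_strict_increasing_iff less_Suc_eq_le del: power_Suc)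
      have "l j \<le> \<Lambda> x (dist x z)" unfolding l_def using j(1) r by (intro Lam_mono) auto
      then have "1 / \<Lambda> x (dist x z) \<le> 1 / l j" using l[of j] by (simp add: frac_le)
      then have "ennreal (w z) * ennreal (1 / \<Lambda> x (dist x z)) \<le> ennreal (w z) * ennreal (1 / l j)"
        by (intro mult_left_mono ennreal_leI) auto
      also have "\<dots> = ?f j" using j by (simp add: mult.commute)
      also have "\<dots> \<le> sum ?f {..n}" using jn by (intro member_le_sum) auto
      finally show ?thesis using True by simp
    qed auto
  qed
  also have "\<dots> = (\<Sum>j\<le>n. ennreal (1 / l j) * (\<integral>\<^sup>+z. ennreal (w z) * indicator (ball x (32 ^ (j + 1) * r)) z \<partial>\<mu>))"
    by (subst nn_integral_sum) (auto simp: nn_integral_cmult)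
  also have "\<dots> \<le> (\<Sum>j\<le>n. ennreal (1 / l j) * ennreal (b j * l j))"
    unfolding l_def using b by (intro sum_mono mult_left_mono) auto
  also have "\<dots> = (\<Sum>j\<le>n. ennreal (b j))"
    using l b0 by (intro sum.cong refl) (subst ennreal_mult[symmetric], auto simp: less_imp_le less_imp_neq[symmetric])
  also have "\<dots> = ennreal (\<Sum>j\<le>n. b j)" using b0 by (simp add: sum_ennreal)
  finally show ?thesis .
qed

text \<open>The same decomposition, now into infinitely many annuli: on the \<open>j\<close>-th one
  the factor \<open>(R / dist x z) powr \<tau>\<close> is at most
  \<open>(32 powr (- \<tau>)) ^ j\<close>, so the bounds form a geometric series.\<close>

lemma nn_integral_far:
  fixes w :: "'a \<Rightarrow> real"
  assumes R: "R > 0" and [measurable]: "w \<in> borel_measurable \<mu>" and a: "a \<ge> 0" and \<tau>: "\<tau> > 0"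
    and b: "\<And>j. (\<integral>\<^sup>+z. ennreal (w z) * indicator (ball x (32 ^ (j + 1) * R)) z \<partial>\<mu>) \<le> ennreal (a * \<Lambda> x (32 ^ j * R))"
  shows "(\<integral>\<^sup>+z. ennreal (w z) * ennreal (R powr \<tau> / (dist x z powr \<tau> * \<Lambda> x (dist x z))) * indicator (- ball x R) z \<partial>\<mu>)
    \<le> ennreal (a / (1 - 32 powr (-\<tau>)))"
proof -
  define \<theta> :: real where "\<theta> = 32 powr (-\<tau>)"
  have th: "0 < \<theta>" "\<theta> < 1" unfolding \<theta>_def using \<tau> powr_less_mono[of "-\<tau>" 0 32] by auto
  define l where "l j = \<Lambda> x (32 ^ j * R)" for j :: nat
  have l: "l j > 0" for j unfolding l_def using R by (intro Lam_pos) simp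
  have "(\<integral>\<^sup>+z. ennreal (w z) * ennreal (R powr \<tau> / (dist x z powr \<tau> * \<Lambda> x (dist x z))) * indicator (- ball x R) z \<partial>\<mu>)
    \<le> (\<integral>\<^sup>+z. (\<Sum>j. ennreal (\<theta> ^ j / l j) * (ennreal (w z) * indicator (ball x (32 ^ (j + 1) * R)) z)) \<partial>\<mu>)"
  proof (rule nn_integral_mono)
    fix z
    show "ennreal (w z) * ennreal (R powr \<tau> / (dist x z powr \<tau> * \<Lambda> x (dist x z))) * indicator (- ball x R) z
      \<le> (\<Sum>j. ennreal (\<theta> ^ j / l j) * (ennreal (w z) * indicator (ball x (32 ^ (j + 1) * R)) z))" (is "_ \<le> suminf ?f")
    proof (cases "z \<in> - ball x R")
      case True
      then have d: "dist x z \<ge> R" by auto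
      obtain j where j: "32 ^ j * R \<le> dist x z" "dist x z < 32 ^ (j + 1) * R" using ex_scale[OF R d] .
      have "l j \<le> \<Lambda> x (dist x z)" unfolding l_def using j(1) R by (intro Lam_mono) auto
      moreover have "(32 ^ j * R) powr \<tau> \<le> dist x z powr \<tau>" using j(1) R \<tau> by (intro powr_mono2) auto
      ultimately have "(32 ^ j * R) powr \<tau> * l j \<le> dist x z powr \<tau> * \<Lambda> x (dist x z)"
        using l[of j] by (intro mult_mono) auto
      then have "R powr \<tau> / (dist x z powr \<tau> * \<Lambda> x (dist x z)) \<le> R powr \<tau> / ((32 ^ j * R) powr \<tau> * l j)"
        using l[of j] R Lam_pos[of "dist x z" x] less_le_trans[OF R d] by (intro divide_left_mono mult_pos_pos) auto
      also have "\<dots> = \<theta> ^ j / l j"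
      proof -
        have "((32::real) ^ j) powr \<tau> = (32 powr \<tau>) ^ j"
          by (simp add: powr_realpow[symmetric] powr_powr powr_power mult.commute)
        then have "(32 ^ j * R) powr \<tau> = (32 powr \<tau>) ^ j * R powr \<tau>" using R by (simp add: powr_mult)
        moreover have "\<theta> ^ j = 1 / (32 powr \<tau>) ^ j" unfolding \<theta>_def by (simp add: powr_minus_divide power_one_over)
        ultimately show ?thesis using R by simp
      qed
      finally have "ennreal (w z) * ennreal (R powr \<tau> / (dist x z powr \<tau> * \<Lambda> x (dist x z))) \<le> ennreal (w z) * ennreal (\<theta> ^ j / l j)"
        by (intro mult_left_mono ennreal_leI) auto
      also have "\<dots> = ?f j" using j by (simp add: mult.commute)
      also have "\<dots> \<le> suminf ?f" using sum_le_suminf[of ?f "{j}"] by simp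
      finally show ?thesis using True by simp
    qed auto
  qed
  also have "\<dots> = (\<Sum>j. ennreal (\<theta> ^ j / l j) * (\<integral>\<^sup>+z. ennreal (w z) * indicator (ball x (32 ^ (j + 1) * R)) z \<partial>\<mu>))"
    by (subst nn_integral_suminf) (auto simp: nn_integral_cmult)
  also have "\<dots> \<le> (\<Sum>j. ennreal (\<theta> ^ j / l j) * ennreal (a * l j))"
    unfolding l_def using b by (intro suminf_le mult_left_mono) auto
  also have "\<dots> = (\<Sum>j. ennreal (a * \<theta> ^ j))"
  proof (rule suminf_cong)
    fix j
    show "ennreal (\<theta> ^ j / l j) * ennreal (a * l j) = ennreal (a * \<theta> ^ j)"
      using l[of j] th a by (subst ennreal_mult[symmetric]) auto
  qed
  also have "\<dots> = ennreal (a / (1 - \<theta>))"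
  proof (rule suminf_ennreal_eq)
    show "(\<lambda>j. a * \<theta> ^ j) sums (a / (1 - \<theta>))"
      using sums_mult[OF geometric_sums[of \<theta>], of a] th by simp
  qed (use a th in auto)
  finally show ?thesis unfolding \<theta>_def .
qed

end

subsection \<open>Kernel estimates\<close>

locale CZ_space = doubling_space \<mu> \<Lambda> L \<beta> N
  for \<mu> :: "'a::{metric_space, second_countable_topology} measure" and \<Lambda> L \<beta> N +
  fixes K :: "'a \<Rightarrow> 'a \<Rightarrow> complex" and T :: "('a \<Rightarrow> complex) \<Rightarrow> 'a \<Rightarrow> complex" and \<kappa> \<tau> :: real
  assumes kappa_pos: "\<kappa> > 0" and tau_pos: "\<tau> > 0"
    and K_size: "x \<noteq> y \<Longrightarrow> norm (K x y) \<le> \<kappa> / \<Lambda> x (dist x y)"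
    and K_regular: "x \<noteq> y \<Longrightarrow> dist x y \<ge> 2 * dist x x' \<Longrightarrow>
      norm (K x y - K x' y) + norm (K y x - K y x') \<le> \<kappa> * (dist x x' powr \<tau> / (dist x y powr \<tau> * \<Lambda> x (dist x y)))"
    and CZ: "CZ_operator \<mu> K T"
begin

section \<open>Linearity of the operator and measurability of its kernel\<close>

lemma T_measurable: "f \<in> Linf_b \<mu> \<Longrightarrow> T f \<in> borel_measurable \<mu>"
  using CZ unfolding CZ_operator_def linear_operator_on_def by blast

lemma T_cong: "f \<in> Linf_b \<mu> \<Longrightarrow> g \<in> Linf_b \<mu> \<Longrightarrow> AE x in \<mu>. f x = g x \<Longrightarrow> AE x in \<mu>. T f x = T g x"
  using CZ unfolding CZ_operator_def linear_operator_on_def by blast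

lemma T_lincomb: "f \<in> Linf_b \<mu> \<Longrightarrow> g \<in> Linf_b \<mu> \<Longrightarrow>
    AE x in \<mu>. T (\<lambda>y. a * f y + b * g y) x = a * T f x + b * T g x"
  using CZ unfolding CZ_operator_def linear_operator_on_def by blast

lemma T_add: "f \<in> Linf_b \<mu> \<Longrightarrow> g \<in> Linf_b \<mu> \<Longrightarrow> AE x in \<mu>. T (\<lambda>y. f y + g y) x = T f x + T g x"
  using T_lincomb[of f g 1 1] by simp

lemma T_diff: "f \<in> Linf_b \<mu> \<Longrightarrow> g \<in> Linf_b \<mu> \<Longrightarrow> AE x in \<mu>. T (\<lambda>y. f y - g y) x = T f x - T g x"
  using T_lincomb[of f g 1 "-1"] by simp

lemma T_zero: "AE x in \<mu>. T (\<lambda>y. 0) x = 0"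
  using T_lincomb[OF Linf_b_zero Linf_b_zero, of 0 0] by simp

lemma T_sum:
  assumes "finite I" "\<And>i. i \<in> I \<Longrightarrow> f i \<in> Linf_b \<mu>"
  shows "AE x in \<mu>. T (\<lambda>y. \<Sum>i\<in>I. f i y) x = (\<Sum>i\<in>I. T (f i) x)"
  using assms
proof (induction I rule: finite_induct)
  case empty
  then show ?case using T_zero by simp
next
  case (insert i I)
  have "AE x in \<mu>. T (\<lambda>y. f i y + (\<Sum>i\<in>I. f i y)) x = T (f i) x + T (\<lambda>y. \<Sum>i\<in>I. f i y) x"
    using insert by (intro T_add Linf_b_sum) auto
  moreover have "AE x in \<mu>. T (\<lambda>y. \<Sum>i\<in>I. f i y) x = (\<Sum>i\<in>I. T (f i) x)" using insert by auto
  ultimately show ?case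
  proof eventually_elim
    case (elim x)
    then show ?case using insert(1,2) by simp
  qed
qed

text \<open>As the support is the least closed set off which \<open>f\<close> vanishes almost
  everywhere, it is disjoint from any open set on which \<open>f\<close> does.\<close>

lemma T_eq_integral:
  assumes f: "f \<in> Linf_b \<mu>" and V: "open V" "AE x in \<mu>. x \<in> V \<longrightarrow> f x = 0"
  shows "AE x in \<mu>. x \<in> V \<longrightarrow> T f x = (LINT y|\<mu>. K x y * f y)"
proof -
  have "AE x in \<mu>. x \<notin> - V \<longrightarrow> f x = 0" using V(2) by simp
  then have "supp \<mu> f \<subseteq> - V" using V(1) by (intro supp_least(3)) auto
  moreover have "AE x in \<mu>. x \<notin> supp \<mu> f \<longrightarrow> T f x = (LINT y|\<mu>. K x y * f y)"
    using CZ f unfolding CZ_operator_def by blast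
  ultimately show ?thesis by (auto elim: AE_mp)
qed

text \<open>A standard kernel comes without measurability. The regularity estimate is a Hoelder
  modulus away from the diagonal, and the resulting continuity makes \<open>K x\<close>
  Borel.\<close>

lemma K_second_continuous: "continuous_on (- {x}) (K x)"
  unfolding continuous_on_iff
proof (intro ballI allI impI)
  fix y :: 'a and e :: real assume y: "y \<in> - {x}" and e: "e > 0"
  define D where "D = dist y x powr \<tau> * \<Lambda> y (dist y x)"
  have d: "dist y x > 0" using y by auto
  then have D: "D > 0" unfolding D_def by (intro mult_pos_pos Lam_pos) auto
  \<comment> \<open>The first entry meets the distance condition of the regularity estimate; the
    second inverts the modulus so that the bound becomes \<open>e / 2\<close>.\<close>
  define \<delta> where "\<delta> = min (dist y x / 2) ((e * D / (2 * \<kappa>)) powr (1 / \<tau>))"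
  have "\<delta> > 0" unfolding \<delta>_def using d e D kappa_pos by auto
  moreover have "dist (K x y') (K x y) < e" if y': "dist y' y < \<delta>" for y'
  proof -
    have "norm (K y x - K y' x) + norm (K x y - K x y') \<le> \<kappa> * (dist y y' powr \<tau> / D)"
      unfolding D_def using y y' by (intro K_regular) (auto simp: \<delta>_def dist_commute)
    then have "norm (K x y - K x y') \<le> \<kappa> * (dist y y' powr \<tau> / D)"
      using norm_ge_zero[of "K y x - K y' x"] by linarith
    also have "dist y y' powr \<tau> \<le> ((e * D / (2 * \<kappa>)) powr (1 / \<tau>)) powr \<tau>"
      using y' tau_pos by (intro powr_mono2) (auto simp: \<delta>_def dist_commute)
    also have "\<dots> = e * D / (2 * \<kappa>)" using tau_pos e D kappa_pos by (simp add: powr_powr)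
    also have "\<kappa> * (e * D / (2 * \<kappa>) / D) = e / 2" using kappa_pos D by simp
    finally have "norm (K x y - K x y') \<le> e / 2" using kappa_pos D by (simp add: divide_right_mono)
    then show ?thesis using e by (simp add: dist_norm norm_minus_commute)
  qed
  ultimately show "\<exists>d>0. \<forall>x'\<in>- {x}. dist x' y < d \<longrightarrow> dist (K x x') (K x y) < e" by blast
qed

lemma K_measurable [measurable]: "K x \<in> borel_measurable \<mu>"
proof -
  have "(\<lambda>y. indicator (- {x}) y *\<^sub>R K x y) \<in> borel_measurable borel"
    by (rule borel_measurable_continuous_on_indicator[OF _ K_second_continuous]) auto
  moreover have "(\<lambda>y. indicator {x} y *\<^sub>R K x x) \<in> borel_measurable borel"
    by (intro borel_measurable_scaleR borel_measurable_indicator) auto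
  ultimately have "(\<lambda>y. indicator (- {x}) y *\<^sub>R K x y + indicator {x} y *\<^sub>R K x x) \<in> borel_measurable borel"
    by (rule borel_measurable_add)
  also have "(\<lambda>y. indicator (- {x}) y *\<^sub>R K x y + indicator {x} y *\<^sub>R K x x) = K x"
    by (auto simp: indicator_def)
  finally show ?thesis by (simp add: measurable_cong_sets[OF sets_mu refl])
qed

section \<open>Pointwise bounds away from a ball\<close>

text \<open>Since \<open>u\<close> stays within \<open>3 * r\<close> of the centre and
  \<open>v\<close> beyond \<open>8 * r\<close>, the distance of \<open>u\<close> and
  \<open>v\<close> is comparable to \<open>dist x v\<close>. One factor \<open>L\<close> moves the
  centre of \<open>\<Lambda>\<close>, the other shrinks its radius to
  \<open>dist u v\<close>.\<close>

lemma K_size_swap: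
  assumes r: "r > 0" and u: "dist x u \<le> 3 * r" and v: "dist x v \<ge> 8 * r"
  shows "norm (K v u) \<le> \<kappa> * L\<^sup>2 / \<Lambda> x (dist x v)" "norm (K u v) \<le> \<kappa> * L\<^sup>2 / \<Lambda> x (dist x v)"
proof -
  define d where "d = dist x v"
  have d: "d > 0" using r v unfolding d_def by linarith
  have uv: "d \<le> 32 * dist u v"
  proof -
    have "d \<le> dist x u + dist u v" unfolding d_def by (rule dist_triangle)
    moreover have "3 * r \<le> 3 / 8 * d" using v by (simp add: d_def)
    ultimately show ?thesis using u d by linarith
  qed
  then have uvp: "dist u v > 0" using d by linarith
  have gen: "\<Lambda> x d \<le> L\<^sup>2 * \<Lambda> z (dist u v)" if "dist x z \<le> d" for z
  proof -
    have "\<Lambda> x d \<le> L * \<Lambda> z d" using d that by (intro Lam_swap)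
    also have "\<Lambda> z d \<le> \<Lambda> z (32 * dist u v)" using d uv by (intro Lam_mono)
    also have "\<dots> \<le> L * \<Lambda> z (dist u v)" using uvp by (rule Lam_32)
    finally show ?thesis using L_ge1 by (simp add: power2_eq_square mult.assoc mult_left_mono)
  qed
  have fin: "\<kappa> / \<Lambda> z (dist u v) \<le> \<kappa> * L\<^sup>2 / \<Lambda> x (dist x v)" if "dist x z \<le> d" for z
  proof -
    have "\<kappa> * \<Lambda> x d \<le> \<kappa> * (L\<^sup>2 * \<Lambda> z (dist u v))" using gen[OF that] kappa_pos by (intro mult_left_mono) auto
    then show ?thesis using Lam_pos[OF d, of x] Lam_pos[OF uvp, of z] unfolding d_def[symmetric]
      by (simp add: field_simps)
  qed
  show "norm (K v u) \<le> \<kappa> * L\<^sup>2 / \<Lambda> x (dist x v)"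
    using K_size[of v u] fin[of v] uvp by (force simp: dist_commute d_def)
  show "norm (K u v) \<le> \<kappa> * L\<^sup>2 / \<Lambda> x (dist x v)"
    using K_size[of u v] fin[of u] uvp u v r by (force simp: d_def)
qed

lemma K_smooth:
  assumes R: "R > 0" and u: "dist x u \<le> R" and v: "dist x v \<ge> 32 * R"
  shows "norm (K v x - K v u) \<le> \<kappa> * (R powr \<tau> / (dist x v powr \<tau> * \<Lambda> x (dist x v)))"
    "norm (K x v - K u v) \<le> \<kappa> * (R powr \<tau> / (dist x v powr \<tau> * \<Lambda> x (dist x v)))"
proof -
  have d: "dist x v > 0" using R v by linarith
  have "norm (K x v - K u v) + norm (K v x - K v u) \<le> \<kappa> * (dist x u powr \<tau> / (dist x v powr \<tau> * \<Lambda> x (dist x v)))"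
    using d u v R by (intro K_regular) auto
  also have "\<dots> \<le> \<kappa> * (R powr \<tau> / (dist x v powr \<tau> * \<Lambda> x (dist x v)))"
    using u tau_pos kappa_pos d Lam_pos[OF d, of x]
    by (intro mult_left_mono divide_right_mono powr_mono2) (auto intro: less_imp_le)
  finally have *: "norm (K x v - K u v) + norm (K v x - K v u) \<le> \<kappa> * (R powr \<tau> / (dist x v powr \<tau> * \<Lambda> x (dist x v)))" .
  show "norm (K v x - K v u) \<le> \<kappa> * (R powr \<tau> / (dist x v powr \<tau> * \<Lambda> x (dist x v)))"
    using * norm_ge_zero[of "K x v - K u v"] by linarith
  show "norm (K x v - K u v) \<le> \<kappa> * (R powr \<tau> / (dist x v powr \<tau> * \<Lambda> x (dist x v)))"
    using * norm_ge_zero[of "K v x - K v u"] by linarith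
qed

lemma integral_norm_bound_weighted:
  fixes G :: "'a \<Rightarrow> complex"
  assumes h: "h \<in> Linf_b \<mu>" and c: "c \<ge> 0" and le: "AE y in \<mu>. norm (G y) \<le> c * norm (h y)"
  shows "norm (LINT y|\<mu>. G y) \<le> c * (LINT y|\<mu>. norm (h y))"
proof -
  have "ennreal (norm (LINT y|\<mu>. G y)) \<le> (\<integral>\<^sup>+y. ennreal (norm (G y)) \<partial>\<mu>)" by (rule ennreal_norm_integral_le)
  also have "\<dots> \<le> (\<integral>\<^sup>+y. ennreal c * ennreal (norm (h y)) \<partial>\<mu>)"
    using le c by (intro nn_integral_mono_AE) (auto simp flip: ennreal_mult intro!: ennreal_leI elim: eventually_mono)
  also have "\<dots> = ennreal c * ennreal (LINT y|\<mu>. norm (h y))"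
    using Linf_b_measurable[OF h] nn_integral_norm_Linf_b[OF h] by (simp add: nn_integral_cmult)
  also have "\<dots> = ennreal (c * (LINT y|\<mu>. norm (h y)))" using c by (simp add: ennreal_mult)
  finally show ?thesis using c by (subst (asm) ennreal_le_iff) (auto intro!: mult_nonneg_nonneg Bochner_Integration.integral_nonneg)
qed

lemma K_mult_integrable:
  assumes h: "h \<in> Linf_b \<mu>" and r: "r > 0" and van: "AE y in \<mu>. dist v y < r \<longrightarrow> h y = 0"
  shows "integrable \<mu> (\<lambda>y. K v y * h y)"
proof (rule Bochner_Integration.integrable_bound)
  note [measurable] = Linf_b_measurable[OF h]
  show "integrable \<mu> (\<lambda>y. \<kappa> / \<Lambda> v r * norm (h y))"
    by (intro integrable_mult_right Linf_b_integrable_norm h)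
  show "(\<lambda>y. K v y * h y) \<in> borel_measurable \<mu>" by measurable
  show "AE y in \<mu>. norm (K v y * h y) \<le> norm (\<kappa> / \<Lambda> v r * norm (h y))"
    using van
  proof eventually_elim
    case (elim y)
    show ?case
    proof (cases "dist v y < r")
      case False
      then have d: "dist v y \<ge> r" by simp
      then have "norm (K v y) \<le> \<kappa> / \<Lambda> v (dist v y)" using r by (intro K_size) auto
      also have "\<dots> \<le> \<kappa> / \<Lambda> v r" using Lam_mono[OF r d, of v] Lam_pos[OF r, of v] kappa_pos by (intro divide_left_mono) auto
      finally have "norm (K v y) * norm (h y) \<le> \<kappa> / \<Lambda> v r * norm (h y)" by (rule mult_right_mono) simp
      then show ?thesis using Lam_pos[OF r, of v] kappa_pos by (simp add: norm_mult abs_mult)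
    qed (use elim in simp)
  qed
qed

text \<open>No cancellation enters here: the size of the kernel is enough at distances from
  \<open>8 * r\<close> on, and the price is the absence of decay beyond that of
  \<open>1 / \<Lambda>\<close>.\<close>

lemma T_near_bound:
  assumes h: "h \<in> Linf_b \<mu>" and r: "r > 0" and van: "AE y in \<mu>. y \<notin> ball x (3 * r) \<longrightarrow> h y = 0"
  shows "AE v in \<mu>. dist x v \<ge> 8 * r \<longrightarrow>
    norm (T h v) \<le> \<kappa> * L\<^sup>2 / \<Lambda> x (dist x v) * (LINT y|\<mu>. norm (h y))"
proof -
  have "AE v in \<mu>. v \<in> - cball x (3 * r) \<longrightarrow> T h v = (LINT y|\<mu>. K v y * h y)"
    by (rule T_eq_integral[OF h]) (use van in \<open>auto elim: eventually_mono\<close>)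
  then show ?thesis
  proof eventually_elim
    case (elim v)
    show ?case
    proof
      assume v: "dist x v \<ge> 8 * r"
      have lp: "\<Lambda> x (dist x v) > 0" using v r by (intro Lam_pos) linarith
      have "norm (LINT y|\<mu>. K v y * h y) \<le> \<kappa> * L\<^sup>2 / \<Lambda> x (dist x v) * (LINT y|\<mu>. norm (h y))"
      proof (rule integral_norm_bound_weighted[OF h])
        show "AE y in \<mu>. norm (K v y * h y) \<le> \<kappa> * L\<^sup>2 / \<Lambda> x (dist x v) * norm (h y)"
          using van
        proof eventually_elim
          case (elim y)
          then show ?case using mult_right_mono[OF K_size_swap(1)[OF r _ v, of y], of "norm (h y)"]
            by (cases "y \<in> ball x (3 * r)") (simp_all add: norm_mult)
        qed
      qed (use lp kappa_pos in auto)
      moreover have "v \<in> - cball x (3 * r)" using v r by simp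
      ultimately show "norm (T h v) \<le> \<kappa> * L\<^sup>2 / \<Lambda> x (dist x v) * (LINT y|\<mu>. norm (h y))" using elim by simp
    qed
  qed
qed

text \<open>Vanishing mean allows the kernel value \<open>K v x\<close> at the centre to be
  subtracted under the integral, so that regularity replaces size and yields the extra power of the
  distance.\<close>

lemma T_far_bound:
  assumes h: "h \<in> Linf_b \<mu>" and R: "R > 0" and van: "AE y in \<mu>. y \<notin> ball x R \<longrightarrow> h y = 0"
    and mean: "(LINT y|\<mu>. h y) = 0"
  shows "AE v in \<mu>. dist x v \<ge> 32 * R \<longrightarrow>
    norm (T h v) \<le> \<kappa> * (R powr \<tau> / (dist x v powr \<tau> * \<Lambda> x (dist x v))) * (LINT y|\<mu>. norm (h y))"
proof -
  have "AE v in \<mu>. v \<in> - cball x R \<longrightarrow> T h v = (LINT y|\<mu>. K v y * h y)"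
    by (rule T_eq_integral[OF h]) (use van in \<open>auto elim: eventually_mono\<close>)
  then show ?thesis
  proof eventually_elim
    case (elim v)
    show ?case
    proof
      assume v: "dist x v \<ge> 32 * R"
      have lp: "\<Lambda> x (dist x v) > 0" using v R by (intro Lam_pos) linarith
      have "AE y in \<mu>. dist v y < R \<longrightarrow> h y = 0" using van
      proof eventually_elim
        case (elim y)
        have "dist x v \<le> dist x y + dist v y" by (metis dist_commute dist_triangle)
        with elim v R show ?case by auto
      qed
      then have int: "integrable \<mu> (\<lambda>y. K v y * h y)" by (rule K_mult_integrable[OF h R])
      have "(LINT y|\<mu>. K v y * h y) = (LINT y|\<mu>. K v y * h y) - (LINT y|\<mu>. K v x * h y)" using mean by simp
      also have "\<dots> = (LINT y|\<mu>. K v y * h y - K v x * h y)"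
        by (rule Bochner_Integration.integral_diff[symmetric, OF int]) (intro integrable_mult_right Linf_b_integrable h)
      also have "norm \<dots> \<le> \<kappa> * (R powr \<tau> / (dist x v powr \<tau> * \<Lambda> x (dist x v))) * (LINT y|\<mu>. norm (h y))"
      proof (rule integral_norm_bound_weighted[OF h])
        show "AE y in \<mu>. norm (K v y * h y - K v x * h y) \<le> \<kappa> * (R powr \<tau> / (dist x v powr \<tau> * \<Lambda> x (dist x v))) * norm (h y)"
          using van
        proof eventually_elim
          case (elim y)
          have "norm (K v y * h y - K v x * h y) = norm (K v x - K v y) * norm (h y)"
            by (simp add: norm_mult[symmetric] norm_minus_commute algebra_simps)
          then show ?case using elim mult_right_mono[OF K_smooth(1)[OF R _ v, of y], of "norm (h y)"]
            by (cases "y \<in> ball x R") simp_all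
        qed
      qed (use lp kappa_pos in auto)
      finally have "norm (LINT y|\<mu>. K v y * h y) \<le> \<kappa> * (R powr \<tau> / (dist x v powr \<tau> * \<Lambda> x (dist x v))) * (LINT y|\<mu>. norm (h y))" .
      moreover have "v \<in> - cball x R" using v R by simp
      ultimately show "norm (T h v) \<le> \<kappa> * (R powr \<tau> / (dist x v powr \<tau> * \<Lambda> x (dist x v))) * (LINT y|\<mu>. norm (h y))"
        using elim by simp
    qed
  qed
qed

end

subsection \<open>From weak type (1,1) to the space L2\<close>

context CZ_space
begin

text \<open>Stated on \<open>Linf_b \<mu>\<close>, where \<open>T\<close> itself acts, rather than
  for an extension to the whole space.\<close>

definition weak11 :: "real \<Rightarrow> bool" where
  "weak11 C \<longleftrightarrow> C > 0 \<and> (\<forall>g\<in>Linf_b \<mu>. \<forall>s>0. emeasure \<mu> {x. norm (T g x) > s} \<le> ennreal (C * (LINT x|\<mu>. norm (g x)) / s))"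

lemma T_level_measurable: "f \<in> Linf_b \<mu> \<Longrightarrow> {x. norm (T f x) > s} \<in> sets \<mu>"
proof -
  assume "f \<in> Linf_b \<mu>"
  note [measurable] = T_measurable[OF this]
  have "{x \<in> space \<mu>. norm (T f x) > s} \<in> sets \<mu>" by measurable
  then show ?thesis by simp
qed

lemma norm_restrict_eq_iw: "(LINT y|\<mu>. norm (f y * indicator A y)) = iw (\<lambda>y. norm (f y)) A" for f :: "'a \<Rightarrow> complex"
  unfolding iw_def by (intro Bochner_Integration.integral_cong) (auto simp: indicator_def)

text \<open>A point \<open>y\<close> of \<open>ball x (3 * r)\<close> outside the maximal set bounds
  the averages of \<open>f\<close> on all concentric balls of radius at least \<open>3 * r\<close>;
  without such a point the set to be estimated is empty. The levels add up as follows: at most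
  \<open>5 / 4 * t\<close> comes from the comparison point and at most \<open>t / 4\<close> from the
  two kernel errors together. Hence \<open>norm (T f u) > 2 * t\<close> forces
  \<open>norm (T f8 u) > t / 2\<close>, and weak type applies to \<open>f8\<close>.\<close>

lemma good_lambda_on_ball:
  fixes f :: "'a \<Rightarrow> complex"
  assumes C: "weak11 C" and f: "f \<in> Linf_b \<mu>" and t: "t > 0" and r: "r > 0" and x: "tame x"
    and U: "U \<in> sets \<mu>" "{u. norm (T f u) > t} \<subseteq> U"
    and stop: "\<And>i. i \<ge> 1 \<Longrightarrow> iw (indicator U) (ball x (32 ^ i * r)) \<le> m x (32 ^ (i + 1) * r) / (4 * \<beta>)"
    and \<gamma>: "\<gamma> > 0" "\<gamma> * (\<kappa> * L\<^sup>2 * (5 * L\<^sup>2 + 2 / (1 - 32 powr (-\<tau>)))) \<le> 1/4" "16 * C * \<gamma> * \<beta> \<le> 1"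
  shows "emeasure \<mu> ({u \<in> ball x (3 * r). norm (T f u) > 2 * t} - max_set (\<lambda>z. norm (f z)) (\<gamma> * t))
    \<le> ennreal (2 * C * \<gamma> * m x (32 * r))"
proof (cases "ball x (3 * r) \<subseteq> max_set (\<lambda>z. norm (f z)) (\<gamma> * t)")
  case True
  then have "{u \<in> ball x (3 * r). norm (T f u) > 2 * t} - max_set (\<lambda>z. norm (f z)) (\<gamma> * t) = {}" by blast
  then show ?thesis by (simp only: emeasure_empty zero_le)
next
  case False
  then obtain y where y: "y \<in> ball x (3 * r)" "y \<notin> max_set (\<lambda>z. norm (f z)) (\<gamma> * t)" by blast
  have C0: "C > 0" and W: "\<And>g s. g \<in> Linf_b \<mu> \<Longrightarrow> s > 0 \<Longrightarrow> emeasure \<mu> {x. norm (T g x) > s} \<le> ennreal (C * (LINT x|\<mu>. norm (g x)) / s)"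
    using C unfolding weak11_def by auto
  define w where "w z = norm (f z)" for z
  have wi: "integrable \<mu> w" unfolding w_def by (rule Linf_b_integrable_norm[OF f])
  have w0: "w z \<ge> 0" for z by (simp add: w_def)
  have wm[measurable]: "w \<in> borel_measurable \<mu>" using wi by auto
  have iw_bound: "iw w (ball x s) \<le> \<gamma> * t * m x (4 * s)" if "s \<ge> 3 * r" for s
    using y that by (intro notin_max_setD[of y]) (auto simp: w_def[abs_def])
  have mpos: "m x r > 0" using x r unfolding tame_def by blast
  obtain n where n: "n \<ge> 1" "m x (32 ^ (n + 2) * r) \<le> \<beta> * m x (32 ^ n * r)"
    "(\<Sum>j\<le>n. m x (32 ^ (j + 2) * r) / \<Lambda> x (32 ^ j * r)) \<le> 5 * L\<^sup>2"
    by (rule next_doubling[OF r mpos])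
  define R where "R = 32 ^ n * r"
  have "(32::real) ^ 1 \<le> 32 ^ n" using n(1) by (intro power_increasing) auto
  then have Rr: "R \<ge> 32 * r" unfolding R_def using r by simp
  then have R: "R > 0" using r by linarith
  have R32: "32 ^ (n + 1) * r = 32 * R" "32 ^ (n + 2) * r = 1024 * R" by (auto simp: R_def)
  have dbl: "m x (1024 * R) \<le> \<beta> * m x R" using n(2) unfolding R32 R_def[symmetric] .
  have mR: "m x R > 0" using mpos m_mono[of r R x] Rr r by linarith
  define \<theta> :: real where "\<theta> = 32 powr (-\<tau>)"
  have th: "0 < \<theta>" "\<theta> < 1" unfolding \<theta>_def using tau_pos powr_less_mono[of "-\<tau>" 0 32] by auto
  \<comment> \<open>On the small ball \<open>f = f8 + g1 + g2\<close>: weak type for \<open>f8\<close>, size of \<open>K\<close> for \<open>g1\<close>, smoothness of \<open>K\<close>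
    for \<open>g2\<close>.  On the doubling ball \<open>f = f0 + g2\<close>, with weak type for \<open>f0\<close>.\<close>
  define f0 where "f0 z = f z * indicator (ball x (32 * R)) z" for z
  define f8 where "f8 z = f z * indicator (ball x (8 * r)) z" for z
  define g1 where "g1 z = f z * indicator (ball x (32 * R) - ball x (8 * r)) z" for z
  define g2 where "g2 z = f z * indicator (- ball x (32 * R)) z" for z
  have lin: "f0 \<in> Linf_b \<mu>" "f8 \<in> Linf_b \<mu>" "g1 \<in> Linf_b \<mu>" "g2 \<in> Linf_b \<mu>"
    unfolding f0_def[abs_def] f8_def[abs_def] g1_def[abs_def] g2_def[abs_def]
    by (intro Linf_b_restrict f sets.Diff ball_in_sets closed_in_sets closed_Compl open_ball)+
  have sub: "ball x (8 * r) \<subseteq> ball x (32 * R)" using Rr r by (intro subset_ball) linarith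
  have f_split: "f = (\<lambda>z. f0 z + g2 z)" unfolding f0_def g2_def by (auto simp: indicator_def)
  have f0_split: "f0 = (\<lambda>z. f8 z + g1 z)" unfolding f0_def f8_def g1_def using subsetD[OF sub]
    by (auto simp: indicator_def fun_eq_iff)
  have Tf: "AE u in \<mu>. T f u = T f0 u + T g2 u" by (subst f_split) (rule T_add lin)+
  have Tf0: "AE u in \<mu>. T f0 u = T f8 u + T g1 u" by (subst f0_split) (rule T_add lin)+
  have Tg1: "AE u in \<mu>. u \<in> ball x (8 * r) \<longrightarrow> T g1 u = (LINT y|\<mu>. K u y * g1 y)"
    by (rule T_eq_integral[OF lin(3)]) (auto simp: g1_def)
  have Tg2: "AE u in \<mu>. u \<in> ball x (32 * R) \<longrightarrow> T g2 u = (LINT y|\<mu>. K u y * g2 y)"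
    by (rule T_eq_integral[OF lin(4)]) (auto simp: g2_def)
  have mid: "norm (LINT y|\<mu>. K u y * g1 y) \<le> \<kappa> * L\<^sup>2 * (5 * L\<^sup>2) * (\<gamma> * t)" if u: "u \<in> ball x (3 * r)" for u
  proof -
    \<comment> \<open>The sum of these ratios over \<open>j\<close> is exactly what the choice of
      the next doubling ball keeps bounded.\<close>
    define b where "b j = \<gamma> * t * (m x (32 ^ (j + 2) * r) / \<Lambda> x (32 ^ j * r))" for j :: nat
    have b0: "b j \<ge> 0" for j unfolding b_def using \<gamma>(1) t Lam_pos[of "32 ^ j * r" x] r by simp
    have "ennreal (norm (LINT y|\<mu>. K u y * g1 y)) \<le> (\<integral>\<^sup>+y. ennreal (norm (K u y * g1 y)) \<partial>\<mu>)"
      by (rule ennreal_norm_integral_le)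
    also have "\<dots> \<le> (\<integral>\<^sup>+y. ennreal (\<kappa> * L\<^sup>2) * (ennreal (w y) * ennreal (1 / \<Lambda> x (dist x y)) * indicator (ball x (32 ^ (n + 1) * r) - ball x r) y) \<partial>\<mu>)"
    proof (rule nn_integral_mono)
      fix y
      show "ennreal (norm (K u y * g1 y)) \<le> ennreal (\<kappa> * L\<^sup>2) * (ennreal (w y) * ennreal (1 / \<Lambda> x (dist x y)) * indicator (ball x (32 ^ (n + 1) * r) - ball x r) y)"
      proof (cases "y \<in> ball x (32 * R) - ball x (8 * r)")
        case True
        then have yd: "dist x y \<ge> 8 * r" by auto
        have lp: "\<Lambda> x (dist x y) > 0" using yd r by (intro Lam_pos) linarith
        have "norm (K u y * g1 y) \<le> \<kappa> * L\<^sup>2 / \<Lambda> x (dist x y) * w y"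
          using mult_right_mono[OF K_size_swap(2)[OF r _ yd, of u], of "w y"] u True
          by (simp add: norm_mult g1_def w_def)
        then have "ennreal (norm (K u y * g1 y)) \<le> ennreal (\<kappa> * L\<^sup>2 / \<Lambda> x (dist x y) * w y)" by (rule ennreal_leI)
        also have "\<kappa> * L\<^sup>2 / \<Lambda> x (dist x y) * w y = (\<kappa> * L\<^sup>2) * (w y * (1 / \<Lambda> x (dist x y)))" by simp
        also have "ennreal \<dots> = ennreal (\<kappa> * L\<^sup>2) * (ennreal (w y) * ennreal (1 / \<Lambda> x (dist x y)))"
        proof -
          have "ennreal (w y * (1 / \<Lambda> x (dist x y))) = ennreal (w y) * ennreal (1 / \<Lambda> x (dist x y))"
            using lp w0[of y] by (intro ennreal_mult) auto
          moreover have "ennreal ((\<kappa> * L\<^sup>2) * (w y * (1 / \<Lambda> x (dist x y)))) = ennreal (\<kappa> * L\<^sup>2) * ennreal (w y * (1 / \<Lambda> x (dist x y)))"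
            using lp w0[of y] kappa_pos by (intro ennreal_mult) auto
          ultimately show ?thesis by (simp only:)
        qed
        also have "\<dots> = ennreal (\<kappa> * L\<^sup>2) * (ennreal (w y) * ennreal (1 / \<Lambda> x (dist x y)) * indicator (ball x (32 ^ (n + 1) * r) - ball x r) y)"
          unfolding R32 using True r by (auto simp: indicator_def)
        finally show ?thesis .
      qed (auto simp: g1_def)
    qed
    also have "\<dots> = ennreal (\<kappa> * L\<^sup>2) * (\<integral>\<^sup>+y. ennreal (w y) * ennreal (1 / \<Lambda> x (dist x y)) * indicator (ball x (32 ^ (n + 1) * r) - ball x r) y \<partial>\<mu>)"
      by (rule nn_integral_cmult) measurable
    also have "\<dots> \<le> ennreal (\<kappa> * L\<^sup>2) * ennreal (\<Sum>j\<le>n. b j)"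
    proof (intro mult_left_mono nn_integral_annuli r wm b0)
      fix j
      have "(\<integral>\<^sup>+z. ennreal (w z) * indicator (ball x (32 ^ (j + 1) * r)) z \<partial>\<mu>) = ennreal (iw w (ball x (32 ^ (j + 1) * r)))"
        by (rule nn_integral_ball_eq_iw[OF wi w0])
      also have "\<dots> \<le> ennreal (b j * \<Lambda> x (32 ^ j * r))"
      proof (rule ennreal_leI)
        have "1 \<le> (32::real) ^ j" by simp
        then have "3 \<le> (32::real) ^ (j + 1)" by (simp add: order_trans[of 3 "32 * 1" "32 * 32 ^ j"])
        then have j3: "3 * r \<le> 32 ^ (j + 1) * r" using r by (intro mult_right_mono) auto
        have "iw w (ball x (32 ^ (j + 1) * r)) \<le> \<gamma> * t * m x (4 * (32 ^ (j + 1) * r))" by (rule iw_bound[OF j3])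
        also have "\<dots> \<le> \<gamma> * t * m x (32 ^ (j + 2) * r)" using \<gamma>(1) t r by (intro mult_left_mono m_mono) auto
        also have "\<dots> = b j * \<Lambda> x (32 ^ j * r)" unfolding b_def using Lam_pos[of "32 ^ j * r" x] r by simp
        finally show "iw w (ball x (32 ^ (j + 1) * r)) \<le> b j * \<Lambda> x (32 ^ j * r)" .
      qed
      finally show "(\<integral>\<^sup>+z. ennreal (w z) * indicator (ball x (32 ^ (j + 1) * r)) z \<partial>\<mu>) \<le> ennreal (b j * \<Lambda> x (32 ^ j * r))" .
    qed simp
    also have "\<dots> = ennreal (\<kappa> * L\<^sup>2 * (\<Sum>j\<le>n. b j))"
      using kappa_pos b0 by (intro ennreal_mult[symmetric]) (auto intro: sum_nonneg)
    finally have "norm (LINT y|\<mu>. K u y * g1 y) \<le> \<kappa> * L\<^sup>2 * (\<Sum>j\<le>n. b j)"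
      using kappa_pos b0 by (subst (asm) ennreal_le_iff) (auto intro!: sum_nonneg mult_nonneg_nonneg)
    also have "(\<Sum>j\<le>n. b j) = \<gamma> * t * (\<Sum>j\<le>n. m x (32 ^ (j + 2) * r) / \<Lambda> x (32 ^ j * r))"
      unfolding b_def by (simp only: sum_distrib_left)
    also have "\<kappa> * L\<^sup>2 * (\<gamma> * t * (\<Sum>j\<le>n. m x (32 ^ (j + 2) * r) / \<Lambda> x (32 ^ j * r))) \<le> \<kappa> * L\<^sup>2 * (\<gamma> * t * (5 * L\<^sup>2))"
      using n(3) \<gamma>(1) t kappa_pos by (intro mult_left_mono) auto
    finally show ?thesis by (simp add: mult_ac)
  qed
  have far: "norm ((LINT y|\<mu>. K x y * g2 y) - (LINT y|\<mu>. K u y * g2 y)) \<le> \<kappa> * L\<^sup>2 / (1 - \<theta>) * (\<gamma> * t)" if u: "u \<in> ball x R" for u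
  proof -
    have int: "integrable \<mu> (\<lambda>y. K v y * g2 y)" if v: "v \<in> ball x R" for v
    proof (rule K_mult_integrable[OF lin(4) R])
      show "AE y in \<mu>. dist v y < R \<longrightarrow> g2 y = 0"
      proof (rule AE_I2)
        fix y
        show "dist v y < R \<longrightarrow> g2 y = 0"
          using dist_triangle[of x y v] v R by (auto simp: g2_def)
      qed
    qed
    have "(LINT y|\<mu>. K x y * g2 y) - (LINT y|\<mu>. K u y * g2 y) = (LINT y|\<mu>. K x y * g2 y - K u y * g2 y)"
      by (rule Bochner_Integration.integral_diff[symmetric]) (use int u R in auto)
    then have "ennreal (norm ((LINT y|\<mu>. K x y * g2 y) - (LINT y|\<mu>. K u y * g2 y))) \<le> (\<integral>\<^sup>+y. ennreal (norm (K x y * g2 y - K u y * g2 y)) \<partial>\<mu>)"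
      by (simp only: ennreal_norm_integral_le)
    also have "\<dots> \<le> (\<integral>\<^sup>+y. ennreal \<kappa> * (ennreal (w y) * ennreal (R powr \<tau> / (dist x y powr \<tau> * \<Lambda> x (dist x y))) * indicator (- ball x R) y) \<partial>\<mu>)"
    proof (rule nn_integral_mono)
      fix y
      show "ennreal (norm (K x y * g2 y - K u y * g2 y)) \<le> ennreal \<kappa> * (ennreal (w y) * ennreal (R powr \<tau> / (dist x y powr \<tau> * \<Lambda> x (dist x y))) * indicator (- ball x R) y)"
      proof (cases "y \<in> - ball x (32 * R)")
        case True
        then have yd: "dist x y \<ge> 32 * R" by auto
        have lp: "\<Lambda> x (dist x y) > 0" using yd R by (intro Lam_pos) linarith
        have "norm (K x y * g2 y - K u y * g2 y) = norm (K x y - K u y) * w y"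
          using True by (simp add: norm_mult[symmetric] g2_def w_def left_diff_distrib)
        also have "\<dots> \<le> \<kappa> * (R powr \<tau> / (dist x y powr \<tau> * \<Lambda> x (dist x y))) * w y"
          using u by (intro mult_right_mono K_smooth(2)[OF R _ yd] w0) auto
        also have "\<dots> = \<kappa> * (w y * (R powr \<tau> / (dist x y powr \<tau> * \<Lambda> x (dist x y))))" by simp
        finally have "ennreal (norm (K x y * g2 y - K u y * g2 y)) \<le> ennreal \<dots>" by (rule ennreal_leI)
        also have "\<dots> = ennreal \<kappa> * (ennreal (w y) * ennreal (R powr \<tau> / (dist x y powr \<tau> * \<Lambda> x (dist x y))))"
        proof -
          let ?q = "R powr \<tau> / (dist x y powr \<tau> * \<Lambda> x (dist x y))"
          have "ennreal (w y * ?q) = ennreal (w y) * ennreal ?q"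
            using lp w0[of y] by (intro ennreal_mult) auto
          moreover have "ennreal (\<kappa> * (w y * ?q)) = ennreal \<kappa> * ennreal (w y * ?q)"
            using lp w0[of y] kappa_pos by (intro ennreal_mult) auto
          ultimately show ?thesis by (simp only:)
        qed
        also have "\<dots> = ennreal \<kappa> * (ennreal (w y) * ennreal (R powr \<tau> / (dist x y powr \<tau> * \<Lambda> x (dist x y))) * indicator (- ball x R) y)"
          using True R by (auto simp: indicator_def)
        finally show ?thesis .
      qed (auto simp: g2_def)
    qed
    also have "\<dots> = ennreal \<kappa> * (\<integral>\<^sup>+y. ennreal (w y) * ennreal (R powr \<tau> / (dist x y powr \<tau> * \<Lambda> x (dist x y))) * indicator (- ball x R) y \<partial>\<mu>)"
      by (rule nn_integral_cmult) measurable
    also have "\<dots> \<le> ennreal \<kappa> * ennreal (\<gamma> * t * L\<^sup>2 / (1 - \<theta>))"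
      unfolding \<theta>_def
    proof (intro mult_left_mono nn_integral_far R wm tau_pos)
      show "\<gamma> * t * L\<^sup>2 \<ge> 0" using \<gamma>(1) t by simp
      fix j
      have "(\<integral>\<^sup>+z. ennreal (w z) * indicator (ball x (32 ^ (j + 1) * R)) z \<partial>\<mu>) = ennreal (iw w (ball x (32 ^ (j + 1) * R)))"
        by (rule nn_integral_ball_eq_iw[OF wi w0])
      also have "\<dots> \<le> ennreal (\<gamma> * t * L\<^sup>2 * \<Lambda> x (32 ^ j * R))"
      proof (rule ennreal_leI)
        have "1 \<le> (32::real) ^ j" by simp
        have "1 \<le> (32::real) ^ (j + 1)" by (rule one_le_power) simp
        then have "1 * R \<le> 32 ^ (j + 1) * R" using R by (intro mult_right_mono) auto
        then have j3: "3 * r \<le> 32 ^ (j + 1) * R" using Rr r by linarith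
        have p: "32 ^ j * R > 0" using R by simp
        have "iw w (ball x (32 ^ (j + 1) * R)) \<le> \<gamma> * t * m x (4 * (32 ^ (j + 1) * R))" by (rule iw_bound[OF j3])
        also have "\<dots> \<le> \<gamma> * t * m x (32 * (32 * (32 ^ j * R)))" using \<gamma>(1) t R by (intro mult_left_mono m_mono) auto
        also have "\<dots> \<le> \<gamma> * t * (L\<^sup>2 * \<Lambda> x (32 ^ j * R))"
          using \<gamma>(1) t p by (intro mult_left_mono order_trans[OF m_le_Lam Lam_32_pow]) auto
        finally show "iw w (ball x (32 ^ (j + 1) * R)) \<le> \<gamma> * t * L\<^sup>2 * \<Lambda> x (32 ^ j * R)" by (simp add: mult.assoc)
      qed
      finally show "(\<integral>\<^sup>+z. ennreal (w z) * indicator (ball x (32 ^ (j + 1) * R)) z \<partial>\<mu>) \<le> ennreal (\<gamma> * t * L\<^sup>2 * \<Lambda> x (32 ^ j * R))" .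
    qed simp
    also have "\<dots> = ennreal (\<kappa> * (\<gamma> * t * L\<^sup>2 / (1 - \<theta>)))"
      using kappa_pos \<gamma>(1) t th by (intro ennreal_mult[symmetric]) auto
    finally have "norm ((LINT y|\<mu>. K x y * g2 y) - (LINT y|\<mu>. K u y * g2 y)) \<le> \<kappa> * (\<gamma> * t * L\<^sup>2 / (1 - \<theta>))"
      using kappa_pos \<gamma>(1) t th by (subst (asm) ennreal_le_iff) auto
    then show ?thesis by (simp add: mult_ac)
  qed
  \<comment> \<open>By stopping, at most a quarter of the doubling ball lies in \<open>U\<close>; on
    at most another quarter \<open>T f0\<close> exceeds \<open>t / 4\<close>, and this is where
    \<open>16 * C * \<gamma> * \<beta> \<le> 1\<close> comes from. At almost every remaining point
    the far part equals \<open>T f - T f0\<close> and has size at most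
    \<open>t + t / 4\<close>.\<close>
  have "\<exists>u'\<in>ball x R. norm (LINT y|\<mu>. K u' y * g2 y) \<le> 5 / 4 * t"
  proof -
    define Bad where "Bad = (U \<inter> ball x R) \<union> {u. norm (T f0 u) > t / 4}"
    have Badm: "Bad \<in> sets \<mu>" unfolding Bad_def
      by (intro sets.Un sets.Int U(1) T_level_measurable lin ball_in_sets)
    have "emeasure \<mu> (U \<inter> ball x R) = ennreal (iw (indicator U) (ball x R))"
    proof -
      have "iw (indicator U) (ball x R) = measure \<mu> (U \<inter> ball x R)"
        unfolding iw_def by (simp add: indicator_inter_arith[symmetric])
      moreover have "emeasure \<mu> (U \<inter> ball x R) \<le> emeasure \<mu> (ball x R)" by (intro emeasure_mono) auto
      then have "emeasure \<mu> (U \<inter> ball x R) \<noteq> \<infinity>" by (auto simp: emeasure_ball top_unique)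
      ultimately show ?thesis by (simp add: emeasure_eq_ennreal_measure)
    qed
    also have "\<dots> \<le> ennreal (m x R / 4)"
    proof (rule ennreal_leI)
      have "iw (indicator U) (ball x R) \<le> m x (32 * R) / (4 * \<beta>)"
        using stop[OF n(1)] unfolding R32 R_def[symmetric] .
      also have "\<dots> \<le> m x (1024 * R) / (4 * \<beta>)" using beta_pos R by (intro divide_right_mono m_mono) auto
      also have "\<dots> \<le> \<beta> * m x R / (4 * \<beta>)" using dbl beta_pos by (intro divide_right_mono) auto
      also have "\<dots> = m x R / 4" using beta_pos by simp
      finally show "iw (indicator U) (ball x R) \<le> m x R / 4" .
    qed
    finally have 1: "emeasure \<mu> (U \<inter> ball x R) \<le> ennreal (m x R / 4)" .
    have 2: "emeasure \<mu> {u. norm (T f0 u) > t / 4} \<le> ennreal (m x R / 4)"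
    proof (rule order_trans[OF W[OF lin(1)]])
      have "(LINT z|\<mu>. norm (f0 z)) = iw w (ball x (32 * R))" unfolding f0_def w_def by (rule norm_restrict_eq_iw)
      also have "\<dots> \<le> \<gamma> * t * m x (4 * (32 * R))" using Rr r by (intro iw_bound) linarith
      also have "\<dots> \<le> \<gamma> * t * (\<beta> * m x R)"
        using \<gamma>(1) t R by (intro mult_left_mono order_trans[OF m_mono dbl]) auto
      finally have "C * (LINT z|\<mu>. norm (f0 z)) / (t / 4) \<le> C * (\<gamma> * t * (\<beta> * m x R)) / (t / 4)"
        using C0 t by (intro divide_right_mono mult_left_mono) auto
      also have "\<dots> = (16 * C * \<gamma> * \<beta>) * (m x R / 4)" using t by (simp add: field_simps)
      also have "\<dots> \<le> 1 * (m x R / 4)" using \<gamma>(3) mR by (intro mult_right_mono) auto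
      finally show "ennreal (C * (LINT z|\<mu>. norm (f0 z)) / (t / 4)) \<le> ennreal (m x R / 4)" by (simp add: ennreal_leI)
    qed (use t in simp)
    have "emeasure \<mu> Bad \<le> emeasure \<mu> (U \<inter> ball x R) + emeasure \<mu> {u. norm (T f0 u) > t / 4}"
      unfolding Bad_def by (intro emeasure_subadditive sets.Int U(1) T_level_measurable lin ball_in_sets)
    also have "\<dots> \<le> ennreal (m x R / 4) + ennreal (m x R / 4)" by (intro add_mono 1 2)
    also have "\<dots> = ennreal (m x R / 2)" using mR by (subst ennreal_plus[symmetric]) auto
    finally have 3: "emeasure \<mu> Bad \<le> ennreal (m x R / 2)" .
    \<comment> \<open>The formulas for \<open>T\<close> hold only almost everywhere, so the
      comparison point has to come from a set that is not negligible.\<close>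
    have nAE: "\<not> (AE u in \<mu>. u \<in> ball x R \<longrightarrow> u \<in> Bad)"
    proof
      assume "AE u in \<mu>. u \<in> ball x R \<longrightarrow> u \<in> Bad"
      then have "emeasure \<mu> (ball x R) \<le> emeasure \<mu> Bad" using Badm by (intro emeasure_mono_AE)
      from order_trans[OF this 3] have "ennreal (m x R) \<le> ennreal (m x R / 2)" unfolding emeasure_ball .
      then have "m x R \<le> m x R / 2" using mR by (subst (asm) ennreal_le_iff) auto
      then show False using mR by simp
    qed
    have *: "AE u in \<mu>. u \<in> ball x R \<longrightarrow> u \<notin> Bad \<longrightarrow> norm (LINT y|\<mu>. K u y * g2 y) \<le> 5 / 4 * t"
      using Tf Tg2
    proof eventually_elim
      case (elim u)
      show ?case
      proof (intro impI)
        assume u: "u \<in> ball x R" "u \<notin> Bad"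
        then have "norm (T f0 u) \<le> t / 4" "norm (T f u) \<le> t" using U(2) unfolding Bad_def by (auto simp: not_less subset_eq)
        moreover have "u \<in> ball x (32 * R)" using u R by auto
        then have "(LINT y|\<mu>. K u y * g2 y) = T f u - T f0 u" using elim by simp
        ultimately show "norm (LINT y|\<mu>. K u y * g2 y) \<le> 5 / 4 * t"
          using norm_triangle_ineq4[of "T f u" "T f0 u"] by simp
      qed
    qed
    show ?thesis
    proof (rule ccontr)
      assume "\<not> ?thesis"
      then have n: "u \<in> ball x R \<Longrightarrow> \<not> norm (LINT y|\<mu>. K u y * g2 y) \<le> 5 / 4 * t" for u by blast
      from * have "AE u in \<mu>. u \<in> ball x R \<longrightarrow> u \<in> Bad"
      proof eventually_elim
        case (elim u)
        then show ?case using n[of u] by blast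
      qed
      with nAE show False ..
    qed
  qed
  then obtain u' where u': "u' \<in> ball x R" "norm (LINT y|\<mu>. K u' y * g2 y) \<le> 5 / 4 * t" by blast
  have "AE u in \<mu>. u \<in> {u \<in> ball x (3 * r). norm (T f u) > 2 * t} - max_set w (\<gamma> * t) \<longrightarrow> u \<in> {u. norm (T f8 u) > t / 2}"
    using Tf Tf0 Tg1 Tg2
  proof eventually_elim
    case (elim u)
    show ?case
    proof
      assume "u \<in> {u \<in> ball x (3 * r). norm (T f u) > 2 * t} - max_set w (\<gamma> * t)"
      then have u: "u \<in> ball x (3 * r)" "norm (T f u) > 2 * t" by auto
      have uR: "u \<in> ball x R" "u \<in> ball x (8 * r)" "u \<in> ball x (32 * R)" using u(1) Rr r R by auto
      have "T f u = T f8 u + (LINT y|\<mu>. K u y * g1 y) + (LINT y|\<mu>. K u y * g2 y)"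
        using elim uR by simp
      then have 1: "norm (T f u) \<le> norm (T f8 u) + norm (LINT y|\<mu>. K u y * g1 y) + norm (LINT y|\<mu>. K u y * g2 y)"
        by (simp only: order_trans[OF norm_triangle_ineq add_right_mono[OF norm_triangle_ineq]])
      \<comment> \<open>The comparison of \<open>u\<close> with \<open>u'\<close> passes through the
        centre \<open>x\<close>, so the oscillation bound is used twice; this is the 2 in the
        condition on \<open>\<gamma>\<close>.\<close>
      have "norm ((LINT y|\<mu>. K u' y * g2 y) - (LINT y|\<mu>. K u y * g2 y)) \<le>
        norm ((LINT y|\<mu>. K x y * g2 y) - (LINT y|\<mu>. K u' y * g2 y)) + norm ((LINT y|\<mu>. K x y * g2 y) - (LINT y|\<mu>. K u y * g2 y))"
        using norm_triangle_ineq4[of "(LINT y|\<mu>. K x y * g2 y) - (LINT y|\<mu>. K u y * g2 y)" "(LINT y|\<mu>. K x y * g2 y) - (LINT y|\<mu>. K u' y * g2 y)"]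
        by simp
      also have "\<dots> \<le> 2 * (\<kappa> * L\<^sup>2 / (1 - \<theta>) * (\<gamma> * t))" unfolding mult_2 by (rule add_mono[OF far[OF u'(1)] far[OF uR(1)]])
      finally have "norm (LINT y|\<mu>. K u y * g2 y) \<le> 5 / 4 * t + 2 * (\<kappa> * L\<^sup>2 / (1 - \<theta>) * (\<gamma> * t))"
        using u'(2) norm_triangle_sub[of "LINT y|\<mu>. K u y * g2 y" "LINT y|\<mu>. K u' y * g2 y"] by (simp add: norm_minus_commute)
      then have 2: "norm (T f u) \<le> norm (T f8 u) + \<kappa> * L\<^sup>2 * (5 * L\<^sup>2) * (\<gamma> * t) + 5 / 4 * t + 2 * (\<kappa> * L\<^sup>2 / (1 - \<theta>) * (\<gamma> * t))"
        using 1 mid[OF u(1)] by linarith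
      have "\<kappa> * L\<^sup>2 * (5 * L\<^sup>2) * (\<gamma> * t) + 2 * (\<kappa> * L\<^sup>2 / (1 - \<theta>) * (\<gamma> * t)) =
         \<gamma> * (\<kappa> * L\<^sup>2 * (5 * L\<^sup>2 + 2 / (1 - \<theta>))) * t"
        by (simp add: algebra_simps)
      also have "\<dots> \<le> 1/4 * t" using \<gamma>(2) t unfolding \<theta>_def by (intro mult_right_mono) auto
      finally have 3: "\<kappa> * L\<^sup>2 * (5 * L\<^sup>2) * (\<gamma> * t) + 2 * (\<kappa> * L\<^sup>2 / (1 - \<theta>) * (\<gamma> * t)) \<le> 1/4 * t" .
      have "a > t / 2" if "b > 2 * t" "b \<le> a + X + 5 / 4 * t + Y" "X + Y \<le> 1/4 * t" for a b X Y
        using that by linarith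
      from this[OF u(2) 2 3] show "u \<in> {u. norm (T f8 u) > t / 2}" by simp
    qed
  qed
  then have "emeasure \<mu> ({u \<in> ball x (3 * r). norm (T f u) > 2 * t} - max_set w (\<gamma> * t)) \<le> emeasure \<mu> {u. norm (T f8 u) > t / 2}"
    using T_level_measurable[OF lin(2)] by (intro emeasure_mono_AE)
  also have "\<dots> \<le> ennreal (C * (LINT z|\<mu>. norm (f8 z)) / (t / 2))" using t by (intro W lin) auto
  also have "\<dots> \<le> ennreal (2 * C * \<gamma> * m x (32 * r))"
  proof (rule ennreal_leI)
    have "(LINT z|\<mu>. norm (f8 z)) = iw w (ball x (8 * r))" unfolding f8_def w_def by (rule norm_restrict_eq_iw)
    also have "\<dots> \<le> \<gamma> * t * m x (4 * (8 * r))" using r by (intro iw_bound) auto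
    finally have "C * (LINT z|\<mu>. norm (f8 z)) / (t / 2) \<le> C * (\<gamma> * t * m x (4 * (8 * r))) / (t / 2)"
      using C0 t by (intro divide_right_mono mult_left_mono) auto
    then show "C * (LINT z|\<mu>. norm (f8 z)) / (t / 2) \<le> 2 * C * \<gamma> * m x (32 * r)" using t by (simp add: mult_ac)
  qed
  finally show ?thesis unfolding w_def .
qed

text \<open>Every point is the centre of a ball outside which \<open>f\<close> vanishes almost
  everywhere; such a ball carries the whole integral and is a witness for the maximal set.\<close>

lemma max_set_UNIV:
  assumes f: "f \<in> Linf_b \<mu>" and s: "s \<ge> 0" and big: "\<And>y r. s * m y r < (LINT z|\<mu>. norm (f z))"
  shows "max_set (\<lambda>z. norm (f z)) s = UNIV"
proof -
  have "y \<in> max_set (\<lambda>z. norm (f z)) s" for y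
  proof -
    obtain B R where "B > 0" and R: "R > 0" and "AE x in \<mu>. norm (f x) \<le> B" and f0: "AE x in \<mu>. x \<notin> ball y R \<longrightarrow> f x = 0"
      by (rule Linf_bE[OF f])
    have "iw (\<lambda>z. norm (f z)) (ball y R) = (LINT z|\<mu>. norm (f z))"
      unfolding iw_def
    proof (rule integral_cong_AE)
      show "AE z in \<mu>. norm (f z) * indicator (ball y R) z = norm (f z)"
        using f0 by eventually_elim (auto simp: indicator_def)
    qed (use Linf_b_measurable[OF f] in measurable)
    then have "s * m y (4 * R) < iw (\<lambda>z. norm (f z)) (ball y R)" using big by simp
    then show ?thesis unfolding max_set_def using R by (auto intro!: exI[of _ "ball y R"])
  qed
  then show ?thesis by blast
qed

text \<open>The stopping weight is the indicator of an open \<open>U\<close> of measure at most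
  \<open>2 * e\<close>, where \<open>e\<close> is the measure of the level set. The stopping balls
  then contribute at most \<open>2 * C * \<gamma> * (4 * \<beta> * (2 * e))\<close>, and the factor
  128 in the condition on \<open>\<gamma>\<close> makes this at most \<open>e / 8\<close>.\<close>

lemma good_lambda_inequality:
  assumes C: "weak11 C" and f: "f \<in> Linf_b \<mu>" and t: "t > 0"
    and \<gamma>: "\<gamma> > 0" "\<gamma> * (\<kappa> * L\<^sup>2 * (5 * L\<^sup>2 + 2 / (1 - 32 powr (-\<tau>)))) \<le> 1/4" "128 * C * \<gamma> * \<beta> \<le> 1"
  shows "emeasure \<mu> {x. norm (T f x) > 2 * t} \<le>
    ennreal (1/8) * emeasure \<mu> {x. norm (T f x) > t} + emeasure \<mu> (max_set (\<lambda>z. norm (f z)) (\<gamma> * t))"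
proof -
  have C0: "C > 0" using C unfolding weak11_def by blast
  define E where "E s = {x. norm (T f x) > s}" for s
  have Em: "E s \<in> sets \<mu>" for s unfolding E_def by (rule T_level_measurable[OF f])
  have E_mono: "E (2 * t) \<subseteq> E t" unfolding E_def using t by auto
  have E_weak: "emeasure \<mu> (E t) \<le> ennreal (C * (LINT x|\<mu>. norm (f x)) / t)"
    using C f t unfolding weak11_def E_def by blast
  then have Efin: "emeasure \<mu> (E t) < \<infinity>" by (simp add: le_less_trans)
  define e where "e = measure \<mu> (E t)"
  have Ee: "emeasure \<mu> (E t) = ennreal e" unfolding e_def using Efin by (intro emeasure_eq_ennreal_measure) auto
  have e0: "e \<ge> 0" by (simp add: e_def)
  let ?M = "max_set (\<lambda>z. norm (f z)) (\<gamma> * t)"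
  have Mm: "?M \<in> sets \<mu>" using open_max_set by auto
  have CC: "C * \<gamma> * \<beta> > 0" using C0 \<gamma>(1) beta_pos by simp
  have "emeasure \<mu> (E (2 * t)) \<le> ennreal (1/8) * ennreal e + emeasure \<mu> ?M"
  \<comment> \<open>Outer regularity with error \<open>e\<close> requires
    \<open>e > 0\<close>.\<close>
  proof (cases "e = 0")
    case True
    then have "emeasure \<mu> (E (2 * t)) \<le> 0" using emeasure_mono[OF E_mono Em] Ee by simp
    then show ?thesis by simp
  next
    case False
    with e0 have e: "e > 0" by simp
    obtain U where U: "open U" "E t \<subseteq> U" "emeasure \<mu> (U - E t) \<le> ennreal e"
      by (rule locally_finite_outer_regular[OF sets_mu emeasure_ball_finite Em e])
    have Um: "U \<in> sets \<mu>" using U(1) by auto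
    have "emeasure \<mu> U \<le> emeasure \<mu> (E t) + emeasure \<mu> (U - E t)"
      using emeasure_subadditive[of "E t" \<mu> "U - E t"] Em Um U(2) by (simp add: Un_absorb1)
    also have "\<dots> \<le> ennreal e + ennreal e" unfolding Ee by (intro add_mono U(3)) simp
    also have "\<dots> = ennreal (2 * e)" using e by (subst ennreal_plus[symmetric]) auto
    finally have Ue: "emeasure \<mu> U \<le> ennreal (2 * e)" .
    then have Ufin: "emeasure \<mu> U < \<infinity>" by (simp add: le_less_trans)
    have mU: "measure \<mu> U \<le> 2 * e" using Ue Ufin e
      by (subst (asm) emeasure_eq_ennreal_measure) (auto simp: ennreal_le_iff)
    have wi: "integrable \<mu> (indicator U :: 'a \<Rightarrow> real)" using Um Ufin by (intro integrable_real_indicator)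
    have w: "(LINT z|\<mu>. indicator U z :: real) = measure \<mu> U" by simp
    show ?thesis
    proof (cases "\<exists>y R. (LINT z|\<mu>. indicator U z :: real) < m y R / (4 * \<beta>)")
      case True
      then obtain y R where big: "(LINT z|\<mu>. indicator U z :: real) < m y R / (4 * \<beta>)" by blast
      show ?thesis
      proof (rule ennreal_le_epsilon)
        fix \<delta> :: real assume \<delta>: "\<delta> > 0"
        obtain I r where I: "finite I" and tm: "\<And>x. x \<in> I \<Longrightarrow> tame x" and r: "\<And>x. x \<in> I \<Longrightarrow> r x > 0"
          and "disjoint_family_on (\<lambda>x. ball x (r x)) I"
          and rest: "emeasure \<mu> (E t - (\<Union>x\<in>I. ball x (3 * r x))) < ennreal \<delta>"
          and sm: "(\<Sum>x\<in>I. m x (32 * r x)) \<le> 4 * \<beta> * (LINT z|\<mu>. indicator U z)"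
          and stop: "\<And>x i. x \<in> I \<Longrightarrow> i \<ge> 1 \<Longrightarrow> iw (indicator U) (ball x (32 ^ i * r x)) \<le> m x (32 ^ (i + 1) * r x) / (4 * \<beta>)"
          by (rule stopping_balls[OF wi _ _ U(1) Em U(2) Efin \<delta> big]) auto
        define P where "P x = {u \<in> ball x (3 * r x). norm (T f u) > 2 * t} - ?M" for x
        have Pm: "P x \<in> sets \<mu>" for x
        proof -
          have "P x = (ball x (3 * r x) \<inter> E (2 * t)) - ?M" unfolding P_def E_def by auto
          then show ?thesis using Em Mm by auto
        qed
        have Pb: "emeasure \<mu> (P x) \<le> ennreal (2 * C * \<gamma> * m x (32 * r x))" if "x \<in> I" for x
          unfolding P_def
        proof (rule good_lambda_on_ball[OF C f t r[OF that] tm[OF that] Um _ stop[OF that] \<gamma>(1,2)])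
          show "{u. norm (T f u) > t} \<subseteq> U" using U(2) unfolding E_def .
          show "16 * C * \<gamma> * \<beta> \<le> 1" using \<gamma>(3) CC by simp
        qed
        have m1: "E t - (\<Union>x\<in>I. ball x (3 * r x)) \<in> sets \<mu>"
          by (intro sets.Diff Em open_in_sets open_UN ballI open_ball)
        have m2: "(\<Union>x\<in>I. P x) \<in> sets \<mu>" by (intro sets.finite_UN I Pm)
        have "E (2 * t) \<subseteq> (E t - (\<Union>x\<in>I. ball x (3 * r x))) \<union> ((\<Union>x\<in>I. P x) \<union> ?M)"
          using E_mono unfolding P_def E_def by blast
        then have "emeasure \<mu> (E (2 * t)) \<le> emeasure \<mu> ((E t - (\<Union>x\<in>I. ball x (3 * r x))) \<union> ((\<Union>x\<in>I. P x) \<union> ?M))"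
          by (intro emeasure_mono sets.Un m1 m2 Mm)
        also have "\<dots> \<le> emeasure \<mu> (E t - (\<Union>x\<in>I. ball x (3 * r x))) + emeasure \<mu> ((\<Union>x\<in>I. P x) \<union> ?M)"
          by (intro emeasure_subadditive sets.Un m1 m2 Mm)
        also have "\<dots> \<le> ennreal \<delta> + (emeasure \<mu> (\<Union>x\<in>I. P x) + emeasure \<mu> ?M)"
          using rest by (intro add_mono emeasure_subadditive m2 Mm less_imp_le)
        also have "emeasure \<mu> (\<Union>x\<in>I. P x) \<le> (\<Sum>x\<in>I. emeasure \<mu> (P x))"
          using I Pm by (intro emeasure_subadditive_finite) auto
        also have "\<dots> \<le> (\<Sum>x\<in>I. ennreal (2 * C * \<gamma> * m x (32 * r x)))" by (intro sum_mono Pb)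
        also have "\<dots> = ennreal (2 * C * \<gamma> * (\<Sum>x\<in>I. m x (32 * r x)))"
          unfolding sum_distrib_left using C0 \<gamma>(1) by (intro sum_ennreal) auto
        also have "\<dots> \<le> ennreal (1/8 * e)"
        proof (rule ennreal_leI)
          have "2 * C * \<gamma> * (\<Sum>x\<in>I. m x (32 * r x)) \<le> 2 * C * \<gamma> * (4 * \<beta> * (2 * e))"
            using C0 \<gamma>(1) beta_pos mU w by (intro mult_left_mono order_trans[OF sm]) auto
          also have "\<dots> = (128 * C * \<gamma> * \<beta>) * (1/8 * e)" by simp
          also have "\<dots> \<le> 1 * (1/8 * e)" using \<gamma>(3) e by (intro mult_right_mono) auto
          finally show "2 * C * \<gamma> * (\<Sum>x\<in>I. m x (32 * r x)) \<le> 1/8 * e" by simp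
        qed
        finally have "emeasure \<mu> (E (2 * t)) \<le> ennreal \<delta> + (ennreal (1/8 * e) + emeasure \<mu> ?M)"
          by (simp add: add_left_mono add_right_mono)
        also have "ennreal (1/8 * e) = ennreal (1/8) * ennreal e" using e by (intro ennreal_mult) auto
        finally show "emeasure \<mu> (E (2 * t)) \<le> ennreal (1/8) * ennreal e + emeasure \<mu> ?M + ennreal \<delta>"
          by (simp add: ac_simps)
      qed
    next
      \<comment> \<open>The space has finite measure comparable to that of \<open>E t\<close>, and the maximal set is everything.\<close>
      case False
      then have mb: "m y R \<le> 8 * \<beta> * e" for y R
      proof -
        have "m y R / (4 * \<beta>) \<le> measure \<mu> U" using False w by (simp add: not_less)
        then have "m y R \<le> 4 * \<beta> * measure \<mu> U" using beta_pos by (simp add: field_simps)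
        also have "\<dots> \<le> 4 * \<beta> * (2 * e)" using mU beta_pos by (intro mult_left_mono) auto
        finally show ?thesis by simp
      qed
      have "ennreal e \<le> ennreal (C * (LINT x|\<mu>. norm (f x)) / t)" using E_weak Ee by simp
      then have "e \<le> C * (LINT x|\<mu>. norm (f x)) / t"
        using C0 t by (subst (asm) ennreal_le_iff) (auto intro!: Bochner_Integration.integral_nonneg)
      then have et: "t * e \<le> C * (LINT x|\<mu>. norm (f x))" using t by (simp add: field_simps)
      have "?M = UNIV"
      proof (rule max_set_UNIV[OF f])
        fix y R
        have "C * (\<gamma> * t * m y R) \<le> C * (\<gamma> * t * (8 * \<beta> * e))"
          using C0 \<gamma>(1) t by (intro mult_left_mono mb) auto
        also have "\<dots> = (8 * C * \<gamma> * \<beta>) * (t * e)" by simp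
        also have "\<dots> < 1 * (t * e)" using \<gamma>(3) CC t e by (intro mult_strict_right_mono) auto
        also have "\<dots> \<le> C * (LINT x|\<mu>. norm (f x))" using et by simp
        finally show "\<gamma> * t * m y R < (LINT x|\<mu>. norm (f x))" using C0 by simp
      qed (use \<gamma>(1) t in simp)
      then have "emeasure \<mu> (E (2 * t)) \<le> emeasure \<mu> ?M" using Em by (intro emeasure_mono) auto
      then show ?thesis by (simp add: add_increasing)
    qed
  qed
  then show ?thesis using Ee unfolding E_def by simp
qed

text \<open>The two smallness conditions on \<open>\<gamma>\<close> involve only \<open>C\<close>
  and the constants of the space and the kernel, so the resulting bound is uniform in
  \<open>f\<close>.\<close>

theorem weak11_imp_L2:
  assumes C: "weak11 C"
  obtains A where "A > 0"
    "\<And>f. f \<in> Linf_b \<mu> \<Longrightarrow> (\<integral>\<^sup>+x. ennreal ((norm (T f x))\<^sup>2) \<partial>\<mu>) \<le> ennreal A * (\<integral>\<^sup>+x. ennreal ((norm (f x))\<^sup>2) \<partial>\<mu>)"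
proof -
  have C0: "C > 0" using C unfolding weak11_def by blast
  define q where "q = \<kappa> * L\<^sup>2 * (5 * L\<^sup>2 + 2 / (1 - 32 powr (-\<tau>)))"
  have "32 powr (-\<tau>) < (1::real)" using tau_pos powr_less_mono[of "-\<tau>" 0 32] by auto
  then have q: "q > 0" unfolding q_def using kappa_pos L_ge1 by (intro mult_pos_pos add_pos_pos) auto
  define \<gamma> where "\<gamma> = min (1 / (4 * q)) (1 / (128 * C * \<beta>))"
  have g1: "\<gamma> > 0" unfolding \<gamma>_def using q C0 beta_pos by auto
  have "\<gamma> \<le> 1 / (4 * q)" "\<gamma> \<le> 1 / (128 * C * \<beta>)" unfolding \<gamma>_def by auto
  then have g2: "\<gamma> * q \<le> 1/4" "128 * C * \<gamma> * \<beta> \<le> 1" using q C0 beta_pos by (auto simp: field_simps)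
  show thesis
  proof (rule that[of "64 / \<gamma>\<^sup>2"])
    show "64 / \<gamma>\<^sup>2 > 0" using g1 by simp
    fix f assume f: "f \<in> Linf_b \<mu>"
    show "(\<integral>\<^sup>+x. ennreal ((norm (T f x))\<^sup>2) \<partial>\<mu>) \<le> ennreal (64 / \<gamma>\<^sup>2) * (\<integral>\<^sup>+x. ennreal ((norm (f x))\<^sup>2) \<partial>\<mu>)"
    proof (rule good_lambda_L2[OF Linf_b_integrable_norm[OF f] _ _ _ g1])
      show "(\<lambda>x. norm (T f x)) \<in> borel_measurable \<mu>" using T_measurable[OF f] by measurable
      fix t :: real assume t: "t > 0"
      show "emeasure \<mu> {x. norm (T f x) > 2 * t} \<le> ennreal (1/8) * emeasure \<mu> {x. norm (T f x) > t} +
        emeasure \<mu> (max_set (\<lambda>x. norm (f x)) (\<gamma> * t))"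
        using g2 unfolding q_def by (intro good_lambda_inequality[OF C f t g1]) auto
      show "emeasure \<mu> {x. norm (T f x) > t} \<le> ennreal (C * (LINT x|\<mu>. norm (f x)) / t)"
        using C f t unfolding weak11_def by blast
    qed auto
  qed
qed

end

subsection \<open>From Lp to weak type (1,1)\<close>

context doubling_space
begin

text \<open>
  The functions \<open>\<alpha> i * indicator (A i)\<close> are chosen greedily in order of increasing radius: by
  Chebyshev's inequality, the earlier ones add up to at most \<open>t\<close> on half of the \<open>k\<close>-th ball.
\<close>

lemma ex_balancing:
  fixes x :: "'i \<Rightarrow> 'a" and \<rho> :: "'i \<Rightarrow> real" and M :: "'i \<Rightarrow> complex"
  assumes "finite I" and t: "t > 0" and "\<And>i. i \<in> I \<Longrightarrow> m (x i) (\<rho> i) > 0"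
    and "\<And>k. k \<in> I \<Longrightarrow> (\<Sum>i\<in>{i\<in>I. \<rho> i \<le> \<rho> k \<and> ball (x i) (\<rho> i) \<inter> ball (x k) (\<rho> k) \<noteq> {}}. norm (M i))
       \<le> t * m (x k) (\<rho> k) / 2"
  shows "\<exists>(\<alpha> :: 'i \<Rightarrow> complex) A. (\<forall>i\<in>I. A i \<in> sets \<mu> \<and> A i \<subseteq> ball (x i) (\<rho> i) \<and> \<alpha> i * measure \<mu> (A i) = M i
      \<and> norm (\<alpha> i) * m (x i) (\<rho> i) \<le> 2 * norm (M i))
    \<and> (\<forall>z. (\<Sum>i\<in>I. norm (\<alpha> i) * indicator (A i) z) \<le> 2 * t)"
  using assms(1,3,4)
proof (induction I rule: finite_ranking_induct[where f = \<rho>])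
  case empty
  then show ?case using t by simp
next
  case (insert k S)
  show ?case
  proof (cases "k \<in> S")
    case True
    then have "insert k S = S" by blast
    then show ?thesis using insert by simp
  next
    case kS: False
    let ?B = "\<lambda>i. ball (x i) (\<rho> i)"
    \<comment> \<open>\<open>k\<close> has the largest radius so far, so every earlier ball that
      meets \<open>?B k\<close> is counted in the hypothesis for \<open>k\<close>.\<close>
    let ?near = "{i\<in>S. ?B i \<inter> ?B k \<noteq> {}}"
    have mk: "m (x k) (\<rho> k) > 0" using insert.prems(1) by simp
    then have Bk: "?B k \<noteq> {}" by (metis less_irrefl measure_empty)
    have "\<exists>(\<alpha> :: 'i \<Rightarrow> complex) A. (\<forall>i\<in>S. A i \<in> sets \<mu> \<and> A i \<subseteq> ?B i \<and> \<alpha> i * measure \<mu> (A i) = M i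
      \<and> norm (\<alpha> i) * m (x i) (\<rho> i) \<le> 2 * norm (M i))
      \<and> (\<forall>z. (\<Sum>i\<in>S. norm (\<alpha> i) * indicator (A i) z) \<le> 2 * t)"
    proof (rule insert.IH)
      fix i assume i: "i \<in> S"
      show "m (x i) (\<rho> i) > 0" using insert.prems(1) i by simp
      have "(\<Sum>j\<in>{j\<in>S. \<rho> j \<le> \<rho> i \<and> ?B j \<inter> ?B i \<noteq> {}}. norm (M j))
        \<le> (\<Sum>j\<in>{j\<in>insert k S. \<rho> j \<le> \<rho> i \<and> ?B j \<inter> ?B i \<noteq> {}}. norm (M j))"
        using insert.hyps(1) by (intro sum_mono2) auto
      also have "\<dots> \<le> t * m (x i) (\<rho> i) / 2" using insert.prems(2)[of i] i by simp
      finally show "(\<Sum>j\<in>{j\<in>S. \<rho> j \<le> \<rho> i \<and> ?B j \<inter> ?B i \<noteq> {}}. norm (M j)) \<le> t * m (x i) (\<rho> i) / 2" .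
    qed
    then obtain \<alpha> :: "'i \<Rightarrow> complex" and A where
      *: "\<forall>i\<in>S. A i \<in> sets \<mu> \<and> A i \<subseteq> ?B i \<and> \<alpha> i * measure \<mu> (A i) = M i
        \<and> norm (\<alpha> i) * m (x i) (\<rho> i) \<le> 2 * norm (M i)"
      and "\<forall>z. (\<Sum>i\<in>S. norm (\<alpha> i) * indicator (A i) z) \<le> 2 * t" by (elim exE conjE) (rule that)
    then have A: "\<And>i. i \<in> S \<Longrightarrow> A i \<in> sets \<mu>" "\<And>i. i \<in> S \<Longrightarrow> A i \<subseteq> ?B i"
      and \<alpha>: "\<And>i. i \<in> S \<Longrightarrow> \<alpha> i * measure \<mu> (A i) = M i"
        "\<And>i. i \<in> S \<Longrightarrow> norm (\<alpha> i) * m (x i) (\<rho> i) \<le> 2 * norm (M i)"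
      and bd: "\<And>z. (\<Sum>i\<in>S. norm (\<alpha> i) * indicator (A i) z) \<le> 2 * t" by auto
    define h where "h z = (\<Sum>i\<in>S. norm (\<alpha> i) * indicator (A i) z)" for z
    have hm[measurable]: "h \<in> borel_measurable \<mu>" unfolding h_def using A(1)
      by (intro borel_measurable_sum borel_measurable_times borel_measurable_indicator) auto
    have "{z \<in> space \<mu>. h z > t} \<in> sets \<mu>" by measurable
    then have hset: "{z. h z > t} \<in> sets \<mu>" by simp
    \<comment> \<open>The points of the ball where the earlier functions already exceed
      \<open>t\<close> are removed; they fill at most half of it.\<close>
    define Ak where "Ak = ?B k - {z. h z > t}"
    have Akm: "Ak \<in> sets \<mu>" unfolding Ak_def using hset by auto
    define H where "H = ?B k \<inter> {z. h z > t}"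
    have Hm: "H \<in> sets \<mu>" unfolding H_def using hset by auto
    have finB: "emeasure \<mu> C < \<infinity>" if "C \<subseteq> ?B i" for C i
      using emeasure_mono[OF that, of \<mu>] emeasure_ball_finite[of "x i" "\<rho> i"] by (simp add: le_less_trans)
    have Sk: "(\<Sum>i\<in>?near. norm (M i)) + norm (M k) \<le> t * m (x k) (\<rho> k) / 2"
    proof -
      have "{i\<in>insert k S. \<rho> i \<le> \<rho> k \<and> ?B i \<inter> ?B k \<noteq> {}} = insert k ?near"
        using insert.hyps(2) Bk by auto
      then show ?thesis using insert.prems(2)[of k] kS insert.hyps(1) by simp
    qed
    have "t * measure \<mu> H = (LINT z|\<mu>. t * indicator H z)" by simp
    also have "\<dots> \<le> (LINT z|\<mu>. (\<Sum>i\<in>S. norm (\<alpha> i) * indicator (A i \<inter> ?B k) z))"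
    proof (rule integral_mono)
      show "integrable \<mu> (\<lambda>z. t * indicator H z)"
        using finB[of H k] Hm by (intro integrable_mult_right integrable_real_indicator) (auto simp: H_def)
      show "integrable \<mu> (\<lambda>z. \<Sum>i\<in>S. norm (\<alpha> i) * indicator (A i \<inter> ?B k) z)"
        using finB[of "A i \<inter> ?B k" k for i] A(1)
        by (intro Bochner_Integration.integrable_sum integrable_mult_right integrable_real_indicator) auto
      fix z
      show "t * indicator H z \<le> (\<Sum>i\<in>S. norm (\<alpha> i) * indicator (A i \<inter> ?B k) z)"
      proof (cases "z \<in> H")
        case True
        then have "t < h z" "z \<in> ?B k" unfolding H_def by auto
        moreover have "h z = (\<Sum>i\<in>S. norm (\<alpha> i) * indicator (A i \<inter> ?B k) z)"
          unfolding h_def using \<open>z \<in> ?B k\<close> by (intro sum.cong) (auto simp: indicator_def)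
        ultimately show ?thesis using True by simp
      qed (auto intro!: sum_nonneg)
    qed
    also have "\<dots> = (\<Sum>i\<in>S. norm (\<alpha> i) * measure \<mu> (A i \<inter> ?B k))"
    proof -
      have "integrable \<mu> (\<lambda>z. norm (\<alpha> i) * indicator (A i \<inter> ?B k) z)" if "i \<in> S" for i
        using finB[of "A i \<inter> ?B k" k] A(1)[OF that]
        by (intro integrable_mult_right integrable_real_indicator) auto
      then show ?thesis by (subst Bochner_Integration.integral_sum) auto
    qed
    also have "\<dots> = (\<Sum>i\<in>?near. norm (\<alpha> i) * measure \<mu> (A i \<inter> ?B k))"
    proof (rule sum.mono_neutral_right)
      show "\<forall>i\<in>S - ?near. norm (\<alpha> i) * measure \<mu> (A i \<inter> ?B k) = 0"
      proof
        fix i assume "i \<in> S - ?near"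
        then have "A i \<inter> ?B k = {}" using A(2)[of i] by blast
        then show "norm (\<alpha> i) * measure \<mu> (A i \<inter> ?B k) = 0" by (simp only: measure_empty mult_zero_right)
      qed
    qed (use insert.hyps(1) in auto)
    also have "\<dots> \<le> (\<Sum>i\<in>?near. norm (M i))"
    proof (rule sum_mono)
      fix i assume i: "i \<in> ?near"
      have "measure \<mu> (A i \<inter> ?B k) \<le> measure \<mu> (A i)"
        using A[of i] i finB[of "A i" i] by (intro measure_mono_fmeasurable) (auto simp: fmeasurable_def)
      then have "norm (\<alpha> i) * measure \<mu> (A i \<inter> ?B k) \<le> norm (\<alpha> i) * measure \<mu> (A i)" by (intro mult_left_mono) auto
      also have "\<dots> = norm (\<alpha> i * measure \<mu> (A i))" by (simp add: norm_mult)
      also have "\<dots> = norm (M i)" using \<alpha>(1)[of i] i by simp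
      finally show "norm (\<alpha> i) * measure \<mu> (A i \<inter> ?B k) \<le> norm (M i)" .
    qed
    also have "\<dots> \<le> t * m (x k) (\<rho> k) / 2" using Sk norm_ge_zero[of "M k"] by linarith
    finally have "t * measure \<mu> H \<le> t * (m (x k) (\<rho> k) / 2)" by simp
    then have mH: "measure \<mu> H \<le> m (x k) (\<rho> k) / 2" using t by simp
    have "m (x k) (\<rho> k) = measure \<mu> (Ak \<union> H)" unfolding Ak_def H_def by (rule arg_cong[where f = "measure \<mu>"]) auto
    also have "\<dots> \<le> measure \<mu> Ak + measure \<mu> H"
      using Akm Hm finB[of Ak k] finB[of H k] by (intro measure_Un_le) auto
    finally have mA: "measure \<mu> Ak \<ge> m (x k) (\<rho> k) / 2" using mH by linarith
    then have mA0: "measure \<mu> Ak > 0" using mk by linarith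
    define ak where "ak = M k / measure \<mu> Ak"
    have nak: "norm (ak) * measure \<mu> Ak = norm (M k)" unfolding ak_def using mA0 by (simp add: norm_divide)
    have ak1: "norm ak * m (x k) (\<rho> k) \<le> 2 * norm (M k)"
    proof -
      have "norm ak * m (x k) (\<rho> k) \<le> norm ak * (2 * measure \<mu> Ak)" using mA by (intro mult_left_mono) auto
      then show ?thesis using nak by simp
    qed
    have nMk: "norm (M k) \<le> t * m (x k) (\<rho> k) / 2"
      using Sk sum_nonneg[of ?near "\<lambda>i. norm (M i)"] by auto
    have "norm ak * measure \<mu> Ak \<le> t * measure \<mu> Ak"
    proof -
      have "t * (m (x k) (\<rho> k) / 2) \<le> t * measure \<mu> Ak" using mA t by (intro mult_left_mono) auto
      then show ?thesis using nak nMk by simp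
    qed
    \<comment> \<open>On \<open>Ak\<close> the old sum and the new term are each at most
      \<open>t\<close>, and elsewhere nothing changes; so the bound \<open>2 * t\<close> is
      preserved.\<close>
    then have ak2: "norm ak \<le> t" using mA0 by simp
    show ?thesis
    proof (intro exI[of _ "\<alpha>(k := ak)"] exI[of _ "A(k := Ak)"] conjI ballI allI)
      fix i assume i: "i \<in> insert k S"
      show "(A(k := Ak)) i \<in> sets \<mu>" using i A Akm by auto
      show "(A(k := Ak)) i \<subseteq> ?B i" using i A(2) unfolding Ak_def by auto
      show "(\<alpha>(k := ak)) i * complex_of_real (measure \<mu> ((A(k := Ak)) i)) = M i"
        using i \<alpha>(1) mA0 by (auto simp: ak_def)
      show "norm ((\<alpha>(k := ak)) i) * m (x i) (\<rho> i) \<le> 2 * norm (M i)"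
        using i \<alpha>(2) ak1 by auto
    next
      fix z
      have "(\<Sum>i\<in>insert k S. norm ((\<alpha>(k := ak)) i) * indicator ((A(k := Ak)) i) z) = norm ak * indicator Ak z + h z"
      proof -
        have "(\<Sum>i\<in>S. norm ((\<alpha>(k := ak)) i) * indicator ((A(k := Ak)) i) z) = h z"
          unfolding h_def using kS by (intro sum.cong refl) auto
        then show ?thesis unfolding sum.insert[OF insert.hyps(1) kS] by (simp only: fun_upd_same)
      qed
      also have "\<dots> \<le> 2 * t"
      proof (cases "z \<in> Ak")
        case True
        then have "h z \<le> t" unfolding Ak_def by auto
        then show ?thesis using ak2 True by simp
      next
        case False
        then show ?thesis using bd[of z] unfolding h_def by simp
      qed
      finally show "(\<Sum>i\<in>insert k S. norm ((\<alpha>(k := ak)) i) * indicator ((A(k := Ak)) i) z) \<le> 2 * t" .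
    qed
  qed
qed

end

context CZ_space
begin

text \<open>The norm inequality raised to the power \<open>p\<close>; accordingly \<open>C\<close>
  is the \<open>p\<close>-th power of an operator bound.\<close>

definition Lp_bd :: "real \<Rightarrow> real \<Rightarrow> bool" where
  "Lp_bd p C \<longleftrightarrow> C > 0 \<and> (\<forall>g\<in>Linf_b \<mu>. (\<integral>\<^sup>+x. ennreal (norm (T g x) powr p) \<partial>\<mu>) \<le> ennreal (C * (LINT x|\<mu>. norm (g x) powr p)))"

text \<open>Integrated over a ball with a suitable \<open>s\<close>, this replaces Hoelder's inequality.\<close>

lemma le_scale_plus_powr:
  fixes v s p :: real
  assumes "v \<ge> 0" "s > 0" "p > 1"
  shows "v \<le> s + s powr (1 - p) * v powr p"
proof (cases "v \<le> s")
  case True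
  then show ?thesis by (simp add: add_increasing2)
next
  case False
  then have "v = v powr (1 - p) * v powr p" using assms by (simp add: powr_add[symmetric])
  also have "\<dots> \<le> s powr (1 - p) * v powr p"
    using False assms by (intro mult_right_mono powr_mono2') auto
  also have "\<dots> \<le> s + s powr (1 - p) * v powr p" using assms by simp
  finally show ?thesis .
qed

text \<open>Write \<open>\<phi>\<close> for the balancing function and \<open>R\<close> for the
  radius of the doubling ball. Beyond \<open>32 * R\<close> the mean of \<open>b - \<phi>\<close>
  vanishes, and regularity of the kernel gives decay. Between \<open>32 * r\<close> and
  \<open>32 * R\<close> this cancellation cannot be exploited, because \<open>\<phi>\<close> is
  spread over the doubling ball, so the two functions are separated: the size of the kernel and the
  sum over scales control \<open>T b\<close>, and the \<open>L\<^sup>p\<close> bound controls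
  \<open>T \<phi>\<close>. These ranges give the three terms of the constant.\<close>

lemma bad_part_bound:
  fixes b :: "'a \<Rightarrow> complex" and \<alpha> :: complex
  assumes C: "Lp_bd p C" and p: "p > 1" and r: "r > 0"
    and n: "n \<ge> 1" "m x (32 ^ (n + 2) * r) \<le> \<beta> * m x (32 ^ n * r)"
      "(\<Sum>j\<le>n. m x (32 ^ (j + 2) * r) / \<Lambda> x (32 ^ j * r)) \<le> 5 * L\<^sup>2"
    and b: "b \<in> Linf_b \<mu>" "\<And>y. y \<notin> ball x (3 * r) \<Longrightarrow> b y = 0"
    and A: "A \<in> sets \<mu>" "A \<subseteq> ball x (32 ^ n * r)"
    and \<alpha>: "\<alpha> * measure \<mu> A = (LINT y|\<mu>. b y)" "norm \<alpha> * m x (32 ^ n * r) \<le> 2 * norm (LINT y|\<mu>. b y)"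
  shows "(\<integral>\<^sup>+z. ennreal (norm (T (\<lambda>y. b y - \<alpha> * indicator A y) z)) * indicator (- ball x (32 * r)) z \<partial>\<mu>)
    \<le> ennreal ((2 * \<kappa> * L / (1 - 32 powr (-\<tau>)) + 5 * \<kappa> * L ^ 4 + 2 * (\<beta> + C)) * (LINT y|\<mu>. norm (b y)))"
proof -
  have C0: "C > 0" and Lp: "\<And>g. g \<in> Linf_b \<mu> \<Longrightarrow> (\<integral>\<^sup>+x. ennreal (norm (T g x) powr p) \<partial>\<mu>) \<le> ennreal (C * (LINT x|\<mu>. norm (g x) powr p))"
    using C unfolding Lp_bd_def by auto
  define R where "R = 32 ^ n * r"
  have "(32::real) ^ 1 \<le> 32 ^ n" using n(1) by (intro power_increasing) auto
  then have Rr: "R \<ge> 32 * r" unfolding R_def using r by simp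
  then have R: "R > 0" using r by linarith
  have R32: "32 ^ (n + 1) * r = 32 * R" "32 ^ (n + 2) * r = 1024 * R" by (auto simp: R_def)
  define \<theta> :: real where "\<theta> = 32 powr (-\<tau>)"
  have th: "0 < \<theta>" "\<theta> < 1" unfolding \<theta>_def using tau_pos powr_less_mono[of "-\<tau>" 0 32] by auto
  define \<phi> where "\<phi> y = \<alpha> * indicator A y" for y
  define a where "a y = b y - \<phi> y" for y
  define nb where "nb = (LINT y|\<mu>. norm (b y))"
  have nb0: "nb \<ge> 0" unfolding nb_def by (rule Bochner_Integration.integral_nonneg) auto
  have Afin: "emeasure \<mu> A < \<infinity>"
    using emeasure_mono[OF A(2), of \<mu>] emeasure_ball_finite[of x "32 ^ n * r"] by (simp add: le_less_trans)
  have phi: "\<phi> \<in> Linf_b \<mu>" unfolding \<phi>_def[abs_def] by (rule Linf_b_indicator[OF A])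
  have a: "a \<in> Linf_b \<mu>" unfolding a_def[abs_def] by (rule Linf_b_diff[OF b(1) phi])
  have Mnb: "norm (LINT y|\<mu>. b y) \<le> nb" unfolding nb_def by (rule integral_norm_bound)
  have int_phi: "(LINT y|\<mu>. \<phi> y) = \<alpha> * measure \<mu> A"
  proof -
    have "(LINT y|\<mu>. \<phi> y) = (LINT y|\<mu>. indicat_real A y *\<^sub>R \<alpha>)"
      by (intro Bochner_Integration.integral_cong) (auto simp: \<phi>_def indicator_def)
    also have "\<dots> = measure \<mu> A *\<^sub>R \<alpha>"
      using A(1) Afin by (subst integral_scaleR_left) (auto intro!: integrable_real_indicator)
    finally show ?thesis by (simp add: scaleR_conv_of_real mult.commute)
  qed
  have mean: "(LINT y|\<mu>. a y) = 0"
    unfolding a_def using \<alpha>(1) int_phi Linf_b_integrable[OF b(1)] Linf_b_integrable[OF phi] by simp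
  have am: "norm \<alpha> * measure \<mu> A \<le> nb"
  proof -
    have "norm \<alpha> * measure \<mu> A = norm (\<alpha> * measure \<mu> A)" by (simp add: norm_mult)
    then show ?thesis using \<alpha>(1) Mnb by simp
  qed
  have nphi: "(LINT y|\<mu>. norm (\<phi> y)) = norm \<alpha> * measure \<mu> A"
  proof -
    have "(LINT y|\<mu>. norm (\<phi> y)) = (LINT y|\<mu>. norm \<alpha> * indicator A y)"
      by (intro Bochner_Integration.integral_cong) (auto simp: \<phi>_def indicator_def)
    then show ?thesis using A(1) by simp
  qed
  have na: "(LINT y|\<mu>. norm (a y)) \<le> 2 * nb"
  proof -
    have "(LINT y|\<mu>. norm (a y)) \<le> (LINT y|\<mu>. norm (b y) + norm (\<phi> y))"
      unfolding a_def using Linf_b_integrable_norm[OF b(1)] Linf_b_integrable_norm[OF phi] Linf_b_integrable_norm[OF a]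
      by (intro integral_mono) (auto simp: a_def norm_triangle_ineq4)
    also have "\<dots> = nb + norm \<alpha> * measure \<mu> A"
      using Linf_b_integrable_norm[OF b(1)] Linf_b_integrable_norm[OF phi] nphi by (simp add: nb_def)
    also have "\<dots> \<le> 2 * nb" using am by simp
    finally show ?thesis .
  qed
  have am2: "norm \<alpha> * m x R \<le> 2 * nb" using \<alpha>(2) Mnb unfolding R_def[symmetric] by linarith
  note [measurable] = T_measurable[OF a] T_measurable[OF b(1)] T_measurable[OF phi]
  have far: "(\<integral>\<^sup>+z. ennreal (norm (T a z)) * indicator (- ball x (32 * R)) z \<partial>\<mu>) \<le> ennreal (2 * \<kappa> * L / (1 - \<theta>) * nb)"
  proof -
    have van: "AE y in \<mu>. y \<notin> ball x R \<longrightarrow> a y = 0"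
    proof (rule AE_I2, rule impI)
      fix y assume y: "y \<notin> ball x R"
      then have "y \<notin> ball x (3 * r)" using Rr r by auto
      moreover have "y \<notin> A" using y A(2) unfolding R_def by blast
      ultimately show "a y = 0" using b(2) by (simp add: a_def \<phi>_def)
    qed
    let ?k = "\<lambda>z. R powr \<tau> / (dist x z powr \<tau> * \<Lambda> x (dist x z))"
    have "(\<integral>\<^sup>+z. ennreal (norm (T a z)) * indicator (- ball x (32 * R)) z \<partial>\<mu>)
      \<le> (\<integral>\<^sup>+z. ennreal (\<kappa> * (2 * nb)) * (ennreal 1 * ennreal (?k z) * indicator (- ball x R) z) \<partial>\<mu>)"
    proof (rule nn_integral_mono_AE)
      show "AE z in \<mu>. ennreal (norm (T a z)) * indicator (- ball x (32 * R)) z \<le>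
        ennreal (\<kappa> * (2 * nb)) * (ennreal 1 * ennreal (?k z) * indicator (- ball x R) z)"
        using T_far_bound[OF a R van mean]
      proof eventually_elim
        case (elim z)
        show ?case
        proof (cases "z \<in> - ball x (32 * R)")
          case True
          then have zd: "dist x z \<ge> 32 * R" by auto
          have lp: "\<Lambda> x (dist x z) > 0" using zd R by (intro Lam_pos) linarith
          then have k0: "?k z \<ge> 0" by simp
          have "norm (T a z) \<le> \<kappa> * ?k z * (LINT y|\<mu>. norm (a y))" using elim zd by blast
          also have "\<dots> \<le> \<kappa> * ?k z * (2 * nb)" using kappa_pos
            by (intro mult_left_mono[OF na] mult_nonneg_nonneg k0) auto
          also have "\<dots> = (\<kappa> * (2 * nb)) * ?k z" by simp
          finally have "ennreal (norm (T a z)) \<le> ennreal ((\<kappa> * (2 * nb)) * ?k z)" by (rule ennreal_leI)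
          also have "\<dots> = ennreal (\<kappa> * (2 * nb)) * ennreal (?k z)" using k0 kappa_pos nb0 by (intro ennreal_mult) auto
          finally show ?thesis using True R by (auto simp: indicator_def)
        qed auto
      qed
    qed
    also have "\<dots> = ennreal (\<kappa> * (2 * nb)) * (\<integral>\<^sup>+z. ennreal 1 * ennreal (?k z) * indicator (- ball x R) z \<partial>\<mu>)"
      by (rule nn_integral_cmult) measurable
    also have "\<dots> \<le> ennreal (\<kappa> * (2 * nb)) * ennreal (L / (1 - \<theta>))"
      unfolding \<theta>_def
    proof (intro mult_left_mono nn_integral_far R tau_pos)
      fix j
      have p: "32 ^ j * R > 0" using R by simp
      have "(\<integral>\<^sup>+z. ennreal 1 * indicator (ball x (32 ^ (j + 1) * R)) z \<partial>\<mu>) = ennreal (m x (32 * (32 ^ j * R)))"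
        by (simp add: emeasure_ball mult.assoc)
      also have "\<dots> \<le> ennreal (L * \<Lambda> x (32 ^ j * R))"
        using p by (intro ennreal_leI order_trans[OF m_le_Lam Lam_32]) auto
      finally show "(\<integral>\<^sup>+z. ennreal 1 * indicator (ball x (32 ^ (j + 1) * R)) z \<partial>\<mu>) \<le> ennreal (L * \<Lambda> x (32 ^ j * R))" .
    qed (use L_ge1 in auto)
    also have "\<dots> = ennreal (\<kappa> * (2 * nb) * (L / (1 - \<theta>)))"
      using kappa_pos nb0 L_ge1 th by (intro ennreal_mult[symmetric]) auto
    finally show ?thesis by (simp add: mult_ac)
  qed
  have mid: "(\<integral>\<^sup>+z. ennreal (norm (T b z)) * indicator (ball x (32 * R) - ball x (32 * r)) z \<partial>\<mu>) \<le> ennreal (5 * \<kappa> * L ^ 4 * nb)"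
  proof -
    have van: "AE y in \<mu>. y \<notin> ball x (3 * r) \<longrightarrow> b y = 0" using b(2) by auto
    have "(\<integral>\<^sup>+z. ennreal (norm (T b z)) * indicator (ball x (32 * R) - ball x (32 * r)) z \<partial>\<mu>)
      \<le> (\<integral>\<^sup>+z. ennreal (\<kappa> * L\<^sup>2 * nb) * (ennreal 1 * ennreal (1 / \<Lambda> x (dist x z)) * indicator (ball x (32 ^ (n + 1) * r) - ball x r) z) \<partial>\<mu>)"
    proof (rule nn_integral_mono_AE)
      show "AE z in \<mu>. ennreal (norm (T b z)) * indicator (ball x (32 * R) - ball x (32 * r)) z \<le>
        ennreal (\<kappa> * L\<^sup>2 * nb) * (ennreal 1 * ennreal (1 / \<Lambda> x (dist x z)) * indicator (ball x (32 ^ (n + 1) * r) - ball x r) z)"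
        using T_near_bound[OF b(1) r van]
      proof eventually_elim
        case (elim z)
        show ?case
        proof (cases "z \<in> ball x (32 * R) - ball x (32 * r)")
          case True
          then have zd: "dist x z \<ge> 8 * r" using r by auto
          have lp: "\<Lambda> x (dist x z) > 0" using zd r by (intro Lam_pos) linarith
          have "norm (T b z) \<le> \<kappa> * L\<^sup>2 / \<Lambda> x (dist x z) * nb" using elim zd unfolding nb_def by blast
          also have "\<dots> = (\<kappa> * L\<^sup>2 * nb) * (1 / \<Lambda> x (dist x z))" by simp
          finally have "ennreal (norm (T b z)) \<le> ennreal ((\<kappa> * L\<^sup>2 * nb) * (1 / \<Lambda> x (dist x z)))" by (rule ennreal_leI)
          also have "\<dots> = ennreal (\<kappa> * L\<^sup>2 * nb) * ennreal (1 / \<Lambda> x (dist x z))" using lp kappa_pos nb0 by (intro ennreal_mult) auto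
          finally show ?thesis unfolding R32 using True r by (auto simp: indicator_def)
        qed auto
      qed
    qed
    also have "\<dots> = ennreal (\<kappa> * L\<^sup>2 * nb) * (\<integral>\<^sup>+z. ennreal 1 * ennreal (1 / \<Lambda> x (dist x z)) * indicator (ball x (32 ^ (n + 1) * r) - ball x r) z \<partial>\<mu>)"
      by (rule nn_integral_cmult) measurable
    also have "\<dots> \<le> ennreal (\<kappa> * L\<^sup>2 * nb) * ennreal (\<Sum>j\<le>n. m x (32 ^ (j + 2) * r) / \<Lambda> x (32 ^ j * r))"
    proof (intro mult_left_mono nn_integral_annuli r)
      fix j
      have lp: "\<Lambda> x (32 ^ j * r) > 0" using r by (intro Lam_pos) simp
      then show "0 \<le> m x (32 ^ (j + 2) * r) / \<Lambda> x (32 ^ j * r)" by simp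
      have "(\<integral>\<^sup>+z. ennreal 1 * indicator (ball x (32 ^ (j + 1) * r)) z \<partial>\<mu>) = ennreal (m x (32 ^ (j + 1) * r))"
        by (simp add: emeasure_ball)
      also have "\<dots> \<le> ennreal (m x (32 ^ (j + 2) * r))" using r by (intro ennreal_leI m_mono) auto
      also have "\<dots> = ennreal (m x (32 ^ (j + 2) * r) / \<Lambda> x (32 ^ j * r) * \<Lambda> x (32 ^ j * r))" using lp by simp
      finally show "(\<integral>\<^sup>+z. ennreal 1 * indicator (ball x (32 ^ (j + 1) * r)) z \<partial>\<mu>) \<le>
        ennreal (m x (32 ^ (j + 2) * r) / \<Lambda> x (32 ^ j * r) * \<Lambda> x (32 ^ j * r))" .
    qed auto
    also have "\<dots> \<le> ennreal (\<kappa> * L\<^sup>2 * nb) * ennreal (5 * L\<^sup>2)" using n(3) by (intro mult_left_mono ennreal_leI) auto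
    also have "\<dots> = ennreal (\<kappa> * L\<^sup>2 * nb * (5 * L\<^sup>2))" using kappa_pos nb0 by (intro ennreal_mult[symmetric]) auto
    finally show ?thesis by (simp add: mult_ac power2_eq_square power4_eq_xxxx)
  qed
  have loc: "(\<integral>\<^sup>+z. ennreal (norm (T \<phi> z)) * indicator (ball x (32 * R)) z \<partial>\<mu>) \<le> ennreal (2 * (\<beta> + C) * nb)"
  \<comment> \<open>The scale \<open>s = norm \<alpha>\<close> chosen below has to be
    positive.\<close>
  proof (cases "\<alpha> = 0")
    case True
    then have "\<phi> = (\<lambda>y. 0)" unfolding \<phi>_def by auto
    then have "AE z in \<mu>. ennreal (norm (T \<phi> z)) * indicator (ball x (32 * R)) z = 0" using T_zero by (auto elim: eventually_mono)
    then have "(\<integral>\<^sup>+z. ennreal (norm (T \<phi> z)) * indicator (ball x (32 * R)) z \<partial>\<mu>) = (\<integral>\<^sup>+z. 0 \<partial>\<mu>)" by (rule nn_integral_cong_AE)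
    then show ?thesis by simp
  next
    case False
    \<comment> \<open>This scale balances the two terms: \<open>\<phi>\<close> has size
      \<open>s\<close> on a set of measure at most \<open>m x R\<close>, so
      \<open>s powr (1 - p)\<close> times the integral of its \<open>p\<close>-th power is at most
      \<open>s * m x R\<close>, which the choice of \<open>\<alpha>\<close> bounds by
      \<open>2 * nb\<close>.\<close>
    define s where "s = norm \<alpha>"
    have s: "s > 0" unfolding s_def using False by simp
    have "(\<integral>\<^sup>+z. ennreal (norm (T \<phi> z)) * indicator (ball x (32 * R)) z \<partial>\<mu>)
      \<le> (\<integral>\<^sup>+z. ennreal s * indicator (ball x (32 * R)) z + ennreal (s powr (1 - p)) * ennreal (norm (T \<phi> z) powr p) \<partial>\<mu>)"
    proof (rule nn_integral_mono)
      fix z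
      show "ennreal (norm (T \<phi> z)) * indicator (ball x (32 * R)) z \<le>
        ennreal s * indicator (ball x (32 * R)) z + ennreal (s powr (1 - p)) * ennreal (norm (T \<phi> z) powr p)"
      proof (cases "z \<in> ball x (32 * R)")
        case True
        have "ennreal (norm (T \<phi> z)) \<le> ennreal (s + s powr (1 - p) * norm (T \<phi> z) powr p)"
          using s p by (intro ennreal_leI le_scale_plus_powr) auto
        also have "\<dots> = ennreal s + ennreal (s powr (1 - p)) * ennreal (norm (T \<phi> z) powr p)"
          using s by (simp add: ennreal_plus ennreal_mult)
        finally show ?thesis using True by simp
      qed auto
    qed
    also have "\<dots> = ennreal s * emeasure \<mu> (ball x (32 * R)) + ennreal (s powr (1 - p)) * (\<integral>\<^sup>+z. ennreal (norm (T \<phi> z) powr p) \<partial>\<mu>)"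
      by (subst nn_integral_add) (auto simp: nn_integral_cmult)
    also have "\<dots> \<le> ennreal s * ennreal (\<beta> * m x R) + ennreal (s powr (1 - p)) * ennreal (C * (s powr p * m x R))"
    proof (intro add_mono mult_left_mono)
      have "m x (32 * R) \<le> m x (1024 * R)" using R by (intro m_mono) auto
      also have "\<dots> \<le> \<beta> * m x R" using n(2) unfolding R32 R_def[symmetric] .
      finally show "emeasure \<mu> (ball x (32 * R)) \<le> ennreal (\<beta> * m x R)" by (simp add: emeasure_ball ennreal_leI)
      have "(LINT y|\<mu>. norm (\<phi> y) powr p) = (LINT y|\<mu>. s powr p * indicator A y)"
        unfolding \<phi>_def s_def using p by (intro Bochner_Integration.integral_cong) (auto simp: indicator_def)
      also have "\<dots> = s powr p * measure \<mu> A" using A(1) by simp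
      also have "\<dots> \<le> s powr p * m x R"
        unfolding R_def using A by (intro mult_left_mono measure_mono_fmeasurable) auto
      finally have "C * (LINT y|\<mu>. norm (\<phi> y) powr p) \<le> C * (s powr p * m x R)" using C0 by (intro mult_left_mono) auto
      then show "(\<integral>\<^sup>+z. ennreal (norm (T \<phi> z) powr p) \<partial>\<mu>) \<le> ennreal (C * (s powr p * m x R))"
        by (intro order_trans[OF Lp[OF phi] ennreal_leI])
    qed auto
    also have "\<dots> = ennreal (s * (\<beta> * m x R) + s powr (1 - p) * (C * (s powr p * m x R)))"
      using s beta_pos C0 by (simp add: ennreal_plus ennreal_mult)
    also have "\<dots> \<le> ennreal (2 * (\<beta> + C) * nb)"
    proof (rule ennreal_leI)
      have "s powr (1 - p) * s powr p = s" using s by (simp add: powr_add[symmetric])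
      then have "s * (\<beta> * m x R) + s powr (1 - p) * (C * (s powr p * m x R)) = (\<beta> + C) * (s * m x R)"
        by (simp add: algebra_simps)
      also have "\<dots> \<le> (\<beta> + C) * (2 * nb)" using am2 beta_pos C0 unfolding s_def by (intro mult_left_mono) auto
      also have "\<dots> = 2 * (\<beta> + C) * nb" by simp
      finally show "s * (\<beta> * m x R) + s powr (1 - p) * (C * (s powr p * m x R)) \<le> 2 * (\<beta> + C) * nb" .
    qed
    finally show ?thesis .
  qed
  have "(\<integral>\<^sup>+z. ennreal (norm (T a z)) * indicator (- ball x (32 * r)) z \<partial>\<mu>)
    \<le> (\<integral>\<^sup>+z. ennreal (norm (T a z)) * indicator (- ball x (32 * R)) z +
      (ennreal (norm (T b z)) * indicator (ball x (32 * R) - ball x (32 * r)) z + ennreal (norm (T \<phi> z)) * indicator (ball x (32 * R)) z) \<partial>\<mu>)"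
  proof (rule nn_integral_mono_AE)
    have "AE z in \<mu>. T a z = T b z - T \<phi> z" unfolding a_def[abs_def] by (rule T_diff[OF b(1) phi])
    then show "AE z in \<mu>. ennreal (norm (T a z)) * indicator (- ball x (32 * r)) z \<le>
      ennreal (norm (T a z)) * indicator (- ball x (32 * R)) z +
      (ennreal (norm (T b z)) * indicator (ball x (32 * R) - ball x (32 * r)) z + ennreal (norm (T \<phi> z)) * indicator (ball x (32 * R)) z)"
    proof eventually_elim
      case (elim z)
      show ?case
      proof (cases "z \<in> ball x (32 * R) \<and> z \<notin> ball x (32 * r)")
        case True
        have "ennreal (norm (T a z)) \<le> ennreal (norm (T b z) + norm (T \<phi> z))"
          unfolding elim by (intro ennreal_leI norm_triangle_ineq4)
        also have "\<dots> = ennreal (norm (T b z)) + ennreal (norm (T \<phi> z))" by (simp add: ennreal_plus)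
        finally show ?thesis using True by (simp add: indicator_def)
      next
        case False
        then show ?thesis by (auto simp: indicator_def)
      qed
    qed
  qed
  also have "\<dots> = (\<integral>\<^sup>+z. ennreal (norm (T a z)) * indicator (- ball x (32 * R)) z \<partial>\<mu>) +
      ((\<integral>\<^sup>+z. ennreal (norm (T b z)) * indicator (ball x (32 * R) - ball x (32 * r)) z \<partial>\<mu>) +
       (\<integral>\<^sup>+z. ennreal (norm (T \<phi> z)) * indicator (ball x (32 * R)) z \<partial>\<mu>))"
    by (simp add: nn_integral_add)
  also have "\<dots> \<le> ennreal (2 * \<kappa> * L / (1 - \<theta>) * nb) + (ennreal (5 * \<kappa> * L ^ 4 * nb) + ennreal (2 * (\<beta> + C) * nb))"
    by (intro add_mono far mid loc)
  also have "\<dots> = ennreal (2 * \<kappa> * L / (1 - \<theta>) * nb + (5 * \<kappa> * L ^ 4 * nb + 2 * (\<beta> + C) * nb))"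
    using kappa_pos L_ge1 th nb0 beta_pos C0 by (simp add: ennreal_plus)
  also have "2 * \<kappa> * L / (1 - \<theta>) * nb + (5 * \<kappa> * L ^ 4 * nb + 2 * (\<beta> + C) * nb) =
    (2 * \<kappa> * L / (1 - 32 powr (-\<tau>)) + 5 * \<kappa> * L ^ 4 + 2 * (\<beta> + C)) * (LINT y|\<mu>. norm (b y))"
    unfolding \<theta>_def nb_def by (simp only: distrib_right add.assoc)
  finally show ?thesis unfolding a_def \<phi>_def .
qed

end

lemma powr_add_le:
  fixes a b p :: real
  assumes "a \<ge> 0" "b \<ge> 0" "p > 0"
  shows "(a + b) powr p \<le> 2 powr p * (a powr p + b powr p)"
proof -
  have "(a + b) powr p \<le> (2 * max a b) powr p" using assms by (intro powr_mono2) auto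
  also have "\<dots> = 2 powr p * (max a b) powr p" using assms by (simp add: powr_mult)
  also have "(max a b) powr p \<le> a powr p + b powr p" by (simp add: max_def)
  finally show ?thesis by simp
qed

context doubling_space
begin

lemma emeasure_level_le:
  assumes [measurable]: "g \<in> borel_measurable \<mu>" and g: "\<And>x. g x \<ge> (0::real)" and t: "t > 0"
  shows "emeasure \<mu> {x. g x > t} \<le> ennreal (1 / t) * (\<integral>\<^sup>+x. ennreal (g x) \<partial>\<mu>)"
proof -
  have "{x \<in> space \<mu>. g x > t} \<in> sets \<mu>" by measurable
  then have s: "{x. g x > t} \<in> sets \<mu>" by simp
  have "emeasure \<mu> {x. g x > t} = (\<integral>\<^sup>+x. indicator {x. g x > t} x \<partial>\<mu>)" using s by simp
  also have "\<dots> \<le> (\<integral>\<^sup>+x. ennreal (1 / t) * ennreal (g x) \<partial>\<mu>)"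
  proof (rule nn_integral_mono)
    fix x
    show "indicator {x. g x > t} x \<le> ennreal (1 / t) * ennreal (g x)"
    proof (cases "g x > t")
      case True
      then have "1 \<le> 1 / t * g x" using t by (simp add: field_simps)
      then have "ennreal 1 \<le> ennreal (1 / t * g x)" by (rule ennreal_leI)
      also have "\<dots> = ennreal (1 / t) * ennreal (g x)" using t g by (intro ennreal_mult) auto
      finally show ?thesis using True by simp
    qed simp
  qed
  also have "\<dots> = ennreal (1 / t) * (\<integral>\<^sup>+x. ennreal (g x) \<partial>\<mu>)" by (rule nn_integral_cmult) measurable
  finally show ?thesis .
qed

lemma emeasure_UNIV_le:
  assumes "\<And>y r. m y r \<le> c"
  shows "emeasure \<mu> UNIV \<le> ennreal c"
proof -
  fix x0 :: 'a
  have "(\<Union>n::nat. ball x0 (real n)) = UNIV" using reals_Archimedean2 by auto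
  moreover have "incseq (\<lambda>n::nat. ball x0 (real n))" unfolding incseq_def by auto
  ultimately have "(\<lambda>n::nat. emeasure \<mu> (ball x0 (real n))) \<longlonglongrightarrow> emeasure \<mu> UNIV"
    using Lim_emeasure_incseq[of "\<lambda>n::nat. ball x0 (real n)" \<mu>] by fastforce
  then show ?thesis
    using assms by (intro LIMSEQ_le_const2) (auto simp: emeasure_ball intro!: ennreal_leI)
qed

lemma sum_integral_norm_disjoint:
  fixes f :: "'a \<Rightarrow> complex"
  assumes f: "f \<in> Linf_b \<mu>" and G: "G \<in> sets \<mu>" and "finite S" and Q: "\<And>x. x \<in> S \<Longrightarrow> Q x \<in> sets \<mu>" "disjoint_family_on Q S"
  shows "(\<Sum>x\<in>S. LINT y|\<mu>. norm (f y * indicator (G \<inter> Q x) y)) = (LINT y|\<mu>. norm (f y) * indicator (G \<inter> (\<Union>x\<in>S. Q x)) y)"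
proof -
  have *: "(LINT y|\<mu>. norm (f y * indicator (G \<inter> Q x) y)) = iw (\<lambda>y. norm (f y)) (G \<inter> Q x)" for x
    unfolding iw_def by (intro Bochner_Integration.integral_cong) (auto simp: indicator_def)
  have "disjoint_family_on (\<lambda>x. G \<inter> Q x) S" using Q(2) unfolding disjoint_family_on_def by blast
  then have "(\<Sum>x\<in>S. iw (\<lambda>y. norm (f y)) (G \<inter> Q x)) = iw (\<lambda>y. norm (f y)) (\<Union>x\<in>S. G \<inter> Q x)"
    using Linf_b_integrable_norm[OF f] G Q(1) assms(3) by (intro sum_iw_disjoint) auto
  also have "(\<Union>x\<in>S. G \<inter> Q x) = G \<inter> (\<Union>x\<in>S. Q x)" by blast
  finally show ?thesis unfolding * iw_def .
qed

text \<open>The dilated stopping balls overlap. Assigning each point to the first ball that contains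
  it, in some enumeration of \<open>I\<close>, allows \<open>f\<close> to be cut into disjoint
  pieces without changing the union.\<close>

lemma ex_disjoint_refinement:
  fixes r :: "'a \<Rightarrow> real"
  assumes I: "finite I"
  shows "\<exists>Q. (\<forall>x. Q x \<in> sets \<mu>) \<and> (\<forall>x. Q x \<subseteq> ball x (r x)) \<and> disjoint_family_on Q I \<and>
    (\<Union>x\<in>I. Q x) = (\<Union>x\<in>I. ball x (r x))"
proof -
  obtain e :: "'a \<Rightarrow> nat" where e: "inj_on e I" using finite_imp_inj_to_nat_seg[OF I] by blast
  define Q where "Q x = ball x (r x) - (\<Union>y\<in>{y\<in>I. e y < e x}. ball y (r y))" for x
  show ?thesis
  proof (intro exI[of _ Q] conjI allI)
    show "Q x \<in> sets \<mu>" for x unfolding Q_def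
      by (intro sets.Diff open_in_sets open_UN ballI open_ball)
    show "Q x \<subseteq> ball x (r x)" for x unfolding Q_def by blast
    show "disjoint_family_on Q I"
      unfolding disjoint_family_on_def
    proof (intro ballI impI)
      fix x y assume "x \<in> I" "y \<in> I" "x \<noteq> y"
      then have "e x < e y \<or> e y < e x" using e by (meson inj_onD nat_neq_iff)
      then show "Q x \<inter> Q y = {}" using \<open>x \<in> I\<close> \<open>y \<in> I\<close> unfolding Q_def by blast
    qed
    show "(\<Union>x\<in>I. Q x) = (\<Union>x\<in>I. ball x (r x))"
    proof
      show "(\<Union>x\<in>I. ball x (r x)) \<subseteq> (\<Union>x\<in>I. Q x)"
      proof
        fix z assume "z \<in> (\<Union>x\<in>I. ball x (r x))"
        then obtain x0 where "x0 \<in> I \<and> z \<in> ball x0 (r x0)" by blast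
        from ex_has_least_nat[where m = e, of "\<lambda>x. x \<in> I \<and> z \<in> ball x (r x)", OF this]
        obtain x where x: "x \<in> I" "z \<in> ball x (r x)" "\<And>y. y \<in> I \<Longrightarrow> z \<in> ball y (r y) \<Longrightarrow> e x \<le> e y" by blast
        then have "z \<in> Q x" unfolding Q_def by (auto simp: not_less[symmetric] simp del: mem_ball)
        then show "z \<in> (\<Union>x\<in>I. Q x)" using x(1) by blast
      qed
    qed (auto simp: Q_def)
  qed
qed

end

context CZ_space
begin

section \<open>Estimates of the good and bad parts and the level set bound\<close>

text \<open>The pointwise bound and the integral of \<open>h1\<close> interpolate to a bound for its
  \<open>p\<close>-th power integral by a multiple of \<open>t powr (p - 1) * M1\<close>, the same
  order as assumed for \<open>h2\<close>. Chebyshev's inequality at exponent \<open>p\<close> turns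
  this into \<open>M1 / t\<close>.\<close>

lemma good_part_bound:
  assumes C: "Lp_bd p C" and p: "p > 1" and t: "t > 0" and M1: "M1 \<ge> 0"
    and h1: "h1 \<in> Linf_b \<mu>" "\<And>z. norm (h1 z) \<le> 3 * t" "(LINT z|\<mu>. norm (h1 z)) \<le> 2 * M1"
    and h2: "h2 \<in> Linf_b \<mu>" "(LINT z|\<mu>. norm (h2 z) powr p) \<le> t powr (p - 1) * M1"
  shows "emeasure \<mu> {z. norm (T (\<lambda>y. h1 y + h2 y) z) > t} \<le> ennreal (C * 2 powr p * (2 * 3 powr (p - 1) + 1) * M1 / t)"
proof -
  have C0: "C > 0" using C unfolding Lp_bd_def by blast
  define h where "h y = h1 y + h2 y" for y
  have h: "h \<in> Linf_b \<mu>" unfolding h_def[abs_def] by (rule Linf_b_add[OF h1(1) h2(1)])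
  note ih = Linf_b_powr_integrable[OF _ order_less_trans[OF zero_less_one p]]
  have "(LINT z|\<mu>. norm (h1 z) powr p) \<le> (LINT z|\<mu>. (3 * t) powr (p - 1) * norm (h1 z))"
  proof (intro integral_mono ih h1 integrable_mult_right Linf_b_integrable_norm)
    fix z
    have "norm (h1 z) powr p = norm (h1 z) powr (p - 1) * norm (h1 z)"
      using p by (cases "h1 z = 0") (auto simp: powr_diff)
    also have "\<dots> \<le> (3 * t) powr (p - 1) * norm (h1 z)" using p h1(2)[of z] by (intro mult_right_mono powr_mono2) auto
    finally show "norm (h1 z) powr p \<le> (3 * t) powr (p - 1) * norm (h1 z)" .
  qed
  also have "\<dots> \<le> (3 * t) powr (p - 1) * (2 * M1)" using h1(3) by (simp add: mult_left_mono)
  finally have i1: "(LINT z|\<mu>. norm (h1 z) powr p) \<le> (3 * t) powr (p - 1) * (2 * M1)" .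
  have "(LINT z|\<mu>. norm (h z) powr p) \<le> (LINT z|\<mu>. 2 powr p * (norm (h1 z) powr p + norm (h2 z) powr p))"
  proof (intro integral_mono ih h integrable_mult_right Bochner_Integration.integrable_add h1(1) h2(1))
    fix z
    have "norm (h z) powr p \<le> (norm (h1 z) + norm (h2 z)) powr p"
      unfolding h_def using p by (intro powr_mono2 norm_triangle_ineq) auto
    also have "\<dots> \<le> 2 powr p * (norm (h1 z) powr p + norm (h2 z) powr p)" using p by (intro powr_add_le) auto
    finally show "norm (h z) powr p \<le> 2 powr p * (norm (h1 z) powr p + norm (h2 z) powr p)" .
  qed
  also have "\<dots> = 2 powr p * ((LINT z|\<mu>. norm (h1 z) powr p) + (LINT z|\<mu>. norm (h2 z) powr p))"
    using ih[OF h1(1)] ih[OF h2(1)] by simp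
  also have "\<dots> \<le> 2 powr p * ((3 * t) powr (p - 1) * (2 * M1) + t powr (p - 1) * M1)"
    by (intro mult_left_mono add_mono i1 h2(2)) auto
  also have "\<dots> = 2 powr p * (2 * 3 powr (p - 1) + 1) * M1 * t powr (p - 1)"
    using t by (simp add: powr_mult algebra_simps)
  finally have ib: "(LINT z|\<mu>. norm (h z) powr p) \<le> 2 powr p * (2 * 3 powr (p - 1) + 1) * M1 * t powr (p - 1)" .
  note [measurable] = T_measurable[OF h]
  have "{z. norm (T h z) > t} \<subseteq> {z. norm (T h z) powr p > t powr p}"
    using t p by (auto intro!: powr_less_mono2)
  moreover have "{z \<in> space \<mu>. norm (T h z) powr p > t powr p} \<in> sets \<mu>" by measurable
  ultimately have "emeasure \<mu> {z. norm (T h z) > t} \<le> emeasure \<mu> {z. norm (T h z) powr p > t powr p}"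
    by (intro emeasure_mono) auto
  also have "\<dots> \<le> ennreal (1 / t powr p) * (\<integral>\<^sup>+z. ennreal (norm (T h z) powr p) \<partial>\<mu>)"
    using t by (intro emeasure_level_le) auto
  also have "\<dots> \<le> ennreal (1 / t powr p) * ennreal (C * (LINT z|\<mu>. norm (h z) powr p))"
    using C h unfolding Lp_bd_def by (intro mult_left_mono) auto
  also have "\<dots> \<le> ennreal (1 / t powr p) * ennreal (C * (2 powr p * (2 * 3 powr (p - 1) + 1) * M1 * t powr (p - 1)))"
    using ib C0 by (intro mult_left_mono ennreal_leI) auto
  also have "\<dots> = ennreal (1 / t powr p * (C * (2 powr p * (2 * 3 powr (p - 1) + 1) * M1 * t powr (p - 1))))"
    using C0 M1 by (intro ennreal_mult[symmetric]) auto
  also have "1 / t powr p * (C * (2 powr p * (2 * 3 powr (p - 1) + 1) * M1 * t powr (p - 1))) =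
    C * 2 powr p * (2 * 3 powr (p - 1) + 1) * M1 / t"
    using t by (simp add: powr_diff)
  finally show ?thesis unfolding h_def .
qed

text \<open>The sets \<open>D i\<close> are given away at the cost of their measure; off their union
  Chebyshev's inequality at exponent 1 applies to the sum.\<close>

lemma bad_sum_bound:
  fixes a :: "'i \<Rightarrow> 'a \<Rightarrow> complex"
  assumes I: "finite I" and a: "\<And>i. i \<in> I \<Longrightarrow> a i \<in> Linf_b \<mu>" and D: "\<And>i. i \<in> I \<Longrightarrow> D i \<in> sets \<mu>"
    and bd: "\<And>i. i \<in> I \<Longrightarrow> (\<integral>\<^sup>+z. ennreal (norm (T (a i) z)) * indicator (- D i) z \<partial>\<mu>) \<le> ennreal (c i)"
    and c: "\<And>i. i \<in> I \<Longrightarrow> c i \<ge> 0" and t: "t > 0"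
  shows "emeasure \<mu> {z. norm (\<Sum>i\<in>I. T (a i) z) > t} \<le> (\<Sum>i\<in>I. emeasure \<mu> (D i)) + ennreal ((\<Sum>i\<in>I. c i) / t)"
proof -
  define DD where "DD = (\<Union>i\<in>I. D i)"
  have DDm[measurable]: "DD \<in> sets \<mu>" unfolding DD_def using I D by auto
  have Tm[measurable]: "T (a i) \<in> borel_measurable \<mu>" if "i \<in> I" for i using T_measurable[OF a[OF that]] .
  define g where "g z = norm (\<Sum>i\<in>I. T (a i) z) * indicator (- DD) z" for z
  have sm[measurable]: "(\<lambda>z. \<Sum>i\<in>I. T (a i) z) \<in> borel_measurable \<mu>" by (intro borel_measurable_sum Tm)
  have nDD: "- DD \<in> sets \<mu>" using sets.compl_sets[OF DDm] by (simp add: Compl_eq_Diff_UNIV)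
  have gm[measurable]: "g \<in> borel_measurable \<mu>" unfolding g_def using nDD by measurable
  have "{z \<in> space \<mu>. g z > t} \<in> sets \<mu>" by measurable
  then have gs: "{z. g z > t} \<in> sets \<mu>" by simp
  have "{z. norm (\<Sum>i\<in>I. T (a i) z) > t} \<subseteq> DD \<union> {z. g z > t}" unfolding g_def by (auto simp: indicator_def)
  then have "emeasure \<mu> {z. norm (\<Sum>i\<in>I. T (a i) z) > t} \<le> emeasure \<mu> (DD \<union> {z. g z > t})"
    using gs DDm by (intro emeasure_mono) auto
  also have "\<dots> \<le> emeasure \<mu> DD + emeasure \<mu> {z. g z > t}" using gs DDm by (intro emeasure_subadditive)
  also have "emeasure \<mu> DD \<le> (\<Sum>i\<in>I. emeasure \<mu> (D i))" unfolding DD_def using I D by (intro emeasure_subadditive_finite) auto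
  also have "emeasure \<mu> {z. g z > t} \<le> ennreal (1 / t) * (\<integral>\<^sup>+z. ennreal (g z) \<partial>\<mu>)"
    using t by (intro emeasure_level_le) (auto simp: g_def)
  also have "(\<integral>\<^sup>+z. ennreal (g z) \<partial>\<mu>) \<le> (\<integral>\<^sup>+z. (\<Sum>i\<in>I. ennreal (norm (T (a i) z)) * indicator (- D i) z) \<partial>\<mu>)"
  proof (rule nn_integral_mono)
    fix z
    show "ennreal (g z) \<le> (\<Sum>i\<in>I. ennreal (norm (T (a i) z)) * indicator (- D i) z)"
    proof (cases "z \<in> DD")
      case False
      have "ennreal (g z) \<le> ennreal (\<Sum>i\<in>I. norm (T (a i) z))"
        unfolding g_def using False by (auto intro!: ennreal_leI norm_sum)
      also have "\<dots> = (\<Sum>i\<in>I. ennreal (norm (T (a i) z)))" by (simp add: sum_ennreal)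
      also have "\<dots> = (\<Sum>i\<in>I. ennreal (norm (T (a i) z)) * indicator (- D i) z)"
        using False unfolding DD_def by (intro sum.cong) auto
      finally show ?thesis .
    qed (simp add: g_def)
  qed
  also have "\<dots> = (\<Sum>i\<in>I. \<integral>\<^sup>+z. ennreal (norm (T (a i) z)) * indicator (- D i) z \<partial>\<mu>)"
  proof (rule nn_integral_sum)
    fix i assume i: "i \<in> I"
    have "- D i \<in> sets \<mu>" using sets.compl_sets[OF D[OF i]] by (simp add: Compl_eq_Diff_UNIV)
    then show "(\<lambda>z. ennreal (norm (T (a i) z)) * indicator (- D i) z) \<in> borel_measurable \<mu>" using Tm[OF i] by measurable
  qed
  also have "\<dots> \<le> (\<Sum>i\<in>I. ennreal (c i))" by (intro sum_mono bd)
  also have "\<dots> = ennreal (\<Sum>i\<in>I. c i)" using c by (rule sum_ennreal)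
  also have "ennreal (1 / t) * ennreal (\<Sum>i\<in>I. c i) = ennreal ((\<Sum>i\<in>I. c i) / t)"
    using t c by (subst ennreal_mult[symmetric]) (auto intro: sum_nonneg)
  finally show ?thesis by (simp add: add_left_mono add_right_mono mult_left_mono)
qed

text \<open>The three summands of the constant belong to the good part, the exceptional set and the
  bad part; the level \<open>2 * t\<close> is shared equally between good and bad. The weight has
  integral at most \<open>3 * M1 / t\<close>, one unit from \<open>f\<close> on \<open>G\<close> and
  two from \<open>U\<close>, and the factor \<open>4 * \<beta>\<close> of the stopping balls makes
  this \<open>12 * \<beta>\<close>.\<close>

lemma CZ_level_estimate:
  assumes C: "Lp_bd p C" and p: "p > 1" and f: "f \<in> Linf_b \<mu>" and t: "t > 0"
  defines "M1 \<equiv> (LINT z|\<mu>. norm (f z))"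
  shows "emeasure \<mu> {z. norm (T f z) > 2 * t} \<le>
    ennreal ((C * 2 powr p * (2 * 3 powr (p - 1) + 1) + 12 * \<beta> +
      (2 * \<kappa> * L / (1 - 32 powr (-\<tau>)) + 5 * \<kappa> * L ^ 4 + 2 * (\<beta> + C))) * M1 / t)"
proof -
  have C0: "C > 0" using C unfolding Lp_bd_def by blast
  define D1 where "D1 = C * 2 powr p * (2 * 3 powr (p - 1) + 1)"
  define D2 where "D2 = 2 * \<kappa> * L / (1 - 32 powr (-\<tau>)) + 5 * \<kappa> * L ^ 4 + 2 * (\<beta> + C)"
  have th: "32 powr (-\<tau>) < (1::real)" using tau_pos powr_less_mono[of "-\<tau>" 0 32] by auto
  have D1: "D1 \<ge> 0" unfolding D1_def using C0 by simp
  have D2: "D2 \<ge> 0" unfolding D2_def using kappa_pos L_ge1 th beta_pos C0 by simp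
  have M0: "M1 \<ge> 0" unfolding M1_def by (rule Bochner_Integration.integral_nonneg) auto
  note fm[measurable] = Linf_b_measurable[OF f]
  have fi: "integrable \<mu> (\<lambda>z. norm (f z))" by (rule Linf_b_integrable_norm[OF f])
  let ?goal = "emeasure \<mu> {z. norm (T f z) > 2 * t} \<le> ennreal ((D1 + 12 * \<beta> + D2) * M1 / t)"
  have ?goal
  \<comment> \<open>\<open>M1\<close> enters the error of the outer regularity and the tolerance
    \<open>\<delta>\<close>, which both have to be positive.\<close>
  proof (cases "M1 = 0")
    case True
    have "AE z in \<mu>. norm (f z) = 0"
      using integral_nonneg_eq_0_iff_AE[OF fi] True unfolding M1_def by simp
    then have "AE z in \<mu>. T f z = T (\<lambda>y. 0) z" by (intro T_cong f Linf_b_zero) auto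
    with T_zero have "AE z in \<mu>. z \<in> {z. norm (T f z) > 2 * t} \<longrightarrow> z \<in> {}"
    proof eventually_elim
      case (elim z)
      then show ?case using t by simp
    qed
    then have "emeasure \<mu> {z. norm (T f z) > 2 * t} \<le> emeasure \<mu> {}" by (rule emeasure_mono_AE) simp
    then show ?thesis by simp
  next
    case False
    with M0 have M1: "M1 > 0" by simp
    define G where "G = {z. norm (f z) > t}"
    have "{z \<in> space \<mu>. norm (f z) > t} \<in> sets \<mu>" by measurable
    then have Gm: "G \<in> sets \<mu>" unfolding G_def by simp
    have "emeasure \<mu> G \<le> ennreal (1 / t) * (\<integral>\<^sup>+z. ennreal (norm (f z)) \<partial>\<mu>)"
      unfolding G_def using t by (intro emeasure_level_le) auto
    also have "\<dots> = ennreal (1 / t) * ennreal M1" using nn_integral_norm_Linf_b[OF f] unfolding M1_def by simp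
    also have "\<dots> = ennreal (M1 / t)" using t M1 by (subst ennreal_mult[symmetric]) auto
    finally have Ge: "emeasure \<mu> G \<le> ennreal (M1 / t)" .
    then have Gfin: "emeasure \<mu> G < \<infinity>" by (simp add: le_less_trans)
    have Mt: "M1 / t > 0" using M1 t by simp
    obtain U where U: "open U" "G \<subseteq> U" "emeasure \<mu> (U - G) \<le> ennreal (M1 / t)"
      by (rule locally_finite_outer_regular[OF sets_mu emeasure_ball_finite Gm Mt])
    have Um: "U \<in> sets \<mu>" using U(1) by auto
    have "emeasure \<mu> U \<le> emeasure \<mu> G + emeasure \<mu> (U - G)"
      using emeasure_subadditive[of G \<mu> "U - G"] Gm Um U(2) by (simp add: Un_absorb1)
    also have "\<dots> \<le> ennreal (M1 / t) + ennreal (M1 / t)" by (intro add_mono U(3) Ge)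
    also have "\<dots> = ennreal (2 * M1 / t)" using Mt by (subst ennreal_plus[symmetric]) auto
    finally have Ue: "emeasure \<mu> U \<le> ennreal (2 * M1 / t)" .
    then have Ufin: "emeasure \<mu> U < \<infinity>" by (simp add: le_less_trans)
    have mU: "measure \<mu> U \<le> 2 * M1 / t"
    proof -
      have "emeasure \<mu> U = ennreal (measure \<mu> U)" using Ufin by (intro emeasure_eq_ennreal_measure) auto
      with Ue have "ennreal (measure \<mu> U) \<le> ennreal (2 * M1 / t)" by simp
      then show ?thesis using M1 t by (subst (asm) ennreal_le_iff) auto
    qed
    \<comment> \<open>As \<open>w \<ge> 1\<close> on the open set \<open>U\<close>, small doubling balls at points of \<open>U\<close> satisfy the stopping condition.\<close>
    define w where "w z = norm (f z) * indicator G z / t + indicator U z" for z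
    have gi: "integrable \<mu> (\<lambda>z. norm (f z) * indicator G z / t)"
      by (intro integrable_divide_zero integrable_real_mult_indicator Gm fi)
    have ui: "integrable \<mu> (indicator U :: 'a \<Rightarrow> real)" using Um Ufin by (intro integrable_real_indicator)
    have wi: "integrable \<mu> w" unfolding w_def by (intro Bochner_Integration.integrable_add gi ui)
    have w0: "w z \<ge> 0" for z unfolding w_def using t by simp
    have w1: "w z \<ge> 1" if "z \<in> U" for z unfolding w_def using t that by simp
    have Ww: "(LINT z|\<mu>. w z) \<le> 3 * M1 / t"
    proof -
      have "(LINT z|\<mu>. w z) = (LINT z|\<mu>. norm (f z) * indicator G z / t) + measure \<mu> U"
        unfolding w_def using gi ui by simp
      also have "(LINT z|\<mu>. norm (f z) * indicator G z / t) \<le> (LINT z|\<mu>. norm (f z) / t)"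
        using t by (intro integral_mono gi) (auto intro!: fi divide_right_mono simp: indicator_def)
      also have "\<dots> = M1 / t" unfolding M1_def by simp
      finally have "(LINT z|\<mu>. w z) \<le> M1 / t + measure \<mu> U" by simp
      also have "\<dots> \<le> M1 / t + 2 * M1 / t" using mU by simp
      finally show ?thesis by (simp add: add_divide_distrib[symmetric])
    qed
    show ?thesis
    proof (cases "\<exists>y R. (LINT z|\<mu>. w z) < m y R / (4 * \<beta>)")
      \<comment> \<open>The whole space is an admissible exceptional set.\<close>
      case False
      have "m y R \<le> 12 * \<beta> * M1 / t" for y R
      proof -
        have "m y R / (4 * \<beta>) \<le> 3 * M1 / t" using False Ww by (meson not_less order_trans)
        then show ?thesis using beta_pos t by (simp add: field_simps)
      qed
      then have "emeasure \<mu> UNIV \<le> ennreal (12 * \<beta> * M1 / t)" by (rule emeasure_UNIV_le)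
      moreover have "UNIV \<in> sets \<mu>" using sets.top[of \<mu>] by simp
      then have "emeasure \<mu> {z. norm (T f z) > 2 * t} \<le> emeasure \<mu> UNIV" by (intro emeasure_mono) auto
      moreover have "ennreal (12 * \<beta> * M1 / t) \<le> ennreal ((D1 + 12 * \<beta> + D2) * M1 / t)"
        using D1 D2 M1 t beta_pos by (intro ennreal_leI divide_right_mono mult_right_mono) auto
      ultimately show ?thesis by (meson order_trans)
    next
      case True
      then obtain y0 R0 where big: "(LINT z|\<mu>. w z) < m y0 R0 / (4 * \<beta>)" by blast
      obtain B R1 where B: "B > 0" and "R1 > 0" and fB: "AE z in \<mu>. norm (f z) \<le> B" and "AE z in \<mu>. z \<notin> ball y0 R1 \<longrightarrow> f z = 0"
        by (rule Linf_bE[OF f])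
      \<comment> \<open>On the uncovered part of \<open>G\<close> only
        \<open>norm (f z) \<le> B\<close> is available. With this tolerance its \<open>p\<close>-th
        power integral is at most \<open>t powr (p - 1) * M1\<close>, so it can join the good
        part.\<close>
      define \<delta> where "\<delta> = t powr (p - 1) * M1 / B powr p"
      have \<delta>: "\<delta> > 0" unfolding \<delta>_def using t M1 B by simp
      obtain I r where I: "finite I" and tm: "\<And>x. x \<in> I \<Longrightarrow> tame x" and r: "\<And>x. x \<in> I \<Longrightarrow> r x > 0"
        and "disjoint_family_on (\<lambda>x. ball x (r x)) I"
        and rest: "emeasure \<mu> (G - (\<Union>x\<in>I. ball x (3 * r x))) < ennreal \<delta>"
        and sm: "(\<Sum>x\<in>I. m x (32 * r x)) \<le> 4 * \<beta> * (LINT z|\<mu>. w z)"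
        and stop: "\<And>x i. x \<in> I \<Longrightarrow> i \<ge> 1 \<Longrightarrow> iw w (ball x (32 ^ i * r x)) \<le> m x (32 ^ (i + 1) * r x) / (4 * \<beta>)"
        by (rule stopping_balls[OF wi w0 w1 U(1) Gm U(2) Gfin \<delta> big]) auto
      have "\<forall>x\<in>I. \<exists>n. n \<ge> 1 \<and> m x (32 ^ (n + 2) * r x) \<le> \<beta> * m x (32 ^ n * r x) \<and>
        (\<Sum>j\<le>n. m x (32 ^ (j + 2) * r x) / \<Lambda> x (32 ^ j * r x)) \<le> 5 * L\<^sup>2"
      proof
        fix x assume x: "x \<in> I"
        have "m x (r x) > 0" using tm[OF x] r[OF x] unfolding tame_def by blast
        then obtain k where k: "k \<ge> 1" "m x (32 ^ (k + 2) * r x) \<le> \<beta> * m x (32 ^ k * r x)"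
          "(\<Sum>j\<le>k. m x (32 ^ (j + 2) * r x) / \<Lambda> x (32 ^ j * r x)) \<le> 5 * L\<^sup>2"
          by (rule next_doubling[OF r[OF x]])
        show "\<exists>n. n \<ge> 1 \<and> m x (32 ^ (n + 2) * r x) \<le> \<beta> * m x (32 ^ n * r x) \<and>
          (\<Sum>j\<le>n. m x (32 ^ (j + 2) * r x) / \<Lambda> x (32 ^ j * r x)) \<le> 5 * L\<^sup>2"
          by (intro exI[of _ k] conjI k)
      qed
      from bchoice[OF this] obtain n where n: "\<And>x. x \<in> I \<Longrightarrow> n x \<ge> 1"
        "\<And>x. x \<in> I \<Longrightarrow> m x (32 ^ (n x + 2) * r x) \<le> \<beta> * m x (32 ^ n x * r x)"
        "\<And>x. x \<in> I \<Longrightarrow> (\<Sum>j\<le>n x. m x (32 ^ (j + 2) * r x) / \<Lambda> x (32 ^ j * r x)) \<le> 5 * L\<^sup>2" by auto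
      define \<rho> where "\<rho> x = 32 ^ n x * r x" for x
      have \<rho>r: "\<rho> x \<ge> 32 * r x" if "x \<in> I" for x
      proof -
        have "(32::real) ^ 1 \<le> 32 ^ n x" using n(1)[OF that] by (intro power_increasing) auto
        then show ?thesis unfolding \<rho>_def using r[OF that] by simp
      qed
      have \<rho>: "\<rho> x > 0" if "x \<in> I" for x using \<rho>r[OF that] r[OF that] by linarith
      have mpos: "m x (\<rho> x) > 0" if "x \<in> I" for x using tm[OF that] \<rho>[OF that] unfolding tame_def by blast
      obtain Q :: "'a \<Rightarrow> 'a set" where "\<forall>x. Q x \<in> sets \<mu>" "\<forall>x. Q x \<subseteq> ball x (3 * r x)"
        and Q3: "disjoint_family_on Q I" and Q4: "(\<Union>x\<in>I. Q x) = (\<Union>x\<in>I. ball x (3 * r x))"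
        using ex_disjoint_refinement[OF I, of "\<lambda>x. 3 * r x"] by (elim exE conjE) (rule that)
      then have Q: "\<And>x. Q x \<in> sets \<mu>" "\<And>x. Q x \<subseteq> ball x (3 * r x)" by auto
      define V where "V = (\<Union>x\<in>I. Q x)"
      have Vm: "V \<in> sets \<mu>" unfolding V_def using I Q(1) by auto
      \<comment> \<open>Only the large values of \<open>f\<close> require cancellation; off
        \<open>G\<close> the function is bounded by \<open>t\<close> and goes to the good
        part.\<close>
      define b where "b x z = f z * indicator (G \<inter> Q x) z" for x z
      have bl: "b x \<in> Linf_b \<mu>" for x unfolding b_def[abs_def] by (intro Linf_b_restrict f sets.Int Gm Q(1))
      define M where "M x = (LINT z|\<mu>. b x z)" for x
      have Mb: "norm (M x) \<le> (LINT z|\<mu>. norm (b x z))" for x unfolding M_def by (rule integral_norm_bound)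
      have sumb: "(\<Sum>x\<in>S. LINT z|\<mu>. norm (b x z)) = (LINT z|\<mu>. norm (f z) * indicator (G \<inter> (\<Union>x\<in>S. Q x)) z)"
        if "S \<subseteq> I" for S
        unfolding b_def using that I Q3
        by (intro sum_integral_norm_disjoint f Gm Q(1)) (auto simp: finite_subset disjoint_family_on_def)
      have sumbI: "(\<Sum>x\<in>I. LINT z|\<mu>. norm (b x z)) \<le> M1"
        unfolding sumb[OF order_refl] M1_def
        by (intro integral_mono integrable_real_mult_indicator fi sets.Int Gm) (use Vm in \<open>auto simp: V_def indicator_def\<close>)
      \<comment> \<open>The hypothesis of \<open>ex_balancing\<close>. A ball that meets the
        \<open>k\<close>-th one and is no larger has its piece inside
        \<open>ball k (32 * \<rho> k)\<close>; there the stopping inequality, read one scale above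
        the doubling ball, bounds the mass of \<open>w\<close> by a quarter of
        \<open>m k (\<rho> k)\<close>.\<close>
      have pack: "(\<Sum>x\<in>{x\<in>I. \<rho> x \<le> \<rho> k \<and> ball x (\<rho> x) \<inter> ball k (\<rho> k) \<noteq> {}}. norm (M x)) \<le> t * m k (\<rho> k) / 2"
        if k: "k \<in> I" for k
      proof -
        let ?S = "{x\<in>I. \<rho> x \<le> \<rho> k \<and> ball x (\<rho> x) \<inter> ball k (\<rho> k) \<noteq> {}}"
        have sub: "Q x \<subseteq> ball k (32 * \<rho> k)" if x: "x \<in> ?S" for x
        proof -
          from x obtain z where z: "z \<in> ball x (\<rho> x)" "z \<in> ball k (\<rho> k)" by blast
          have "dist k x \<le> dist k z + dist z x" by (rule dist_triangle)
          also have "\<dots> < \<rho> k + \<rho> x" using z by (simp add: dist_commute)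
          finally have "dist k x + 3 * r x \<le> 32 * \<rho> k" using x \<rho>r[of x] r[of x] by auto
          from ball_subset_shift[OF this] show ?thesis using Q(2)[of x] by blast
        qed
        have "(\<Sum>x\<in>?S. norm (M x)) \<le> (\<Sum>x\<in>?S. LINT z|\<mu>. norm (b x z))" by (intro sum_mono Mb)
        also have "\<dots> = (LINT z|\<mu>. norm (f z) * indicator (G \<inter> (\<Union>x\<in>?S. Q x)) z)" by (rule sumb) auto
        also have "\<dots> \<le> (LINT z|\<mu>. t * (w z * indicator (ball k (32 * \<rho> k)) z))"
        proof (intro integral_mono integrable_real_mult_indicator fi integrable_mult_right wi sets.Int Gm sets.finite_UN Q(1) ball_in_sets)
          show "finite ?S" using I by simp
          fix z
          show "norm (f z) * indicator (G \<inter> (\<Union>x\<in>?S. Q x)) z \<le> t * (w z * indicator (ball k (32 * \<rho> k)) z)"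
          proof (cases "z \<in> G \<inter> (\<Union>x\<in>?S. Q x)")
            case True
            then have zb: "z \<in> ball k (32 * \<rho> k)" using sub by blast
            \<comment> \<open>On \<open>G\<close> the first summand of \<open>w\<close> is
              \<open>norm (f z) / t\<close>.\<close>
            have "norm (f z) \<le> t * w z" unfolding w_def using True t by (simp add: distrib_left)
            then show ?thesis using True zb by simp
          next
            case False
            then show ?thesis using t w0[of z] by simp
          qed
        qed
        also have "\<dots> = t * iw w (ball k (32 * \<rho> k))" unfolding iw_def by simp
        also have "\<dots> \<le> t * (m k (\<rho> k) / 4)"
        proof (rule mult_left_mono)
          have "iw w (ball k (32 * \<rho> k)) = iw w (ball k (32 ^ (n k + 1) * r k))" by (simp add: \<rho>_def mult.assoc)
          also have "\<dots> \<le> m k (32 ^ (n k + 1 + 1) * r k) / (4 * \<beta>)" by (rule stop[OF k]) simp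
          also have "\<dots> \<le> \<beta> * m k (\<rho> k) / (4 * \<beta>)"
            using n(2)[OF k] beta_pos unfolding \<rho>_def by (intro divide_right_mono) auto
          also have "\<dots> = m k (\<rho> k) / 4" using beta_pos by simp
          finally show "iw w (ball k (32 * \<rho> k)) \<le> m k (\<rho> k) / 4" .
        qed (use t in simp)
        also have "\<dots> \<le> t * m k (\<rho> k) / 2" using t mpos[OF k] by simp
        finally show ?thesis .
      qed
      have "\<exists>(\<alpha> :: 'a \<Rightarrow> complex) A. (\<forall>x\<in>I. A x \<in> sets \<mu> \<and> A x \<subseteq> ball x (\<rho> x) \<and> \<alpha> x * measure \<mu> (A x) = M x
          \<and> norm (\<alpha> x) * m x (\<rho> x) \<le> 2 * norm (M x))
        \<and> (\<forall>z. (\<Sum>x\<in>I. norm (\<alpha> x) * indicator (A x) z) \<le> 2 * t)"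
        by (rule ex_balancing[where x = "\<lambda>x. x", OF I t mpos pack])
      then obtain \<alpha> :: "'a \<Rightarrow> complex" and A where
        "\<forall>x\<in>I. A x \<in> sets \<mu> \<and> A x \<subseteq> ball x (\<rho> x) \<and> \<alpha> x * measure \<mu> (A x) = M x
          \<and> norm (\<alpha> x) * m x (\<rho> x) \<le> 2 * norm (M x)"
        and \<alpha>sum': "\<forall>z. (\<Sum>x\<in>I. norm (\<alpha> x) * indicator (A x) z) \<le> 2 * t"
        by (elim exE conjE) (rule that)
      then have A: "\<And>x. x \<in> I \<Longrightarrow> A x \<in> sets \<mu>" "\<And>x. x \<in> I \<Longrightarrow> A x \<subseteq> ball x (\<rho> x)"
        and \<alpha>: "\<And>x. x \<in> I \<Longrightarrow> \<alpha> x * measure \<mu> (A x) = M x"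
          "\<And>x. x \<in> I \<Longrightarrow> norm (\<alpha> x) * m x (\<rho> x) \<le> 2 * norm (M x)" by auto
      have \<alpha>sum: "(\<Sum>x\<in>I. norm (\<alpha> x) * indicator (A x) z) \<le> 2 * t" for z using \<alpha>sum' by blast
      define \<phi> where "\<phi> x z = \<alpha> x * indicator (A x) z" for x z
      have \<phi>l: "\<phi> x \<in> Linf_b \<mu>" if "x \<in> I" for x
        unfolding \<phi>_def[abs_def] by (rule Linf_b_indicator[OF A(1)[OF that] A(2)[OF that]])
      define a where "a x z = b x z - \<phi> x z" for x z
      have al: "a x \<in> Linf_b \<mu>" if "x \<in> I" for x unfolding a_def[abs_def] by (intro Linf_b_diff bl \<phi>l that)
      \<comment> \<open>The functions \<open>\<phi> x\<close> subtracted from the pieces of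
        \<open>f\<close> are added back here. The bound \<open>3 * t\<close> arises as
        \<open>t\<close> for \<open>f\<close> off \<open>G\<close> plus \<open>2 * t\<close> from
        balancing.\<close>
      define h1 where "h1 z = f z * indicator (- G) z + (\<Sum>x\<in>I. \<phi> x z)" for z
      define h2 where "h2 z = f z * indicator (G - V) z" for z
      have Gc: "- G \<in> sets \<mu>" using sets.compl_sets[OF Gm] by (simp add: Compl_eq_Diff_UNIV)
      have h1l: "h1 \<in> Linf_b \<mu>" unfolding h1_def[abs_def] by (intro Linf_b_add Linf_b_restrict f Gc Linf_b_sum I \<phi>l)
      have h2l: "h2 \<in> Linf_b \<mu>" unfolding h2_def[abs_def] by (intro Linf_b_restrict f sets.Diff Gm Vm)
      have nphi: "norm (\<Sum>x\<in>I. \<phi> x z) \<le> (\<Sum>x\<in>I. norm (\<alpha> x) * indicator (A x) z)" for z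
        unfolding \<phi>_def by (rule order_trans[OF norm_sum]) (auto intro!: sum_mono simp: norm_mult indicator_def)
      have h1b: "norm (h1 z) \<le> 3 * t" for z
      proof -
        have "norm (f z * indicator (- G) z) \<le> t" unfolding G_def using t by (auto simp: indicator_def)
        then show ?thesis unfolding h1_def
          using norm_triangle_ineq[of "f z * indicator (- G) z" "\<Sum>x\<in>I. \<phi> x z"] nphi[of z] \<alpha>sum[of z] by linarith
      qed
      have Afin: "emeasure \<mu> (A x) < \<infinity>" if "x \<in> I" for x
        using emeasure_mono[OF A(2)[OF that], of \<mu>] emeasure_ball_finite[of x "\<rho> x"] by (simp add: le_less_trans)
      have h1i: "(LINT z|\<mu>. norm (h1 z)) \<le> 2 * M1"
      proof -
        have ia: "integrable \<mu> (\<lambda>z. norm (\<alpha> x) * indicator (A x) z)" if "x \<in> I" for x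
          using A(1)[OF that] Afin[OF that] by (intro integrable_mult_right integrable_real_indicator)
        have "(LINT z|\<mu>. norm (h1 z)) \<le> (LINT z|\<mu>. norm (f z) + (\<Sum>x\<in>I. norm (\<alpha> x) * indicator (A x) z))"
        proof (intro integral_mono Linf_b_integrable_norm h1l Bochner_Integration.integrable_add f Bochner_Integration.integrable_sum ia)
          fix z
          have "norm (f z * indicator (- G) z) \<le> norm (f z)" by (auto simp: indicator_def)
          then show "norm (h1 z) \<le> norm (f z) + (\<Sum>x\<in>I. norm (\<alpha> x) * indicator (A x) z)"
            unfolding h1_def using norm_triangle_ineq[of "f z * indicator (- G) z" "\<Sum>x\<in>I. \<phi> x z"] nphi[of z] by linarith
        qed
        also have "\<dots> = M1 + (LINT z|\<mu>. (\<Sum>x\<in>I. norm (\<alpha> x) * indicator (A x) z))"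
          unfolding M1_def by (intro Bochner_Integration.integral_add fi Bochner_Integration.integrable_sum ia)
        also have "(LINT z|\<mu>. (\<Sum>x\<in>I. norm (\<alpha> x) * indicator (A x) z)) = (\<Sum>x\<in>I. norm (\<alpha> x) * measure \<mu> (A x))"
          using ia by (subst Bochner_Integration.integral_sum) auto
        also have "\<dots> = (\<Sum>x\<in>I. norm (M x))"
        proof (rule sum.cong)
          fix x assume "x \<in> I"
          have "norm (\<alpha> x) * measure \<mu> (A x) = norm (\<alpha> x * measure \<mu> (A x))" by (simp add: norm_mult)
          then show "norm (\<alpha> x) * measure \<mu> (A x) = norm (M x)" using \<alpha>(1)[OF \<open>x \<in> I\<close>] by simp
        qed simp
        also have "\<dots> \<le> (\<Sum>x\<in>I. LINT z|\<mu>. norm (b x z))" by (intro sum_mono Mb)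
        also have "\<dots> \<le> M1" by (rule sumbI)
        finally show ?thesis by simp
      qed
      have restm: "G - V \<in> sets \<mu>" using Gm Vm by auto
      have rest': "emeasure \<mu> (G - V) < ennreal \<delta>" using rest unfolding V_def Q4 .
      have h2i: "(LINT z|\<mu>. norm (h2 z) powr p) \<le> t powr (p - 1) * M1"
      proof -
        have rfin: "emeasure \<mu> (G - V) < \<infinity>" using less_trans[OF rest' ennreal_less_top] by simp
        have "(LINT z|\<mu>. norm (h2 z) powr p) \<le> (LINT z|\<mu>. B powr p * indicator (G - V) z)"
        proof (rule integral_mono_AE)
          show "integrable \<mu> (\<lambda>z. norm (h2 z) powr p)" using p by (intro Linf_b_powr_integrable h2l) simp
          show "integrable \<mu> (\<lambda>z. B powr p * indicator (G - V) z)"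
            by (intro integrable_mult_right integrable_real_indicator restm rfin)
          show "AE z in \<mu>. norm (h2 z) powr p \<le> B powr p * indicator (G - V) z"
            using fB
          proof eventually_elim
            case (elim z)
            then show ?case using p unfolding h2_def by (cases "z \<in> G - V") (auto intro!: powr_mono2)
          qed
        qed
        also have "\<dots> = B powr p * measure \<mu> (G - V)" using restm by simp
        also have "\<dots> \<le> B powr p * \<delta>"
        proof (rule mult_left_mono)
          have "emeasure \<mu> (G - V) = ennreal (measure \<mu> (G - V))" using rfin by (intro emeasure_eq_ennreal_measure) auto
          with rest' have "ennreal (measure \<mu> (G - V)) \<le> ennreal \<delta>" by simp
          then show "measure \<mu> (G - V) \<le> \<delta>" using \<delta> by (subst (asm) ennreal_le_iff) auto
        qed simp
        also have "\<dots> = t powr (p - 1) * M1" unfolding \<delta>_def using B by simp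
        finally show ?thesis .
      qed
      have good: "emeasure \<mu> {z. norm (T (\<lambda>y. h1 y + h2 y) z) > t} \<le> ennreal (D1 * M1 / t)"
        unfolding D1_def by (rule good_part_bound[OF C p t M0 h1l h1b h1i h2l h2i])
      have bad: "emeasure \<mu> {z. norm (\<Sum>x\<in>I. T (a x) z) > t} \<le>
        (\<Sum>x\<in>I. emeasure \<mu> (ball x (32 * r x))) + ennreal ((\<Sum>x\<in>I. D2 * (LINT z|\<mu>. norm (b x z))) / t)"
      proof (rule bad_sum_bound[OF I al _ _ _ t])
        fix x assume x: "x \<in> I"
        show "(\<integral>\<^sup>+z. ennreal (norm (T (a x) z)) * indicator (- ball x (32 * r x)) z \<partial>\<mu>) \<le> ennreal (D2 * (LINT z|\<mu>. norm (b x z)))"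
          unfolding a_def[abs_def] \<phi>_def D2_def
        proof (rule bad_part_bound[OF C p r[OF x] n(1,2,3)[OF x] bl _ A(1)[OF x]])
          show "b x y = 0" if "y \<notin> ball x (3 * r x)" for y
            using that Q(2)[of x] unfolding b_def by (auto simp: indicator_def subset_eq simp del: mem_ball)
        qed (use A(2)[OF x] \<alpha>[OF x] in \<open>auto simp: M_def \<rho>_def\<close>)
        show "D2 * (LINT z|\<mu>. norm (b x z)) \<ge> 0" using D2 by (intro mult_nonneg_nonneg Bochner_Integration.integral_nonneg) auto
      qed simp_all
      also have "\<dots> \<le> ennreal (12 * \<beta> * M1 / t) + ennreal (D2 * M1 / t)"
      proof (intro add_mono)
        have "(\<Sum>x\<in>I. emeasure \<mu> (ball x (32 * r x))) = ennreal (\<Sum>x\<in>I. m x (32 * r x))"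
          by (simp add: emeasure_ball sum_ennreal)
        also have "\<dots> \<le> ennreal (12 * \<beta> * M1 / t)"
        proof (rule ennreal_leI)
          have "4 * \<beta> * (LINT z|\<mu>. w z) \<le> 4 * \<beta> * (3 * M1 / t)" using Ww beta_pos by (intro mult_left_mono) auto
          then show "(\<Sum>x\<in>I. m x (32 * r x)) \<le> 12 * \<beta> * M1 / t" using sm by simp
        qed
        finally show "(\<Sum>x\<in>I. emeasure \<mu> (ball x (32 * r x))) \<le> ennreal (12 * \<beta> * M1 / t)" .
        show "ennreal ((\<Sum>x\<in>I. D2 * (LINT z|\<mu>. norm (b x z))) / t) \<le> ennreal (D2 * M1 / t)"
          unfolding sum_distrib_left[symmetric] using sumbI D2 t by (intro ennreal_leI divide_right_mono mult_left_mono) auto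
      qed
      finally have bad: "emeasure \<mu> {z. norm (\<Sum>x\<in>I. T (a x) z) > t} \<le> ennreal (12 * \<beta> * M1 / t) + ennreal (D2 * M1 / t)" .
      have hl: "(\<lambda>y. h1 y + h2 y) \<in> Linf_b \<mu>" by (intro Linf_b_add h1l h2l)
      have split: "f = (\<lambda>z. (h1 z + h2 z) + (\<Sum>x\<in>I. a x z))"
      proof
        fix z
        have ind: "(\<Sum>x\<in>I. indicator (Q x) z) = (indicator V z :: complex)"
          unfolding V_def by (rule indicator_UN_disjoint[OF I Q3, symmetric])
        have "(\<Sum>x\<in>I. b x z) = f z * indicator G z * (\<Sum>x\<in>I. indicator (Q x) z)"
          unfolding b_def sum_distrib_left by (intro sum.cong) (auto simp: indicator_def)
        then have "(\<Sum>x\<in>I. b x z) = f z * indicator (G \<inter> V) z" unfolding ind by (auto simp: indicator_def)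
        then have "(\<Sum>x\<in>I. a x z) = f z * indicator (G \<inter> V) z - (\<Sum>x\<in>I. \<phi> x z)"
          unfolding a_def by (simp add: sum_subtractf)
        then show "f z = (h1 z + h2 z) + (\<Sum>x\<in>I. a x z)" unfolding h1_def h2_def by (auto simp: indicator_def)
      qed
      have "AE z in \<mu>. T f z = T (\<lambda>y. h1 y + h2 y) z + T (\<lambda>y. \<Sum>x\<in>I. a x y) z"
        by (subst split) (intro T_add hl Linf_b_sum I al)
      moreover have "AE z in \<mu>. T (\<lambda>y. \<Sum>x\<in>I. a x y) z = (\<Sum>x\<in>I. T (a x) z)" by (intro T_sum I al)
      ultimately have "AE z in \<mu>. z \<in> {z. norm (T f z) > 2 * t} \<longrightarrow>
        z \<in> {z. norm (T (\<lambda>y. h1 y + h2 y) z) > t} \<union> {z. norm (\<Sum>x\<in>I. T (a x) z) > t}"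
      proof eventually_elim
        case (elim z)
        show ?case using norm_triangle_ineq[of "T (\<lambda>y. h1 y + h2 y) z" "\<Sum>x\<in>I. T (a x) z"] elim by auto
      qed
      moreover have s1: "{z. norm (T (\<lambda>y. h1 y + h2 y) z) > t} \<in> sets \<mu>" by (rule T_level_measurable[OF hl])
      moreover have s2: "{z. norm (\<Sum>x\<in>I. T (a x) z) > t} \<in> sets \<mu>"
      proof -
        have [measurable]: "(\<lambda>z. \<Sum>x\<in>I. T (a x) z) \<in> borel_measurable \<mu>" by (intro borel_measurable_sum T_measurable al)
        have "{z \<in> space \<mu>. norm (\<Sum>x\<in>I. T (a x) z) > t} \<in> sets \<mu>" by measurable
        then show ?thesis by simp
      qed
      ultimately have "emeasure \<mu> {z. norm (T f z) > 2 * t} \<le>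
        emeasure \<mu> ({z. norm (T (\<lambda>y. h1 y + h2 y) z) > t} \<union> {z. norm (\<Sum>x\<in>I. T (a x) z) > t})"
        by (intro emeasure_mono_AE) auto
      also have "\<dots> \<le> ennreal (D1 * M1 / t) + (ennreal (12 * \<beta> * M1 / t) + ennreal (D2 * M1 / t))"
        by (rule order_trans[OF emeasure_subadditive[OF s1 s2] add_mono[OF good bad]])
      also have "\<dots> = ennreal (D1 * M1 / t + (12 * \<beta> * M1 / t + D2 * M1 / t))"
        using D1 D2 M0 t beta_pos by (simp add: ennreal_plus)
      also have "D1 * M1 / t + (12 * \<beta> * M1 / t + D2 * M1 / t) = (D1 + 12 * \<beta> + D2) * M1 / t"
        by (simp add: distrib_right add_divide_distrib)
      finally show ?thesis .
    qed
  qed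
  then show ?thesis unfolding D1_def D2_def .
qed

theorem Lp_imp_weak11:
  assumes C: "Lp_bd p C" and p: "p > 1"
  obtains C' where "weak11 C'"
proof -
  have C0: "C > 0" using C unfolding Lp_bd_def by blast
  define D where "D = C * 2 powr p * (2 * 3 powr (p - 1) + 1) + 12 * \<beta> +
      (2 * \<kappa> * L / (1 - 32 powr (-\<tau>)) + 5 * \<kappa> * L ^ 4 + 2 * (\<beta> + C))"
  have th: "32 powr (-\<tau>) < (1::real)" using tau_pos powr_less_mono[of "-\<tau>" 0 32] by auto
  have "2 * 3 powr (p - 1) + 1 > (0::real)" by (rule add_pos_pos) auto
  then have D: "D > 0" unfolding D_def using kappa_pos L_ge1 th beta_pos C0 by (intro add_pos_pos) auto
  have "weak11 (2 * D)"
    unfolding weak11_def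
  proof (intro conjI ballI allI impI)
    fix g and s :: real assume g: "g \<in> Linf_b \<mu>" and s: "s > 0"
    have "emeasure \<mu> {x. norm (T g x) > 2 * (s / 2)} \<le> ennreal (D * (LINT x|\<mu>. norm (g x)) / (s / 2))"
      unfolding D_def using s by (intro CZ_level_estimate[OF C p g]) simp
    then show "emeasure \<mu> {x. norm (T g x) > s} \<le> ennreal (2 * D * (LINT x|\<mu>. norm (g x)) / s)" by (simp add: mult_ac)
  qed (use D in simp)
  then show thesis by (rule that)
qed

end

subsection \<open>Extension by limits in measure\<close>

text \<open>The \<open>p\<close>-th power of the norm; with it Minkowski's inequality is replaced by
  an elementary bound with factor \<open>2 powr p\<close>.\<close>

definition Lp_mass :: "'a measure \<Rightarrow> real \<Rightarrow> ('a \<Rightarrow> complex) \<Rightarrow> ennreal" where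
  "Lp_mass M p f = (\<integral>\<^sup>+x. ennreal (norm (f x) powr p) \<partial>M)"

lemma Lp_mass_cong_AE: "AE x in M. norm (f x) = norm (g x) \<Longrightarrow> Lp_mass M p f = Lp_mass M p g"
  unfolding Lp_mass_def by (intro nn_integral_cong_AE) (auto elim: eventually_mono)

lemma Lp_mass_mono: "p > 0 \<Longrightarrow> (\<And>x. norm (f x) \<le> norm (g x)) \<Longrightarrow> Lp_mass M p f \<le> Lp_mass M p g"
  unfolding Lp_mass_def by (intro nn_integral_mono ennreal_leI powr_mono2) auto

lemma Lp_mass_add:
  assumes p: "p > 0" and [measurable]: "f \<in> borel_measurable M" "g \<in> borel_measurable M"
  shows "Lp_mass M p (\<lambda>x. f x + g x) \<le> ennreal (2 powr p) * (Lp_mass M p f + Lp_mass M p g)"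
proof -
  have "Lp_mass M p (\<lambda>x. f x + g x) \<le> (\<integral>\<^sup>+x. ennreal (2 powr p) * (ennreal (norm (f x) powr p) + ennreal (norm (g x) powr p)) \<partial>M)"
    unfolding Lp_mass_def
  proof (rule nn_integral_mono)
    fix x
    have "norm (f x + g x) powr p \<le> (norm (f x) + norm (g x)) powr p"
      using p by (intro powr_mono2 norm_triangle_ineq) auto
    also have "\<dots> \<le> 2 powr p * (norm (f x) powr p + norm (g x) powr p)" using p by (intro powr_add_le) auto
    finally show "ennreal (norm (f x + g x) powr p) \<le> ennreal (2 powr p) * (ennreal (norm (f x) powr p) + ennreal (norm (g x) powr p))"
      by (simp add: ennreal_plus[symmetric] ennreal_mult[symmetric] ennreal_leI del: ennreal_plus)
  qed
  also have "\<dots> = ennreal (2 powr p) * (Lp_mass M p f + Lp_mass M p g)"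
    unfolding Lp_mass_def by (simp add: nn_integral_cmult nn_integral_add)
  finally show ?thesis .
qed

lemma Lp_mass_cmult:
  assumes p: "p > 0" and [measurable]: "f \<in> borel_measurable M"
  shows "Lp_mass M p (\<lambda>x. a * f x) = ennreal (norm a powr p) * Lp_mass M p f"
  unfolding Lp_mass_def by (subst nn_integral_cmult[symmetric]) (auto simp: norm_mult powr_mult ennreal_mult)

lemma Lp_space_iff: "p > 0 \<Longrightarrow> f \<in> Lp_space M p \<longleftrightarrow> f \<in> borel_measurable M \<and> Lp_mass M p f < \<infinity>"
  unfolding Lp_space_def Lp_norm_def enn_powr_def Lp_mass_def by (auto simp: less_top)

section \<open>Null sequences and convergence in measure\<close>

text \<open>Convergence to 0, written with eventual real bounds so that it passes along inequalities
  between sequences that may take the value \<infinity>.\<close>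

definition vanishing :: "(nat \<Rightarrow> ennreal) \<Rightarrow> bool" where
  "vanishing X \<longleftrightarrow> (\<forall>\<epsilon>>0. \<forall>\<^sub>F n in sequentially. X n \<le> ennreal \<epsilon>)"

lemma vanishing_tendsto: "X \<longlonglongrightarrow> 0 \<Longrightarrow> vanishing X"
  unfolding vanishing_def by (auto dest!: order_tendstoD(2)[where a = "ennreal _"] elim!: eventually_mono)

text \<open>The denominator \<open>2 * c + 1\<close> instead of \<open>2 * c\<close> keeps the
  tolerance positive when \<open>c = 0\<close>.\<close>

lemma scaled_le:
  fixes c e :: real
  assumes "c \<ge> 0" "e \<ge> 0"
  shows "c * (e / (2 * c + 1) + e / (2 * c + 1)) \<le> e"
proof -
  have "c * (e / (2 * c + 1) + e / (2 * c + 1)) = e * (2 * c / (2 * c + 1))" by simp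
  also have "\<dots> \<le> e * 1" using assms by (intro mult_left_mono) auto
  finally show ?thesis by simp
qed

lemma vanishing_bound:
  assumes X: "vanishing X" and Y: "vanishing Y" and c: "c \<ge> 0" and le: "\<And>n. Z n \<le> ennreal c * (X n + Y n)"
  shows "vanishing Z"
  unfolding vanishing_def
proof (intro allI impI)
  fix \<epsilon> :: real assume e: "\<epsilon> > 0"
  define d where "d = \<epsilon> / (2 * c + 1)"
  have d: "d > 0" using e c by (simp add: d_def)
  have cd: "c * (d + d) \<le> \<epsilon>" unfolding d_def using c e by (intro scaled_le) auto
  have "\<forall>\<^sub>F n in sequentially. X n \<le> ennreal d" "\<forall>\<^sub>F n in sequentially. Y n \<le> ennreal d"
    using X Y d unfolding vanishing_def by auto
  then show "\<forall>\<^sub>F n in sequentially. Z n \<le> ennreal \<epsilon>"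
  proof eventually_elim
    case (elim n)
    have "Z n \<le> ennreal c * (ennreal d + ennreal d)" by (rule order_trans[OF le mult_left_mono[OF add_mono[OF elim]]]) simp
    also have "\<dots> = ennreal (c * (d + d))" using c d by (simp add: ennreal_plus[symmetric] ennreal_mult[symmetric] del: ennreal_plus)
    also have "\<dots> \<le> ennreal \<epsilon>" by (rule ennreal_leI[OF cd])
    finally show ?case .
  qed
qed

lemma vanishing_add: "vanishing X \<Longrightarrow> vanishing Y \<Longrightarrow> (\<And>n. Z n \<le> X n + Y n) \<Longrightarrow> vanishing Z"
  by (rule vanishing_bound[of X Y 1]) auto

definition tends_in_measure :: "'a measure \<Rightarrow> (nat \<Rightarrow> 'a \<Rightarrow> complex) \<Rightarrow> ('a \<Rightarrow> complex) \<Rightarrow> bool" where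
  "tends_in_measure M g h \<longleftrightarrow> (\<forall>t>0. vanishing (\<lambda>n. emeasure M {x \<in> space M. norm (g n x - h x) > t}))"

lemma tends_in_measureD:
  "tends_in_measure M g h \<Longrightarrow> t > 0 \<Longrightarrow> vanishing (\<lambda>n. emeasure M {x \<in> space M. norm (g n x - h x) > t})"
  unfolding tends_in_measure_def by blast

lemma tends_in_measure_unique:
  assumes g: "tends_in_measure M g h" "tends_in_measure M g h'"
    and [measurable]: "\<And>n. g n \<in> borel_measurable M" "h \<in> borel_measurable M" "h' \<in> borel_measurable M"
  shows "AE x in M. h x = h' x"
proof -
  have "AE x in M. \<not> norm (h x - h' x) > t" if t: "t > 0" for t
  proof -
    have le: "emeasure M {x \<in> space M. norm (h x - h' x) > t} \<le> 0 + ennreal \<epsilon>" if e: "\<epsilon> > 0" for \<epsilon>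
    proof -
      have "vanishing (\<lambda>n. emeasure M {x \<in> space M. norm (g n x - h x) > t / 2})"
        "vanishing (\<lambda>n. emeasure M {x \<in> space M. norm (g n x - h' x) > t / 2})"
        using t by (intro tends_in_measureD g, simp)+
      then have "\<forall>\<^sub>F n in sequentially. emeasure M {x \<in> space M. norm (g n x - h x) > t / 2} \<le> ennreal (\<epsilon> / 2)"
        "\<forall>\<^sub>F n in sequentially. emeasure M {x \<in> space M. norm (g n x - h' x) > t / 2} \<le> ennreal (\<epsilon> / 2)"
        using e unfolding vanishing_def by auto
      then have "\<forall>\<^sub>F n in sequentially. emeasure M {x \<in> space M. norm (g n x - h x) > t / 2} \<le> ennreal (\<epsilon> / 2) \<and>
        emeasure M {x \<in> space M. norm (g n x - h' x) > t / 2} \<le> ennreal (\<epsilon> / 2)" by eventually_elim auto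
      then obtain n where n: "emeasure M {x \<in> space M. norm (g n x - h x) > t / 2} \<le> ennreal (\<epsilon> / 2)"
        "emeasure M {x \<in> space M. norm (g n x - h' x) > t / 2} \<le> ennreal (\<epsilon> / 2)"
        using eventually_happens'[OF sequentially_bot] by blast
      have "{x \<in> space M. norm (h x - h' x) > t} \<subseteq> {x \<in> space M. norm (g n x - h x) > t / 2} \<union> {x \<in> space M. norm (g n x - h' x) > t / 2}"
      proof
        fix x assume "x \<in> {x \<in> space M. norm (h x - h' x) > t}"
        moreover have "norm (h x - h' x) \<le> norm (g n x - h x) + norm (g n x - h' x)"
          using norm_triangle_ineq4[of "g n x - h' x" "g n x - h x"] by simp
        ultimately show "x \<in> {x \<in> space M. norm (g n x - h x) > t / 2} \<union> {x \<in> space M. norm (g n x - h' x) > t / 2}" by auto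
      qed
      then have "emeasure M {x \<in> space M. norm (h x - h' x) > t} \<le>
        emeasure M ({x \<in> space M. norm (g n x - h x) > t / 2} \<union> {x \<in> space M. norm (g n x - h' x) > t / 2})"
        by (intro emeasure_mono) auto
      also have "\<dots> \<le> ennreal (\<epsilon> / 2) + ennreal (\<epsilon> / 2)"
        by (rule order_trans[OF emeasure_subadditive add_mono[OF n]]) auto
      also have "\<dots> = ennreal \<epsilon>" using e by (subst ennreal_plus[symmetric]) auto
      finally show ?thesis by simp
    qed
    have "emeasure M {x \<in> space M. norm (h x - h' x) > t} \<le> 0" by (rule ennreal_le_epsilon[OF le])
    then have "emeasure M {x \<in> space M. norm (h x - h' x) > t} = 0" by simp
    then show ?thesis by (subst AE_iff_measurable[OF _ refl]) auto
  qed
  then have "AE x in M. \<forall>n::nat. \<not> norm (h x - h' x) > 1 / Suc n" unfolding AE_all_countable by simp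
  then show ?thesis
  proof eventually_elim
    case (elim x)
    show ?case
    proof (rule ccontr)
      assume "h x \<noteq> h' x"
      then have "norm (h x - h' x) > 0" by simp
      then obtain n where "1 / Suc n < norm (h x - h' x)" by (meson nat_approx_posE)
      with elim show False by blast
    qed
  qed
qed

text \<open>Fatou's lemma for indicators: \<open>norm (h x) > t\<close> is an open condition, so it
  passes to \<open>g n x\<close> for all large \<open>n\<close>.\<close>

lemma emeasure_level_AE_limit:
  fixes g :: "nat \<Rightarrow> 'a \<Rightarrow> complex"
  assumes [measurable]: "\<And>n. g n \<in> borel_measurable M" "h \<in> borel_measurable M"
    and lim: "AE x in M. (\<lambda>n. g n x) \<longlonglongrightarrow> h x"
    and le: "\<forall>\<^sub>F n in sequentially. emeasure M {x \<in> space M. norm (g n x) > t} \<le> c"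
  shows "emeasure M {x \<in> space M. norm (h x) > t} \<le> c"
proof -
  have "emeasure M {x \<in> space M. norm (h x) > t} = (\<integral>\<^sup>+x. indicator {x \<in> space M. norm (h x) > t} x \<partial>M)" by simp
  also have "\<dots> \<le> (\<integral>\<^sup>+x. liminf (\<lambda>n. indicator {x \<in> space M. norm (g n x) > t} x) \<partial>M)"
  proof (rule nn_integral_mono_AE)
    show "AE x in M. indicator {x \<in> space M. norm (h x) > t} x \<le> (liminf (\<lambda>n. indicator {x \<in> space M. norm (g n x) > t} x) :: ennreal)"
      using lim
    proof eventually_elim
      case (elim x)
      show ?case
      proof (cases "x \<in> space M \<and> norm (h x) > t")
        case True
        have "\<forall>\<^sub>F n in sequentially. norm (g n x) > t"
          using order_tendstoD(1)[OF tendsto_norm[OF elim]] True by blast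
        then have "\<forall>\<^sub>F n in sequentially. (1::ennreal) \<le> indicator {x \<in> space M. norm (g n x) > t} x"
          using True by (auto elim!: eventually_mono)
        then have "(1::ennreal) \<le> liminf (\<lambda>n. indicator {x \<in> space M. norm (g n x) > t} x)" by (rule Liminf_bounded)
        then show ?thesis using True by simp
      qed simp
    qed
  qed
  also have "\<dots> \<le> liminf (\<lambda>n. \<integral>\<^sup>+x. indicator {x \<in> space M. norm (g n x) > t} x \<partial>M)"
    by (rule nn_integral_liminf) auto
  also have "\<dots> \<le> c" using le by (intro Liminf_le) (auto elim: eventually_mono)
  finally show ?thesis .
qed

context CZ_space
begin

section \<open>Limits of the operator along approximations\<close>

definition approx :: "real \<Rightarrow> (nat \<Rightarrow> 'a \<Rightarrow> complex) \<Rightarrow> ('a \<Rightarrow> complex) \<Rightarrow> bool" where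
  "approx p u f \<longleftrightarrow> (\<forall>n. u n \<in> Linf_b \<mu>) \<and> vanishing (\<lambda>n. Lp_mass \<mu> p (\<lambda>x. u n x - f x))"

text \<open>Truncation in height and in space. The pointwise domination by \<open>f\<close> is
  recorded because it lets norm bounds for \<open>T (u n)\<close> pass to the limit with the same
  constant.\<close>

lemma ex_approx:
  assumes p: "p > 0" and f: "f \<in> Lp_space \<mu> p"
  shows "\<exists>u. approx p u f \<and> (\<forall>n x. norm (u n x) \<le> norm (f x))"
proof -
  fix x0 :: 'a
  have [measurable]: "f \<in> borel_measurable \<mu>" and fin: "Lp_mass \<mu> p f < \<infinity>" using f Lp_space_iff[OF p] by auto
  define A where "A n = {x. norm (f x) \<le> real n} \<inter> ball x0 (real n)" for n :: nat
  have "{x \<in> space \<mu>. norm (f x) \<le> real n} \<in> sets \<mu>" for n :: nat by measurable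
  then have Am[measurable]: "A n \<in> sets \<mu>" for n unfolding A_def by auto
  define u where "u n x = f x * indicator (A n) x" for n x
  have um[measurable]: "u n \<in> borel_measurable \<mu>" for n unfolding u_def by measurable
  have ule: "norm (u n x) \<le> norm (f x)" for n x unfolding u_def by (auto simp: indicator_def)
  have "u n \<in> Linf_b \<mu>" for n
  proof (rule Linf_bI[of _ "real n" x0 "real n"])
    show "AE x in \<mu>. norm (u n x) \<le> real n" unfolding u_def A_def by (auto simp: indicator_def)
    show "AE x in \<mu>. x \<notin> ball x0 (real n) \<longrightarrow> u n x = 0" unfolding u_def A_def by (auto simp: indicator_def)
  qed measurable
  moreover have "vanishing (\<lambda>n. Lp_mass \<mu> p (\<lambda>x. u n x - f x))"
  proof (rule vanishing_tendsto)
    have "(\<lambda>n. \<integral>\<^sup>+x. ennreal (norm (u n x - f x) powr p) \<partial>\<mu>) \<longlonglongrightarrow> (\<integral>\<^sup>+x. 0 \<partial>\<mu>)"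
    proof (rule nn_integral_dominated_convergence[where w = "\<lambda>x. ennreal (norm (f x) powr p)"])
      show "(\<integral>\<^sup>+x. ennreal (norm (f x) powr p) \<partial>\<mu>) < \<infinity>" using fin unfolding Lp_mass_def .
      fix n
      show "AE x in \<mu>. ennreal (norm (u n x - f x) powr p) \<le> ennreal (norm (f x) powr p)"
        using p by (intro AE_I2 ennreal_leI powr_mono2) (auto simp: u_def indicator_def)
    next
      show "AE x in \<mu>. (\<lambda>n. ennreal (norm (u n x - f x) powr p)) \<longlonglongrightarrow> 0"
      proof (rule AE_I2)
        fix x
        obtain N1 :: nat where N1: "norm (f x) < N1" using reals_Archimedean2 by blast
        obtain N2 :: nat where N2: "dist x0 x < N2" using reals_Archimedean2 by blast
        have "u n x = f x" if "n \<ge> max N1 N2" for n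
        proof -
          have "real N1 \<le> real n" "real N2 \<le> real n" using that by auto
          then have "x \<in> A n" using N1 N2 unfolding A_def by auto
          then show ?thesis unfolding u_def by simp
        qed
        then have "\<forall>\<^sub>F n in sequentially. ennreal (norm (u n x - f x) powr p) = 0"
          unfolding eventually_sequentially by (intro exI[of _ "max N1 N2"]) auto
        then show "(\<lambda>n. ennreal (norm (u n x - f x) powr p)) \<longlonglongrightarrow> 0" by (rule tendsto_eventually)
      qed
    qed auto
    then show "(\<lambda>n. Lp_mass \<mu> p (\<lambda>x. u n x - f x)) \<longlonglongrightarrow> 0" unfolding Lp_mass_def by simp
  qed
  ultimately show ?thesis using ule unfolding approx_def by (intro exI[of _ u] conjI allI)
qed

text \<open>The common form of both applications: \<open>c s\<close> is \<open>C / s\<close> for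
  weak type (1,1) and \<open>A / s\<^sup>2\<close> for \<open>p = 2\<close>.\<close>

definition weak_type :: "real \<Rightarrow> (real \<Rightarrow> real) \<Rightarrow> bool" where
  "weak_type p c \<longleftrightarrow> p > 0 \<and> (\<forall>s>0. c s \<ge> 0 \<and> (\<forall>g\<in>Linf_b \<mu>. emeasure \<mu> {x. norm (T g x) > s} \<le> ennreal (c s) * Lp_mass \<mu> p g))"

lemma weak_type_diff:
  assumes W: "weak_type p c" and s: "s > 0" and u: "u \<in> Linf_b \<mu>" and v: "v \<in> Linf_b \<mu>" and f: "f \<in> borel_measurable \<mu>"
  shows "emeasure \<mu> {x. norm (T u x - T v x) > s} \<le>
    ennreal (c s * 2 powr p) * (Lp_mass \<mu> p (\<lambda>x. u x - f x) + Lp_mass \<mu> p (\<lambda>x. v x - f x))"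
proof -
  have p: "p > 0" and c: "c s \<ge> 0" using W s unfolding weak_type_def by auto
  note [measurable] = Linf_b_measurable[OF u] Linf_b_measurable[OF v] f
  have uv: "(\<lambda>x. u x - v x) \<in> Linf_b \<mu>" by (rule Linf_b_diff[OF u v])
  have "AE x in \<mu>. x \<in> {x. norm (T u x - T v x) > s} \<longrightarrow> x \<in> {x. norm (T (\<lambda>x. u x - v x) x) > s}"
    using T_diff[OF u v] by eventually_elim simp
  then have "emeasure \<mu> {x. norm (T u x - T v x) > s} \<le> emeasure \<mu> {x. norm (T (\<lambda>x. u x - v x) x) > s}"
    using T_level_measurable[OF uv] by (rule emeasure_mono_AE)
  also have "\<dots> \<le> ennreal (c s) * Lp_mass \<mu> p (\<lambda>x. u x - v x)" using W s uv unfolding weak_type_def by blast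
  also have "Lp_mass \<mu> p (\<lambda>x. u x - v x) = Lp_mass \<mu> p (\<lambda>x. (u x - f x) + (f x - v x))" by simp
  also have "\<dots> \<le> ennreal (2 powr p) * (Lp_mass \<mu> p (\<lambda>x. u x - f x) + Lp_mass \<mu> p (\<lambda>x. f x - v x))"
    by (rule Lp_mass_add[OF p]) measurable
  also have "Lp_mass \<mu> p (\<lambda>x. f x - v x) = Lp_mass \<mu> p (\<lambda>x. v x - f x)"
    by (rule Lp_mass_cong_AE) (simp add: norm_minus_commute)
  finally show ?thesis using c by (simp add: ennreal_mult mult.assoc mult_left_mono)
qed

text \<open>Weak type makes \<open>T (u n)\<close> Cauchy in measure. Along a subsequence,
  consecutive differences exceed \<open>(1/2) ^ k\<close> only on sets of measure at most
  \<open>(1/2) ^ k\<close>, so it converges almost everywhere by the Borel-Cantelli lemma; its limit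
  is then the limit in measure of the full sequence.\<close>

lemma ex_limit_in_measure:
  assumes W: "weak_type p c" and f: "f \<in> borel_measurable \<mu>" and u: "approx p u f"
  obtains h \<sigma> where "h \<in> borel_measurable \<mu>" "tends_in_measure \<mu> (\<lambda>n. T (u n)) h"
    "AE x in \<mu>. (\<lambda>k. T (u (\<sigma> k)) x) \<longlonglongrightarrow> h x"
proof -
  have p: "p > 0" using W unfolding weak_type_def by auto
  have c: "c s \<ge> 0" if "s > 0" for s using W that unfolding weak_type_def by auto
  have ul: "u n \<in> Linf_b \<mu>" for n using u unfolding approx_def by blast
  note Tm[measurable] = T_measurable[OF ul]
  define X where "X n = Lp_mass \<mu> p (\<lambda>x. u n x - f x)" for n
  have X: "vanishing X" using u unfolding approx_def X_def by blast
  define s where "s k = (1/2::real) ^ k" for k :: nat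
  have s0: "s k > 0" for k unfolding s_def by simp
  define d where "d k = s k / (2 * (c (s k) * 2 powr p) + 1)" for k
  have cp: "c (s k) * 2 powr p \<ge> 0" for k using c[OF s0] by simp
  have d0: "d k > 0" for k unfolding d_def using s0[of k] cp[of k] by (intro divide_pos_pos) auto
  have cd: "c (s k) * 2 powr p * (d k + d k) \<le> s k" for k
    unfolding d_def using cp[of k] s0[of k] by (intro scaled_le) auto
  have "\<forall>k. \<exists>n0. \<forall>n\<ge>n0. X n \<le> ennreal (d k)"
    using X d0 unfolding vanishing_def eventually_sequentially by blast
  from choice[OF this] obtain n0 where n0: "\<And>k n. n \<ge> n0 k \<Longrightarrow> X n \<le> ennreal (d k)" by blast
  \<comment> \<open>The maximum makes \<open>\<sigma> (Suc k)\<close> admissible for the threshold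
    of \<open>k\<close> as well; adding \<open>k\<close> forces the indices to infinity.\<close>
  define \<sigma> where "\<sigma> k = Max (n0 ` {..k}) + k" for k
  have \<sigma>_ge: "\<sigma> k \<ge> n0 j" if "j \<le> k" for j k
  proof -
    have "n0 j \<le> Max (n0 ` {..k})" using that by (intro Max_ge) auto
    then show ?thesis unfolding \<sigma>_def by simp
  qed
  have \<sigma>_ge_k: "\<sigma> k \<ge> k" for k unfolding \<sigma>_def by simp
  define A where "A k = {x \<in> space \<mu>. norm (T (u (\<sigma> k)) x - T (u (\<sigma> (Suc k))) x) > s k}" for k
  have Am: "A k \<in> sets \<mu>" for k unfolding A_def by measurable
  have Ae: "emeasure \<mu> (A k) \<le> ennreal (s k)" for k
  proof -
    have "emeasure \<mu> (A k) \<le> ennreal (c (s k) * 2 powr p) * (X (\<sigma> k) + X (\<sigma> (Suc k)))"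
      unfolding A_def X_def using weak_type_diff[OF W s0 ul ul f] by simp
    also have "\<dots> \<le> ennreal (c (s k) * 2 powr p) * (ennreal (d k) + ennreal (d k))"
      by (intro mult_left_mono add_mono n0 \<sigma>_ge) auto
    also have "\<dots> = ennreal (c (s k) * 2 powr p * (d k + d k))"
      using cp[of k] d0[of k] by (simp add: ennreal_plus[symmetric] ennreal_mult[symmetric] del: ennreal_plus)
    also have "\<dots> \<le> ennreal (s k)" by (rule ennreal_leI[OF cd])
    finally show ?thesis .
  qed
  have Afin: "emeasure \<mu> (A k) < \<infinity>" for k using Ae[of k] by (simp add: le_less_trans)
  have Ams: "measure \<mu> (A k) \<le> s k" for k
  proof -
    have "emeasure \<mu> (A k) = ennreal (measure \<mu> (A k))" using Afin[of k] by (intro emeasure_eq_ennreal_measure) auto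
    with Ae[of k] have "ennreal (measure \<mu> (A k)) \<le> ennreal (s k)" by simp
    then show ?thesis using s0[of k] by (subst (asm) ennreal_le_iff) auto
  qed
  have ss: "summable s" unfolding s_def by (simp add: summable_geometric)
  have "summable (\<lambda>k. measure \<mu> (A k))"
    by (rule summable_comparison_test'[OF ss, of 0]) (use Ams in auto)
  from borel_cantelli_AE1[OF Am Afin this]
  have conv: "AE x in \<mu>. convergent (\<lambda>k. T (u (\<sigma> k)) x)"
  proof eventually_elim
    case (elim x)
    then obtain k0 where k0: "\<And>k. k \<ge> k0 \<Longrightarrow> x \<notin> A k" unfolding eventually_sequentially by auto
    have "summable (\<lambda>k. T (u (\<sigma> (Suc k))) x - T (u (\<sigma> k)) x)"
    proof (rule summable_comparison_test'[OF ss, of k0])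
      fix k assume "k \<ge> k0"
      from k0[OF this] show "norm (T (u (\<sigma> (Suc k))) x - T (u (\<sigma> k)) x) \<le> s k"
        unfolding A_def by (simp add: norm_minus_commute)
    qed
    then have "convergent (\<lambda>n. \<Sum>k<n. T (u (\<sigma> (Suc k))) x - T (u (\<sigma> k)) x)" by (simp add: summable_iff_convergent)
    then have "convergent (\<lambda>n. T (u (\<sigma> n)) x - T (u (\<sigma> 0)) x)"
      unfolding sum_lessThan_telescope[of "\<lambda>k. T (u (\<sigma> k)) x"] .
    then have "convergent (\<lambda>n. (T (u (\<sigma> n)) x - T (u (\<sigma> 0)) x) + T (u (\<sigma> 0)) x)"
      by (intro convergent_add convergent_const)
    then show ?case by simp
  qed
  define h where "h x = lim (\<lambda>k. T (u (\<sigma> k)) x)" for x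
  have hm[measurable]: "h \<in> borel_measurable \<mu>" unfolding h_def by (rule borel_measurable_lim_metric) measurable
  have lim: "AE x in \<mu>. (\<lambda>k. T (u (\<sigma> k)) x) \<longlonglongrightarrow> h x"
    using conv unfolding h_def by eventually_elim (simp add: convergent_LIMSEQ_iff)
  have "tends_in_measure \<mu> (\<lambda>n. T (u n)) h"
    unfolding tends_in_measure_def
  proof (intro allI impI)
    fix t :: real assume t: "t > 0"
    show "vanishing (\<lambda>n. emeasure \<mu> {x \<in> space \<mu>. norm (T (u n) x - h x) > t})"
      unfolding vanishing_def
    proof (intro allI impI)
      fix \<epsilon> :: real assume e: "\<epsilon> > 0"
      define q where "q = c t * 2 powr p"
      have q: "q \<ge> 0" unfolding q_def using c[OF t] by simp
      define \<eta> where "\<eta> = \<epsilon> / (2 * q + 1)"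
      have eta: "\<eta> > 0" unfolding \<eta>_def using e q by simp
      have qe: "q * (\<eta> + \<eta>) \<le> \<epsilon>" unfolding \<eta>_def using q e by (intro scaled_le) auto
      obtain m0 where m0: "\<And>n. n \<ge> m0 \<Longrightarrow> X n \<le> ennreal \<eta>"
        using X eta unfolding vanishing_def eventually_sequentially by blast
      \<comment> \<open>With \<open>n\<close> fixed, \<open>h\<close> is approached along the
        subsequence only, where convergence almost everywhere is available.\<close>
      have "emeasure \<mu> {x \<in> space \<mu>. norm (T (u n) x - h x) > t} \<le> ennreal \<epsilon>" if n: "n \<ge> m0" for n
      proof (rule emeasure_level_AE_limit[where g = "\<lambda>k x. T (u n) x - T (u (\<sigma> k)) x"])
        show "AE x in \<mu>. (\<lambda>k. T (u n) x - T (u (\<sigma> k)) x) \<longlonglongrightarrow> T (u n) x - h x"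
          using lim by eventually_elim (intro tendsto_diff tendsto_const)
        show "\<forall>\<^sub>F k in sequentially. emeasure \<mu> {x \<in> space \<mu>. norm (T (u n) x - T (u (\<sigma> k)) x) > t} \<le> ennreal \<epsilon>"
          unfolding eventually_sequentially
        proof (intro exI[of _ m0] allI impI)
          fix k assume k: "k \<ge> m0"
          have "emeasure \<mu> {x \<in> space \<mu>. norm (T (u n) x - T (u (\<sigma> k)) x) > t} \<le> ennreal q * (X n + X (\<sigma> k))"
            unfolding q_def X_def using weak_type_diff[OF W t ul ul f] by simp
          also have "\<dots> \<le> ennreal q * (ennreal \<eta> + ennreal \<eta>)"
            using n k \<sigma>_ge_k[of k] by (intro mult_left_mono add_mono m0) auto
          also have "\<dots> = ennreal (q * (\<eta> + \<eta>))"
            using q eta by (simp add: ennreal_plus[symmetric] ennreal_mult[symmetric] del: ennreal_plus)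
          also have "\<dots> \<le> ennreal \<epsilon>" by (rule ennreal_leI[OF qe])
          finally show "emeasure \<mu> {x \<in> space \<mu>. norm (T (u n) x - T (u (\<sigma> k)) x) > t} \<le> ennreal \<epsilon>" .
        qed
      qed measurable
      then show "\<forall>\<^sub>F n in sequentially. emeasure \<mu> {x \<in> space \<mu>. norm (T (u n) x - h x) > t} \<le> ennreal \<epsilon>"
        unfolding eventually_sequentially by blast
    qed
  qed
  with that hm lim show thesis by blast
qed

text \<open>Independence of the limit from the approximation: it allows the extension to be
  evaluated on whichever approximation is convenient, such as a linear combination or a constant
  sequence.\<close>

lemma tends_in_measure_other_approx:
  assumes W: "weak_type p c" and f: "f \<in> borel_measurable \<mu>" and u: "approx p u f" and v: "approx p v f"
    and h[measurable]: "h \<in> borel_measurable \<mu>" and lim: "tends_in_measure \<mu> (\<lambda>n. T (u n)) h"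
  shows "tends_in_measure \<mu> (\<lambda>n. T (v n)) h"
  unfolding tends_in_measure_def
proof (intro allI impI)
  fix t :: real assume t: "t > 0"
  have ul: "u n \<in> Linf_b \<mu>" "v n \<in> Linf_b \<mu>" for n using u v unfolding approx_def by auto
  note [measurable] = T_measurable[OF ul(1)] T_measurable[OF ul(2)]
  have c: "c (t / 2) \<ge> 0" using W t unfolding weak_type_def by auto
  have "vanishing (\<lambda>n. emeasure \<mu> {x. norm (T (v n) x - T (u n) x) > t / 2})"
  proof (rule vanishing_bound)
    show "vanishing (\<lambda>n. Lp_mass \<mu> p (\<lambda>x. v n x - f x))" "vanishing (\<lambda>n. Lp_mass \<mu> p (\<lambda>x. u n x - f x))"
      using u v unfolding approx_def by auto
    show "c (t / 2) * 2 powr p \<ge> 0" using c by simp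
    show "emeasure \<mu> {x. norm (T (v n) x - T (u n) x) > t / 2} \<le>
      ennreal (c (t / 2) * 2 powr p) * (Lp_mass \<mu> p (\<lambda>x. v n x - f x) + Lp_mass \<mu> p (\<lambda>x. u n x - f x))" for n
      using t by (intro weak_type_diff[OF W _ ul(2) ul(1) f]) simp
  qed
  moreover have "vanishing (\<lambda>n. emeasure \<mu> {x \<in> space \<mu>. norm (T (u n) x - h x) > t / 2})"
    using t by (intro tends_in_measureD[OF lim]) simp
  ultimately show "vanishing (\<lambda>n. emeasure \<mu> {x \<in> space \<mu>. norm (T (v n) x - h x) > t})"
  proof (rule vanishing_add)
    fix n
    have s1: "{x \<in> space \<mu>. norm (T (v n) x - T (u n) x) > t / 2} \<in> sets \<mu>" by measurable
    have s2: "{x \<in> space \<mu>. norm (T (u n) x - h x) > t / 2} \<in> sets \<mu>" by measurable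
    have "{x \<in> space \<mu>. norm (T (v n) x - h x) > t} \<subseteq>
      {x \<in> space \<mu>. norm (T (v n) x - T (u n) x) > t / 2} \<union> {x \<in> space \<mu>. norm (T (u n) x - h x) > t / 2}"
    proof
      fix x assume "x \<in> {x \<in> space \<mu>. norm (T (v n) x - h x) > t}"
      moreover have "norm (T (v n) x - h x) \<le> norm (T (v n) x - T (u n) x) + norm (T (u n) x - h x)"
        using norm_triangle_ineq[of "T (v n) x - T (u n) x" "T (u n) x - h x"] by simp
      ultimately show "x \<in> {x \<in> space \<mu>. norm (T (v n) x - T (u n) x) > t / 2} \<union> {x \<in> space \<mu>. norm (T (u n) x - h x) > t / 2}"
        by auto
    qed
    then have "emeasure \<mu> {x \<in> space \<mu>. norm (T (v n) x - h x) > t} \<le>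
      emeasure \<mu> ({x \<in> space \<mu>. norm (T (v n) x - T (u n) x) > t / 2} \<union> {x \<in> space \<mu>. norm (T (u n) x - h x) > t / 2})"
      by (intro emeasure_mono sets.Un s1 s2)
    also have "\<dots> \<le> emeasure \<mu> {x \<in> space \<mu>. norm (T (v n) x - T (u n) x) > t / 2} + emeasure \<mu> {x \<in> space \<mu>. norm (T (u n) x - h x) > t / 2}"
      by (rule emeasure_subadditive[OF s1 s2])
    finally show "emeasure \<mu> {x \<in> space \<mu>. norm (T (v n) x - h x) > t} \<le>
      emeasure \<mu> {x. norm (T (v n) x - T (u n) x) > t / 2} + emeasure \<mu> {x \<in> space \<mu>. norm (T (u n) x - h x) > t / 2}"
      by simp
  qed
qed

text \<open>The choice is unspecified for \<open>f\<close> outside \<open>L\<^sup>p\<close> or when \<open>T\<close> is not of weak type.\<close>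

definition extension :: "real \<Rightarrow> ('a \<Rightarrow> complex) \<Rightarrow> 'a \<Rightarrow> complex" where
  "extension p f = (SOME h. h \<in> borel_measurable \<mu> \<and> (\<forall>u. approx p u f \<longrightarrow> tends_in_measure \<mu> (\<lambda>n. T (u n)) h))"

lemma extension_props:
  assumes W: "weak_type p c" and f: "f \<in> Lp_space \<mu> p"
  shows "extension p f \<in> borel_measurable \<mu>" "approx p u f \<Longrightarrow> tends_in_measure \<mu> (\<lambda>n. T (u n)) (extension p f)"
proof -
  have p: "p > 0" using W unfolding weak_type_def by auto
  have fm: "f \<in> borel_measurable \<mu>" using f Lp_space_iff[OF p] by auto
  obtain v where v: "approx p v f" using ex_approx[OF p f] by (elim exE conjE)
  obtain h \<sigma> where h: "h \<in> borel_measurable \<mu>" "tends_in_measure \<mu> (\<lambda>n. T (v n)) h"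
    "AE x in \<mu>. (\<lambda>k. T (v (\<sigma> k)) x) \<longlonglongrightarrow> h x" by (rule ex_limit_in_measure[OF W fm v])
  have "\<exists>h. h \<in> borel_measurable \<mu> \<and> (\<forall>u. approx p u f \<longrightarrow> tends_in_measure \<mu> (\<lambda>n. T (u n)) h)"
    using h(1) tends_in_measure_other_approx[OF W fm v _ h(1,2)] by blast
  from someI_ex[OF this] show "extension p f \<in> borel_measurable \<mu>"
    "approx p u f \<Longrightarrow> tends_in_measure \<mu> (\<lambda>n. T (u n)) (extension p f)"
    unfolding extension_def by auto
qed

lemma Linf_b_subset_Lp: "p > 0 \<Longrightarrow> f \<in> Linf_b \<mu> \<Longrightarrow> f \<in> Lp_space \<mu> p"
  using nn_integral_eq_integral[OF Linf_b_powr_integrable[of f p]] Linf_b_measurable[of f]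
  unfolding Lp_space_iff Lp_mass_def by simp

text \<open>Domination by \<open>f\<close> together with convergence almost everywhere is the form
  in which Fatou's lemma transfers bounds to the extension.\<close>

lemma extension_AE_limit:
  assumes W: "weak_type p c" and f: "f \<in> Lp_space \<mu> p"
  shows "\<exists>v. (\<forall>n. v n \<in> Linf_b \<mu>) \<and> (\<forall>n x. norm (v n x) \<le> norm (f x)) \<and>
    (AE x in \<mu>. (\<lambda>n. T (v n) x) \<longlonglongrightarrow> extension p f x)"
proof -
  have p: "p > 0" using W unfolding weak_type_def by auto
  have fm: "f \<in> borel_measurable \<mu>" using f Lp_space_iff[OF p] by auto
  obtain v where v: "approx p v f" and vle: "\<forall>n x. norm (v n x) \<le> norm (f x)" using ex_approx[OF p f] by (elim exE conjE)
  have vl: "v n \<in> Linf_b \<mu>" for n using v unfolding approx_def by blast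
  obtain h \<sigma> where h: "h \<in> borel_measurable \<mu>" "tends_in_measure \<mu> (\<lambda>n. T (v n)) h"
    "AE x in \<mu>. (\<lambda>k. T (v (\<sigma> k)) x) \<longlonglongrightarrow> h x" by (rule ex_limit_in_measure[OF W fm v])
  have "AE x in \<mu>. h x = extension p f x"
    using extension_props[OF W f] v by (intro tends_in_measure_unique[OF h(2)] T_measurable vl h(1)) auto
  with h(3) have "AE x in \<mu>. (\<lambda>k. T (v (\<sigma> k)) x) \<longlonglongrightarrow> extension p f x" by eventually_elim simp
  with vl vle show ?thesis by (intro exI[of _ "\<lambda>k. v (\<sigma> k)"] conjI allI) auto
qed

text \<open>Linear combinations of approximations approximate the linear combination, and limits in
  measure are unique almost everywhere.\<close>

lemma extension_linear:
  assumes W: "weak_type p c"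
  shows "linear_extension \<mu> T (Lp_space \<mu> p) (extension p)"
  unfolding linear_extension_def linear_operator_on_def
proof (intro conjI ballI allI impI)
  have p: "p > 0" using W unfolding weak_type_def by auto
  note fm = Lp_space_iff[OF p, THEN iffD1, THEN conjunct1]
  note E = extension_props[OF W]
  fix f assume f: "f \<in> Lp_space \<mu> p"
  show "extension p f \<in> borel_measurable \<mu>" by (rule E(1)[OF f])
  obtain u where u: "approx p u f" using ex_approx[OF p f] by (elim exE conjE)
  have ul: "u n \<in> Linf_b \<mu>" for n using u unfolding approx_def by blast
  fix g assume g: "g \<in> Lp_space \<mu> p"
  obtain v where v: "approx p v g" using ex_approx[OF p g] by (elim exE conjE)
  have vl: "v n \<in> Linf_b \<mu>" for n using v unfolding approx_def by blast
  { assume eq: "AE x in \<mu>. f x = g x"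
    have "Lp_mass \<mu> p (\<lambda>x. u n x - f x) = Lp_mass \<mu> p (\<lambda>x. u n x - g x)" for n
      by (rule Lp_mass_cong_AE) (use eq in eventually_elim, simp)
    then have "approx p u g" using u unfolding approx_def by simp
    then show "AE x in \<mu>. extension p f x = extension p g x"
      by (intro tends_in_measure_unique[of _ "\<lambda>n. T (u n)"] E f g u T_measurable ul) }
  fix a b :: complex
  define k where "k x = a * f x + b * g x" for x
  define w where "w n x = a * u n x + b * v n x" for n x
  note [measurable] = fm[OF f] fm[OF g] E(1)[OF f] E(1)[OF g] Linf_b_measurable[OF ul] Linf_b_measurable[OF vl]
    T_measurable[OF ul] T_measurable[OF vl]
  have wl: "w n \<in> Linf_b \<mu>" for n unfolding w_def[abs_def] by (intro Linf_b_lincomb ul vl)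
  note [measurable] = T_measurable[OF wl]
  have km[measurable]: "k \<in> borel_measurable \<mu>" unfolding k_def by measurable
  have mass2: "Lp_mass \<mu> p (\<lambda>x. a * F x + b * H x) \<le>
    ennreal (2 powr p * (norm a powr p + norm b powr p)) * (Lp_mass \<mu> p F + Lp_mass \<mu> p H)"
    if [measurable]: "F \<in> borel_measurable \<mu>" "H \<in> borel_measurable \<mu>" for F H
  proof -
    have "Lp_mass \<mu> p (\<lambda>x. a * F x + b * H x) \<le> ennreal (2 powr p) * (Lp_mass \<mu> p (\<lambda>x. a * F x) + Lp_mass \<mu> p (\<lambda>x. b * H x))"
      by (rule Lp_mass_add[OF p]) measurable
    also have "Lp_mass \<mu> p (\<lambda>x. a * F x) + Lp_mass \<mu> p (\<lambda>x. b * H x) =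
      ennreal (norm a powr p) * Lp_mass \<mu> p F + ennreal (norm b powr p) * Lp_mass \<mu> p H"
      by (simp add: Lp_mass_cmult[OF p])
    also have "\<dots> \<le> ennreal (norm a powr p + norm b powr p) * Lp_mass \<mu> p F + ennreal (norm a powr p + norm b powr p) * Lp_mass \<mu> p H"
      by (intro add_mono mult_right_mono ennreal_leI) auto
    also have "\<dots> = ennreal (norm a powr p + norm b powr p) * (Lp_mass \<mu> p F + Lp_mass \<mu> p H)" by (simp add: distrib_left)
    finally show ?thesis by (simp add: ennreal_mult mult.assoc mult_left_mono)
  qed
  have kL: "k \<in> Lp_space \<mu> p"
  proof -
    have "Lp_mass \<mu> p k \<le> ennreal (2 powr p * (norm a powr p + norm b powr p)) * (Lp_mass \<mu> p f + Lp_mass \<mu> p g)"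
      unfolding k_def[abs_def] by (rule mass2) measurable
    also have "\<dots> < \<infinity>" using f g unfolding Lp_space_iff[OF p] by (simp add: ennreal_mult_less_top)
    finally show ?thesis unfolding Lp_space_iff[OF p] using km by simp
  qed
  have wk: "approx p w k"
    unfolding approx_def
  proof (intro conjI allI wl)
    show "vanishing (\<lambda>n. Lp_mass \<mu> p (\<lambda>x. w n x - k x))"
    proof (rule vanishing_bound)
      show "vanishing (\<lambda>n. Lp_mass \<mu> p (\<lambda>x. u n x - f x))" "vanishing (\<lambda>n. Lp_mass \<mu> p (\<lambda>x. v n x - g x))"
        using u v unfolding approx_def by auto
      show "2 powr p * (norm a powr p + norm b powr p) \<ge> 0" by simp
      fix n
      have "Lp_mass \<mu> p (\<lambda>x. w n x - k x) = Lp_mass \<mu> p (\<lambda>x. a * (u n x - f x) + b * (v n x - g x))"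
        unfolding w_def k_def by (simp add: algebra_simps)
      also have "\<dots> \<le> ennreal (2 powr p * (norm a powr p + norm b powr p)) * (Lp_mass \<mu> p (\<lambda>x. u n x - f x) + Lp_mass \<mu> p (\<lambda>x. v n x - g x))"
        by (rule mass2) measurable
      finally show "Lp_mass \<mu> p (\<lambda>x. w n x - k x) \<le>
        ennreal (2 powr p * (norm a powr p + norm b powr p)) * (Lp_mass \<mu> p (\<lambda>x. u n x - f x) + Lp_mass \<mu> p (\<lambda>x. v n x - g x))" .
    qed
  qed
  let ?S = "\<lambda>x. a * extension p f x + b * extension p g x"
  have "tends_in_measure \<mu> (\<lambda>n. T (w n)) ?S"
    unfolding tends_in_measure_def
  proof (intro allI impI)
    fix t :: real assume t: "t > 0"
    \<comment> \<open>The summand 1 keeps the denominator positive when \<open>a\<close> and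
      \<open>b\<close> are 0; the factor 2 leaves a strict gap below \<open>t\<close>.\<close>
    define q where "q = t / (2 * (norm a + norm b + 1))"
    have ab: "norm a + norm b + 1 > 0" using norm_ge_zero[of a] norm_ge_zero[of b] by linarith
    have q: "q > 0" unfolding q_def using t ab by simp
    have "vanishing (\<lambda>n. emeasure \<mu> {x \<in> space \<mu>. norm (T (u n) x - extension p f x) > q})"
      "vanishing (\<lambda>n. emeasure \<mu> {x \<in> space \<mu>. norm (T (v n) x - extension p g x) > q})"
      by (rule tends_in_measureD[OF E(2)[OF f u] q], rule tends_in_measureD[OF E(2)[OF g v] q])
    then show "vanishing (\<lambda>n. emeasure \<mu> {x \<in> space \<mu>. norm (T (w n) x - ?S x) > t})"
    proof (rule vanishing_add)
      fix n
      let ?P = "{x \<in> space \<mu>. norm (T (u n) x - extension p f x) > q}"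
      let ?Q = "{x \<in> space \<mu>. norm (T (v n) x - extension p g x) > q}"
      have s: "?P \<in> sets \<mu>" "?Q \<in> sets \<mu>" by measurable
      have "AE x in \<mu>. x \<in> {x \<in> space \<mu>. norm (T (w n) x - ?S x) > t} \<longrightarrow> x \<in> ?P \<union> ?Q"
        using T_lincomb[OF ul[of n] vl[of n], of a b]
      proof eventually_elim
        case (elim x)
        show ?case
        proof (rule impI, rule ccontr)
          assume x: "x \<in> {x \<in> space \<mu>. norm (T (w n) x - ?S x) > t}" and "x \<notin> ?P \<union> ?Q"
          then have le: "norm (T (u n) x - extension p f x) \<le> q" "norm (T (v n) x - extension p g x) \<le> q" by auto
          have "T (w n) x - ?S x = a * (T (u n) x - extension p f x) + b * (T (v n) x - extension p g x)"
            using elim unfolding w_def[abs_def] by (simp add: algebra_simps)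
          then have "norm (T (w n) x - ?S x) \<le> norm a * norm (T (u n) x - extension p f x) + norm b * norm (T (v n) x - extension p g x)"
            by (metis norm_mult norm_triangle_ineq)
          also have "\<dots> \<le> norm a * q + norm b * q" using le by (intro add_mono mult_left_mono) auto
          also have "\<dots> \<le> (norm a + norm b + 1) * q" using q by (simp add: distrib_right)
          also have "\<dots> = t / 2" unfolding q_def mult.commute[of 2] using ab
            by (simp only: times_divide_eq_right divide_divide_eq_left[symmetric] nonzero_mult_div_cancel_left[OF less_imp_neq[OF ab, symmetric]])
          finally show False using x t by simp
        qed
      qed
      then have "emeasure \<mu> {x \<in> space \<mu>. norm (T (w n) x - ?S x) > t} \<le> emeasure \<mu> (?P \<union> ?Q)"
        using s by (intro emeasure_mono_AE) auto
      also have "\<dots> \<le> emeasure \<mu> ?P + emeasure \<mu> ?Q" by (rule emeasure_subadditive[OF s])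
      finally show "emeasure \<mu> {x \<in> space \<mu>. norm (T (w n) x - ?S x) > t} \<le> emeasure \<mu> ?P + emeasure \<mu> ?Q" .
    qed
  qed
  then have "AE x in \<mu>. extension p k x = ?S x"
    by (intro tends_in_measure_unique[OF E(2)[OF kL wk]] E(1)[OF kL]) measurable
  then show "AE x in \<mu>. extension p (\<lambda>y. a * f y + b * g y) x = a * extension p f x + b * extension p g x"
    unfolding k_def .
next
  fix f assume f: "f \<in> Linf_b \<mu>"
  have p: "p > 0" using W unfolding weak_type_def by auto
  have fL: "f \<in> Lp_space \<mu> p" by (rule Linf_b_subset_Lp[OF p f])
  have "approx p (\<lambda>n. f) f" unfolding approx_def vanishing_def using f p by (simp add: Lp_mass_def)
  then have "tends_in_measure \<mu> (\<lambda>n. T f) (extension p f)" by (rule extension_props(2)[OF W fL])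
  moreover have "tends_in_measure \<mu> (\<lambda>n. T f) (T f)" unfolding tends_in_measure_def vanishing_def by simp
  ultimately show "AE x in \<mu>. extension p f x = T f x"
    by (intro tends_in_measure_unique[of _ "\<lambda>n. T f"] T_measurable f extension_props(1)[OF W fL])
qed

end

subsection \<open>The equivalence\<close>

lemma enn_powr_1 [simp]: "enn_powr a 1 = a"
  unfolding enn_powr_def by (auto simp: less_top)

lemma Lp_norm_1: "Lp_norm M 1 f = (\<integral>\<^sup>+x. ennreal (norm (f x)) \<partial>M)"
  unfolding Lp_norm_def by simp

context CZ_space
begin

text \<open>The bound survives in the limit with the same \<open>C\<close>, because the
  approximating functions are dominated by \<open>f\<close> pointwise.\<close>

lemma weak11_imp_bounded_L1_weak_L1:
  assumes C: "weak11 C"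
  shows "bounded_L1_weak_L1 \<mu> T"
proof -
  have C0: "C > 0" using C unfolding weak11_def by blast
  have W: "weak_type 1 (\<lambda>s. C / s)"
    unfolding weak_type_def
  proof (intro conjI allI impI ballI)
    fix s :: real and g assume s: "s > 0" and g: "g \<in> Linf_b \<mu>"
    have "emeasure \<mu> {x. norm (T g x) > s} \<le> ennreal (C * (LINT x|\<mu>. norm (g x)) / s)"
      using C s g unfolding weak11_def by blast
    also have "\<dots> = ennreal (C / s) * ennreal (LINT x|\<mu>. norm (g x))"
      using C0 s by (subst ennreal_mult[symmetric]) (auto intro!: Bochner_Integration.integral_nonneg)
    also have "ennreal (LINT x|\<mu>. norm (g x)) = Lp_mass \<mu> 1 g"
      unfolding Lp_mass_def using nn_integral_norm_Linf_b[OF g] by simp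
    finally show "emeasure \<mu> {x. norm (T g x) > s} \<le> ennreal (C / s) * Lp_mass \<mu> 1 g" .
  qed (use C0 in auto)
  have "weak_Lp_norm \<mu> 1 (extension 1 f) \<le> ennreal C * Lp_norm \<mu> 1 f" if f: "f \<in> Lp_space \<mu> 1" for f
    unfolding weak_Lp_norm_def
  proof (rule SUP_least)
    fix t :: real assume "t \<in> {0<..}"
    then have t: "t > 0" by simp
    from extension_AE_limit[OF W f] obtain v where v: "\<forall>n. v n \<in> Linf_b \<mu>" "\<forall>n x. norm (v n x) \<le> norm (f x)"
      "AE x in \<mu>. (\<lambda>n. T (v n) x) \<longlonglongrightarrow> extension 1 f x" by (elim exE conjE)
    have "emeasure \<mu> {x \<in> space \<mu>. norm (extension 1 f x) > t} \<le> ennreal (C / t) * Lp_mass \<mu> 1 f"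
    proof (rule emeasure_level_AE_limit[OF _ _ v(3)])
      show "T (v n) \<in> borel_measurable \<mu>" for n using v(1) T_measurable by blast
      show "extension 1 f \<in> borel_measurable \<mu>" by (rule extension_props(1)[OF W f])
      have "emeasure \<mu> {x. norm (T (v n) x) > t} \<le> ennreal (C / t) * Lp_mass \<mu> 1 f" for n
      proof -
        have "emeasure \<mu> {x. norm (T (v n) x) > t} \<le> ennreal (C / t) * Lp_mass \<mu> 1 (v n)"
          using W t v(1) unfolding weak_type_def by blast
        also have "\<dots> \<le> ennreal (C / t) * Lp_mass \<mu> 1 f"
          using v(2) by (intro mult_left_mono Lp_mass_mono) auto
        finally show ?thesis .
      qed
      then show "\<forall>\<^sub>F n in sequentially. emeasure \<mu> {x \<in> space \<mu>. norm (T (v n) x) > t} \<le> ennreal (C / t) * Lp_mass \<mu> 1 f"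
        by simp
    qed
    then have "ennreal t * emeasure \<mu> {x \<in> space \<mu>. norm (extension 1 f x) > t} \<le> ennreal t * (ennreal (C / t) * Lp_mass \<mu> 1 f)"
      by (intro mult_left_mono) auto
    also have "\<dots> = ennreal C * Lp_mass \<mu> 1 f"
      unfolding mult.assoc[symmetric] using t C0 by (subst ennreal_mult[symmetric]) auto
    finally show "ennreal t * enn_powr (emeasure \<mu> {x \<in> space \<mu>. t < norm (extension 1 f x)}) (1 / 1) \<le> ennreal C * Lp_norm \<mu> 1 f"
      by (simp add: Lp_norm_1 Lp_mass_def)
  qed
  then show ?thesis unfolding bounded_L1_weak_L1_def using extension_linear[OF W] C0 by blast
qed

text \<open>Chebyshev's inequality first weakens the \<open>L\<^sup>2\<close> bound on
  \<open>Linf_b \<mu>\<close> to a weak type bound, which is enough to construct the extension;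
  Fatou's lemma then recovers the strong bound for it.\<close>

lemma weak11_imp_bounded_on_L2:
  assumes C: "weak11 C"
  shows "bounded_on_Lp \<mu> 2 T"
proof -
  obtain A where A: "A > 0"
    "\<And>f. f \<in> Linf_b \<mu> \<Longrightarrow> (\<integral>\<^sup>+x. ennreal ((norm (T f x))\<^sup>2) \<partial>\<mu>) \<le> ennreal A * (\<integral>\<^sup>+x. ennreal ((norm (f x))\<^sup>2) \<partial>\<mu>)"
    using weak11_imp_L2[OF C] by blast
  have p2: "norm z powr 2 = (norm z)\<^sup>2" for z :: complex by (cases "z = 0") (auto simp: powr_numeral)
  have M2: "Lp_mass \<mu> 2 f = (\<integral>\<^sup>+x. ennreal ((norm (f x))\<^sup>2) \<partial>\<mu>)" for f unfolding Lp_mass_def p2 ..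
  have W: "weak_type 2 (\<lambda>s. A / s\<^sup>2)"
    unfolding weak_type_def
  proof (intro conjI allI impI ballI)
    fix s :: real and g assume s: "s > 0" and g: "g \<in> Linf_b \<mu>"
    note [measurable] = T_measurable[OF g]
    have "{x. norm (T g x) > s} = {x. (norm (T g x))\<^sup>2 > s\<^sup>2}"
      using s by (auto intro: power_strict_mono dest: power_less_imp_less_base)
    then have "emeasure \<mu> {x. norm (T g x) > s} \<le> ennreal (1 / s\<^sup>2) * (\<integral>\<^sup>+x. ennreal ((norm (T g x))\<^sup>2) \<partial>\<mu>)"
      using s emeasure_level_le[of "\<lambda>x. (norm (T g x))\<^sup>2" "s\<^sup>2"] by simp
    also have "\<dots> \<le> ennreal (1 / s\<^sup>2) * (ennreal A * Lp_mass \<mu> 2 g)"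
      unfolding M2 by (intro mult_left_mono A(2) g) simp
    also have "\<dots> = ennreal (A / s\<^sup>2) * Lp_mass \<mu> 2 g"
      unfolding mult.assoc[symmetric] using A(1) by (subst ennreal_mult[symmetric]) auto
    finally show "emeasure \<mu> {x. norm (T g x) > s} \<le> ennreal (A / s\<^sup>2) * Lp_mass \<mu> 2 g" .
  qed (use A(1) in auto)
  have bd: "Lp_norm \<mu> 2 (extension 2 f) \<le> ennreal (sqrt A) * Lp_norm \<mu> 2 f" if f: "f \<in> Lp_space \<mu> 2" for f
  proof -
    from extension_AE_limit[OF W f] obtain v where v: "\<forall>n. v n \<in> Linf_b \<mu>" "\<forall>n x. norm (v n x) \<le> norm (f x)"
      "AE x in \<mu>. (\<lambda>n. T (v n) x) \<longlonglongrightarrow> extension 2 f x" by (elim exE conjE)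
    have Tm: "T (v n) \<in> borel_measurable \<mu>" for n using v(1) T_measurable by blast
    have "Lp_mass \<mu> 2 (extension 2 f) = (\<integral>\<^sup>+x. liminf (\<lambda>n. ennreal ((norm (T (v n) x))\<^sup>2)) \<partial>\<mu>)"
      unfolding M2
    proof (rule nn_integral_cong_AE)
      show "AE x in \<mu>. ennreal ((norm (extension 2 f x))\<^sup>2) = liminf (\<lambda>n. ennreal ((norm (T (v n) x))\<^sup>2))"
        using v(3)
      proof eventually_elim
        case (elim x)
        have "(\<lambda>n. ennreal ((norm (T (v n) x))\<^sup>2)) \<longlonglongrightarrow> ennreal ((norm (extension 2 f x))\<^sup>2)"
          by (intro tendsto_ennrealI tendsto_power tendsto_norm elim)
        then show ?case by (rule lim_imp_Liminf[OF sequentially_bot, symmetric])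
      qed
    qed
    also have "\<dots> \<le> liminf (\<lambda>n. \<integral>\<^sup>+x. ennreal ((norm (T (v n) x))\<^sup>2) \<partial>\<mu>)"
      using Tm by (intro nn_integral_liminf) measurable
    also have "\<dots> \<le> ennreal A * Lp_mass \<mu> 2 f"
    proof (rule Liminf_le[OF sequentially_bot], rule always_eventually, rule allI)
      fix n
      have "(\<integral>\<^sup>+x. ennreal ((norm (T (v n) x))\<^sup>2) \<partial>\<mu>) \<le> ennreal A * Lp_mass \<mu> 2 (v n)" unfolding M2 using v(1) A(2) by blast
      also have "\<dots> \<le> ennreal A * Lp_mass \<mu> 2 f" using v(2) by (intro mult_left_mono Lp_mass_mono) auto
      finally show "(\<integral>\<^sup>+x. ennreal ((norm (T (v n) x))\<^sup>2) \<partial>\<mu>) \<le> ennreal A * Lp_mass \<mu> 2 f" .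
    qed
    finally have le: "Lp_mass \<mu> 2 (extension 2 f) \<le> ennreal A * Lp_mass \<mu> 2 f" .
    have "Lp_mass \<mu> 2 f < \<infinity>" using f Lp_space_iff[of 2] by auto
    then obtain y where y: "Lp_mass \<mu> 2 f = ennreal y" "y \<ge> 0" by (cases "Lp_mass \<mu> 2 f") auto
    have "Lp_mass \<mu> 2 (extension 2 f) \<le> ennreal (A * y)" using le y A(1) by (simp add: ennreal_mult)
    moreover from this obtain z where z: "Lp_mass \<mu> 2 (extension 2 f) = ennreal z" "z \<ge> 0"
      by (cases "Lp_mass \<mu> 2 (extension 2 f)") (auto simp: top_unique)
    ultimately have zy: "z \<le> A * y" using y A(1) by (simp add: ennreal_le_iff)
    have "Lp_norm \<mu> 2 (extension 2 f) = ennreal (z powr (1/2))" "Lp_norm \<mu> 2 f = ennreal (y powr (1/2))"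
      using z y unfolding Lp_norm_def Lp_mass_def[symmetric] enn_powr_def by auto
    moreover have "z powr (1/2) \<le> sqrt A * y powr (1/2)"
      using zy z(2) y(2) A(1) by (simp add: powr_half_sqrt flip: real_sqrt_mult)
    ultimately show ?thesis using A(1) by (simp add: ennreal_mult[symmetric] ennreal_leI)
  qed
  show ?thesis unfolding bounded_on_Lp_def using extension_linear[OF W] bd A(1)
    by (intro exI[of _ "extension 2"] exI[of _ "sqrt A"]) auto
qed

text \<open>The given extension agrees with \<open>T\<close> almost everywhere on
  \<open>Linf_b \<mu>\<close>, and raising its norm bound to the power \<open>p\<close> undoes the
  root, hence \<open>C powr p\<close>.\<close>

lemma bounded_on_Lp_imp_Lp_bd:
  assumes bd: "bounded_on_Lp \<mu> p T" and p: "p > 1"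
  obtains C where "Lp_bd p C"
proof -
  obtain S C where S: "linear_extension \<mu> T (Lp_space \<mu> p) S" and C: "C > 0"
    and le: "\<And>f. f \<in> Lp_space \<mu> p \<Longrightarrow> Lp_norm \<mu> p (S f) \<le> ennreal C * Lp_norm \<mu> p f"
    using bd unfolding bounded_on_Lp_def by blast
  have "Lp_bd p (C powr p)"
    unfolding Lp_bd_def
  proof (intro conjI ballI)
    fix g assume g: "g \<in> Linf_b \<mu>"
    define y where "y = (LINT x|\<mu>. norm (g x) powr p)"
    have y0: "y \<ge> 0" unfolding y_def by (rule Bochner_Integration.integral_nonneg) auto
    have y: "Lp_mass \<mu> p g = ennreal y"
      unfolding Lp_mass_def y_def using p by (intro nn_integral_eq_integral Linf_b_powr_integrable g) auto
    have "AE x in \<mu>. S g x = T g x" using S g unfolding linear_extension_def by blast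
    then have ST: "Lp_mass \<mu> p (S g) = Lp_mass \<mu> p (T g)" by (intro Lp_mass_cong_AE) (auto elim: eventually_mono)
    have "Lp_norm \<mu> p (S g) \<le> ennreal C * Lp_norm \<mu> p g" using p by (intro le Linf_b_subset_Lp g) simp
    also have "Lp_norm \<mu> p g = ennreal (y powr (1/p))" using y y0 unfolding Lp_norm_def Lp_mass_def[symmetric] enn_powr_def by simp
    also have "ennreal C * ennreal (y powr (1/p)) = ennreal (C * y powr (1/p))" using C by (intro ennreal_mult[symmetric]) auto
    finally have n: "enn_powr (Lp_mass \<mu> p (T g)) (1/p) \<le> ennreal (C * y powr (1/p))"
      unfolding Lp_norm_def Lp_mass_def[symmetric] ST .
    then have "Lp_mass \<mu> p (T g) \<noteq> \<infinity>" unfolding enn_powr_def by (auto simp: top_unique)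
    then obtain z where z: "Lp_mass \<mu> p (T g) = ennreal z" "z \<ge> 0" by (cases "Lp_mass \<mu> p (T g)") auto
    have "ennreal (z powr (1/p)) \<le> ennreal (C * y powr (1/p))" using n z unfolding enn_powr_def by simp
    then have "z powr (1/p) \<le> C * y powr (1/p)" using C by (subst (asm) ennreal_le_iff) auto
    then have "(z powr (1/p)) powr p \<le> (C * y powr (1/p)) powr p" using p by (intro powr_mono2) auto
    then have "z \<le> C powr p * y" using p z(2) y0 C by (simp add: powr_powr powr_mult)
    then show "(\<integral>\<^sup>+x. ennreal (norm (T g x) powr p) \<partial>\<mu>) \<le> ennreal (C powr p * (LINT x|\<mu>. norm (g x) powr p))"
      using z unfolding Lp_mass_def y_def[symmetric] by (simp add: ennreal_leI)
  qed (use C in simp)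
  then show thesis by (rule that)
qed

lemma bounded_L1_weak_L1_imp_weak11:
  assumes bd: "bounded_L1_weak_L1 \<mu> T"
  obtains C where "weak11 C"
proof -
  obtain S C where S: "linear_extension \<mu> T (Lp_space \<mu> 1) S" and C: "C > 0"
    and le: "\<And>f. f \<in> Lp_space \<mu> 1 \<Longrightarrow> weak_Lp_norm \<mu> 1 (S f) \<le> ennreal C * Lp_norm \<mu> 1 f"
    using bd unfolding bounded_L1_weak_L1_def by blast
  have "weak11 C"
    unfolding weak11_def
  proof (intro conjI ballI allI impI)
    fix g and s :: real assume g: "g \<in> Linf_b \<mu>" and s: "s > 0"
    have gL: "g \<in> Lp_space \<mu> 1" by (rule Linf_b_subset_Lp[OF _ g]) simp
    have Sm: "S g \<in> borel_measurable \<mu>" using S gL unfolding linear_extension_def linear_operator_on_def by blast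
    have eq: "AE x in \<mu>. S g x = T g x" using S g unfolding linear_extension_def by blast
    let ?E = "{x \<in> space \<mu>. norm (S g x) > s}"
    have Em: "?E \<in> sets \<mu>" using Sm by measurable
    have "ennreal s * emeasure \<mu> ?E \<le> weak_Lp_norm \<mu> 1 (S g)"
      unfolding weak_Lp_norm_def using s by (intro SUP_upper2[of s]) auto
    also have "\<dots> \<le> ennreal C * ennreal (LINT x|\<mu>. norm (g x))"
      using le[OF gL] nn_integral_norm_Linf_b[OF g] by (simp add: Lp_norm_1)
    also have "\<dots> = ennreal (C * (LINT x|\<mu>. norm (g x)))" using C by (simp add: ennreal_mult')
    finally have "ennreal (1 / s) * (ennreal s * emeasure \<mu> ?E) \<le> ennreal (1 / s) * ennreal (C * (LINT x|\<mu>. norm (g x)))"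
      by (rule mult_left_mono) simp
    moreover have "ennreal (1 / s) * (ennreal s * emeasure \<mu> ?E) = emeasure \<mu> ?E"
      unfolding mult.assoc[symmetric] using s by (subst ennreal_mult[symmetric]) auto
    moreover have "ennreal (1 / s) * ennreal (C * (LINT x|\<mu>. norm (g x))) = ennreal (C * (LINT x|\<mu>. norm (g x)) / s)"
      using s C by (subst ennreal_mult[symmetric]) (auto intro!: mult_nonneg_nonneg Bochner_Integration.integral_nonneg)
    moreover have "emeasure \<mu> {x. norm (T g x) > s} \<le> emeasure \<mu> ?E"
      using eq by (intro emeasure_mono_AE Em) (auto elim: eventually_mono)
    ultimately show "emeasure \<mu> {x. norm (T g x) > s} \<le> ennreal (C * (LINT x|\<mu>. norm (g x)) / s)" by simp
  qed (rule C)
  then show thesis by (rule that)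
qed

text \<open>All implications pass through \<open>weak11\<close>: an \<open>L\<^sup>p\<close> bound
  with \<open>p > 1\<close> or the weak type bound yields it, and it yields both the weak type bound
  and the case \<open>p = 2\<close>, which is itself an instance of the middle statement.\<close>

theorem boundedness_equivalence:
  "(bounded_on_Lp \<mu> 2 T \<longleftrightarrow> (\<exists>p>1. bounded_on_Lp \<mu> p T)) \<and>
   ((\<exists>p>1. bounded_on_Lp \<mu> p T) \<longleftrightarrow> bounded_L1_weak_L1 \<mu> T)"
proof -
  have A: "\<exists>C. weak11 C" if "p > 1" "bounded_on_Lp \<mu> p T" for p
    using bounded_on_Lp_imp_Lp_bd[OF that(2,1)] Lp_imp_weak11[OF _ that(1)] by metis
  have B: "\<exists>C. weak11 C" if "bounded_L1_weak_L1 \<mu> T"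
    using bounded_L1_weak_L1_imp_weak11[OF that] by metis
  have "\<exists>p>1. bounded_on_Lp \<mu> p T" if "bounded_on_Lp \<mu> 2 T"
    using that by (intro exI[of _ 2]) simp
  with A B weak11_imp_bounded_L1_weak_L1 weak11_imp_bounded_on_L2 show ?thesis by blast
qed

end

theorem theorem1p1:
  fixes \<mu> :: "'a::{metric_space, second_countable_topology} measure"
    and \<Lambda> :: "'a \<Rightarrow> real \<Rightarrow> real"
    and K :: "'a \<Rightarrow> 'a \<Rightarrow> complex"
    and T :: "('a \<Rightarrow> complex) \<Rightarrow> 'a \<Rightarrow> complex"
  assumes "sets \<mu> = sets borel"
    and "upper_doubling \<mu> \<Lambda>"
    and "geometrically_doubling TYPE('a)"
    and "\<forall>x. emeasure \<mu> {x} = 0"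
    and "standard_kernel \<Lambda> K"
    and "CZ_operator \<mu> K T"
  shows "(bounded_on_Lp \<mu> 2 T \<longleftrightarrow> (\<exists>p>1. bounded_on_Lp \<mu> p T)) \<and>
         ((\<exists>p>1. bounded_on_Lp \<mu> p T) \<longleftrightarrow> bounded_L1_weak_L1 \<mu> T)"
proof -
  from assms(2) obtain C1 C2 where Lam: "\<forall>x. \<forall>r>0. \<Lambda> x r > 0" "\<forall>x. mono_on {0<..} (\<Lambda> x)"
    "\<forall>x. \<forall>r>0. emeasure \<mu> (ball x r) \<le> ennreal (\<Lambda> x r)"
    and C1: "C1 > 0" "\<forall>x. \<forall>r>0. \<Lambda> x r \<le> C1 * \<Lambda> x (r / 2)"
    and C2: "C2 > 0" "\<forall>x y. \<forall>r>0. dist x y \<le> r \<longrightarrow> \<Lambda> x r \<le> C2 * \<Lambda> y r"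
    unfolding upper_doubling_def by (elim conjE exE)
  from assms(3) obtain N0 where N0: "\<forall>x::'a. \<forall>r>0. \<exists>Y. finite Y \<and> card Y \<le> N0 \<and> ball x r \<subseteq> (\<Union>y\<in>Y. ball y (r / 2))"
    unfolding geometrically_doubling_def by (elim exE conjE)
  from assms(5) obtain \<tau> C where \<tau>: "0 < \<tau>" and C: "C > 0"
    and K1: "\<forall>x y. x \<noteq> y \<longrightarrow> norm (K x y) \<le> C / \<Lambda> x (dist x y)"
    and K2: "\<forall>x x' y. x \<noteq> y \<and> dist x y \<ge> 2 * dist x x' \<longrightarrow>
           norm (K x y - K x' y) + norm (K y x - K y x')
             \<le> C * (dist x x' powr \<tau> / (dist x y powr \<tau> * \<Lambda> x (dist x y)))"
    unfolding standard_kernel_def by (elim exE conjE)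
  \<comment> \<open>As \<open>32 = 2 ^ 5\<close>, five applications of the doubling inequality for
    \<open>\<Lambda>\<close> give \<open>C1 ^ 5\<close>; \<open>C2\<close> is the constant for the
    change of centre.\<close>
  define L where "L = max 1 (max (C1 ^ 5) C2)"
  have L: "1 \<le> L" "C1 ^ 5 \<le> L" "C2 \<le> L" unfolding L_def by auto
  \<comment> \<open>As \<open>1024 = 2 ^ 10\<close>, ten halvings of the radius replace
    \<open>N0\<close> by \<open>N0 ^ 10\<close>.\<close>
  define \<beta> where "\<beta> = max (2 * real (N0 ^ 10)) (2 * L\<^sup>2)"
  interpret CZ_space \<mu> \<Lambda> L \<beta> "N0 ^ 10" K T C \<tau>
  proof
    show "sets \<mu> = sets borel" by fact
    show "\<Lambda> x r > 0" if "r > 0" for x r using Lam(1) that by blast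
    show "\<Lambda> x r \<le> \<Lambda> x s" if "0 < r" "r \<le> s" for x r s
      using Lam(2)[rule_format, of x] that unfolding mono_on_def by simp
    show "emeasure \<mu> (ball x r) \<le> ennreal (\<Lambda> x r)" if "0 < r" for x r using Lam(3) that by blast
    show "1 \<le> L" by fact
    show "\<Lambda> x (32 * r) \<le> L * \<Lambda> x r" if r: "0 < r" for x r
    proof -
      have "\<Lambda> x (2 ^ k * r) \<le> C1 ^ k * \<Lambda> x r" for k
      proof (induction k)
        case (Suc k)
        have "2 ^ Suc k * r > 0" using r by simp
        then have "\<Lambda> x (2 ^ Suc k * r) \<le> C1 * \<Lambda> x (2 ^ Suc k * r / 2)" using C1(2) by blast
        also have "\<dots> = C1 * \<Lambda> x (2 ^ k * r)" by simp
        also have "\<dots> \<le> C1 * (C1 ^ k * \<Lambda> x r)" using Suc C1(1) by (intro mult_left_mono) auto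
        finally show ?case by (simp add: mult.assoc)
      qed simp
      from this[of 5] have "\<Lambda> x (32 * r) \<le> C1 ^ 5 * \<Lambda> x r" by simp
      also have "\<dots> \<le> L * \<Lambda> x r" using L(2) Lam(1) r by (intro mult_right_mono) (auto intro: less_imp_le)
      finally show ?thesis .
    qed
    show "\<Lambda> x r \<le> L * \<Lambda> y r" if r: "0 < r" "dist x y \<le> r" for x y r
    proof -
      have "\<Lambda> x r \<le> C2 * \<Lambda> y r" using C2(2) r by blast
      also have "\<dots> \<le> L * \<Lambda> y r" using L(3) Lam(1) r(1) by (intro mult_right_mono) (auto intro: less_imp_le)
      finally show ?thesis .
    qed
    show "\<exists>Y. finite Y \<and> card Y \<le> N0 ^ 10 \<and> ball x r \<subseteq> (\<Union>y\<in>Y. ball y (r / 1024))" if "0 < r" for x :: 'a and r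
      using iterated_ball_cover[where N = N0 and q = 2 and r = r and x = x and k = 10] N0 that by simp
    show "2 * real (N0 ^ 10) \<le> \<beta>" "2 * L\<^sup>2 \<le> \<beta>" unfolding \<beta>_def by auto
    show "C > 0" "\<tau> > 0" by fact+
    show "norm (K x y) \<le> C / \<Lambda> x (dist x y)" if "x \<noteq> y" for x y using K1 that by blast
    show "norm (K x y - K x' y) + norm (K y x - K y x') \<le> C * (dist x x' powr \<tau> / (dist x y powr \<tau> * \<Lambda> x (dist x y)))"
      if "x \<noteq> y" "dist x y \<ge> 2 * dist x x'" for x y x' using K2 that by blast
    show "CZ_operator \<mu> K T" by fact
  qed
  show ?thesis by (rule boundedness_equivalence)
qed

end
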